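(* Let $(X_t,Y_t)_{t\geq 0}$ be a two-dimensional Lévy process with characteristic triple $(b,\Sigma,\nu)$. Define $\rho=\Sigma_{12}/\sqrt{\Sigma_{11}\Sigma_{22}}$ if $\Sigma_{11}\Sigma_{22}>0$ and $\rho=0$ if $\Sigma_{11}\Sigma_{22}=0$. Let $\mathrm{Op}(\nu)$ be the minimal constant $s\ge 0$ such that the inequality \[\int_{\mathbb{R}^2}\varphi(x)\psi(y)\,\nu(\mathrm{d}x,\mathrm{d}y)\leq s\sqrt{\int_{\mathbb{R}^2}(\varphi(x))^2\,\nu(\mathrm{d}x,\mathrm{d}y)\int_{\mathbb{R}^2}(\psi(y))^2\,\nu(\mathrm{d}x,\mathrm{d}y)}\] holds for all measurable functions $\varphi,\psi:\mathbb{R}\to\mathbb{R}$ such that $\varphi(0)=\psi(0)=0$ and both integrals on the right-hand side are finite. Then \[R\big((X_t)_{t\geq 0},(Y_t)_{t\geq 0}\big)=\max(|\rho|,\mathrm{Op}(\nu)).\]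
   Context: For two random elements $X,Y$ (defined on a common probability space, with values in arbitrary measurable spaces), the maximal correlation coefficient is $R(X,Y)=\sup \rho(\varphi(X),\psi(Y))$, where here $\rho(\cdot,\cdot)$ denotes the Pearson correlation coefficient and the supremum is over all real-valued measurable functions $\varphi,\psi$ such that $\varphi(X)$ and $\psi(Y)$ are square-integrable with positive variance. If $X$ or $Y$ is degenerate (i.e. every real measurable function of it is almost surely constant), one sets $R(X,Y)=0$. A two-dimensional Lévy process $(X_t,Y_t)_{t\ge 0}$ (started at $0$, with càdlàg paths) has characteristic triple $(b,\Sigma,\nu)$ when for all $u_1,u_2\in\mathbb{R}$ and $t\ge0$, \[E[e^{i(u_1X_t+u_2Y_t)}]=\exp\Big(t\Big\{i(b_1u_1+b_2u_2)-\tfrac12\sum_{j,k=1,2}\Sigma_{jk}u_ju_k+\int_{\mathbb{R}^2\setminus\{(0,0)\}}\big(e^{i(u_1x+u_2y)}-1-i(u_1x+u_2y)1_{\{0<x^2+y^2\le 1\}}\big)\nu(\mathrm{d}x,\mathrm{d}y)\Big\}\Big),\] where $b\in\mathbb{R}^2$, $\Sigma$ is a symmetric positive semidefinite $2\times2$ matrix, and $\nu$ is a measure on $\mathbb{R}^2\setminus\{(0,0)\}$ (viewed as a measure on $\mathbb{R}^2$ with no mass at the origin) with $\int\min(1,x^2+y^2)\,\nu(\mathrm{d}x,\mathrm{d}y)<\infty$. The processes $(X_t)_{t\ge0}$ and $(Y_t)_{t\ge0}$ are random elements of the space of real càdlàg functions on $[0,\infty)$ with the Skorokhod Borel $\sigma$-field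 (equivalently, the $\sigma$-field generated by the coordinate maps). *)

theory Defs
  imports "HOL-Probability.Probability"
begin

subsection \<open>Maximal correlation\<close>

definition pearson_correlation :: "'a measure \<Rightarrow> ('a \<Rightarrow> real) \<Rightarrow> ('a \<Rightarrow> real) \<Rightarrow> real" where
  "pearson_correlation M U V =
     prob_space.expectation M
       (\<lambda>\<omega>. (U \<omega> - prob_space.expectation M U) * (V \<omega> - prob_space.expectation M V))
     / sqrt (prob_space.variance M U * prob_space.variance M V)"

definition degenerate :: "'a measure \<Rightarrow> 'b measure \<Rightarrow> ('a \<Rightarrow> 'b) \<Rightarrow> bool" where
  "degenerate M N X \<longleftrightarrow>
     (\<forall>\<phi>\<in>borel_measurable N. \<exists>c::real. AE \<omega> in M. \<phi> (X \<omega>) = c)"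

text \<open>
  Of the measures \<open>N\<^sub>X\<close> and \<open>N\<^sub>Y\<close> on the value spaces, only the measurable structure matters.
  If neither element is degenerate, the set below is nonempty (for instance, it contains a
  value obtained from bounded \<open>\<phi>\<close> and \<open>\<psi>\<close>) and bounded above by 1, so that the supremum of
  reals is the intended one.
\<close>

definition maximal_correlation ::
  "'a measure \<Rightarrow> 'b measure \<Rightarrow> 'c measure \<Rightarrow> ('a \<Rightarrow> 'b) \<Rightarrow> ('a \<Rightarrow> 'c) \<Rightarrow> real" where
  "maximal_correlation M N\<^sub>X N\<^sub>Y X Y =
     (if degenerate M N\<^sub>X X \<or> degenerate M N\<^sub>Y Y then 0
      else Sup {pearson_correlation M (\<lambda>\<omega>. \<phi> (X \<omega>)) (\<lambda>\<omega>. \<psi> (Y \<omega>)) | \<phi> \<psi>.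
             \<phi> \<in> borel_measurable N\<^sub>X \<and> \<psi> \<in> borel_measurable N\<^sub>Y \<and>
             integrable M (\<lambda>\<omega>. (\<phi> (X \<omega>))\<^sup>2) \<and> integrable M (\<lambda>\<omega>. (\<psi> (Y \<omega>))\<^sup>2) \<and>
             prob_space.variance M (\<lambda>\<omega>. \<phi> (X \<omega>)) > 0 \<and>
             prob_space.variance M (\<lambda>\<omega>. \<psi> (Y \<omega>)) > 0})"


subsection \<open>Path space\<close>

text \<open>Time is \<open>[0, \<infinity>)\<close>; the values of a path at negative times play no role.\<close>

definition cadlag :: "(real \<Rightarrow> 'b::topological_space) \<Rightarrow> bool" where
  "cadlag f \<longleftrightarrow> (\<forall>t\<ge>0. (f \<longlongrightarrow> f t) (at_right t)) \<and> (\<forall>t>0. \<exists>l. (f \<longlongrightarrow> l) (at_left t))"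

text \<open>
  The space of real cadlag functions on \<open>[0, \<infinity>)\<close>, represented by functions that are
  \<^const>\<open>undefined\<close> at negative times, with the \<open>\<sigma>\<close>-field generated by the coordinate maps
  (the trace of the product \<open>\<sigma>\<close>-field). It serves only as a measurable space.
\<close>

definition cadlag_space :: "(real \<Rightarrow> real) measure" where
  "cadlag_space = restrict_space (Pi\<^sub>M {0..} (\<lambda>_. borel)) {f. cadlag f}"

definition sample_path :: "(real \<Rightarrow> 'a \<Rightarrow> real) \<Rightarrow> 'a \<Rightarrow> real \<Rightarrow> real" where
  "sample_path X \<omega> = (\<lambda>t\<in>{0..}. X t \<omega>)"


subsection \<open>Levy processes\<close>

definition levy_process :: "'a measure \<Rightarrow> (real \<Rightarrow> 'a \<Rightarrow> 'b::euclidean_space) \<Rightarrow> bool" where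
  "levy_process M Z \<longleftrightarrow>
     prob_space M \<and>
     (\<forall>t\<ge>0. Z t \<in> borel_measurable M) \<and>
     (AE \<omega> in M. Z 0 \<omega> = 0) \<and>
     (\<forall>\<omega>\<in>space M. cadlag (\<lambda>t. Z t \<omega>)) \<and>
     (\<forall>(n::nat) \<tau>. 0 \<le> \<tau> 0 \<and> mono \<tau> \<longrightarrow>
        prob_space.indep_vars M (\<lambda>_. borel) (\<lambda>i \<omega>. Z (\<tau> (Suc i)) \<omega> - Z (\<tau> i) \<omega>) {..<n}) \<and>
     (\<forall>s\<ge>0. \<forall>t\<ge>0. distr M borel (\<lambda>\<omega>. Z (s + t) \<omega> - Z s \<omega>) = distr M borel (Z t))"

definition levy_measure :: "(real \<times> real) measure \<Rightarrow> bool" where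
  "levy_measure \<nu> \<longleftrightarrow>
     sets \<nu> = sets borel \<and> emeasure \<nu> {(0, 0)} = 0 \<and>
     (\<integral>\<^sup>+(x, y). ennreal (min 1 (x\<^sup>2 + y\<^sup>2)) \<partial>\<nu>) < \<infinity>"

definition characteristic_exponent ::
  "real ^ 2 \<Rightarrow> real ^ 2 ^ 2 \<Rightarrow> (real \<times> real) measure \<Rightarrow> real ^ 2 \<Rightarrow> complex" where
  "characteristic_exponent b \<Sigma> \<nu> u =
     \<i> * complex_of_real (b $ 1 * u $ 1 + b $ 2 * u $ 2)
     - complex_of_real (1 / 2 * (\<Sum>j\<in>UNIV. \<Sum>k\<in>UNIV. \<Sigma> $ j $ k * u $ j * u $ k))
     + (LINT (x, y)|\<nu>. iexp (u $ 1 * x + u $ 2 * y) - 1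
          - \<i> * complex_of_real ((u $ 1 * x + u $ 2 * y)
                * of_bool (0 < x\<^sup>2 + y\<^sup>2 \<and> x\<^sup>2 + y\<^sup>2 \<le> 1)))"

definition has_characteristic_triple ::
  "'a measure \<Rightarrow> (real \<Rightarrow> 'a \<Rightarrow> real \<times> real) \<Rightarrow>
     real ^ 2 \<Rightarrow> real ^ 2 ^ 2 \<Rightarrow> (real \<times> real) measure \<Rightarrow> bool" where
  "has_characteristic_triple M Z b \<Sigma> \<nu> \<longleftrightarrow>
     transpose \<Sigma> = \<Sigma> \<and> (\<forall>v. 0 \<le> v \<bullet> (\<Sigma> *v v)) \<and> levy_measure \<nu> \<and>
     (\<forall>u. \<forall>t\<ge>0.
        (LINT \<omega>|M. iexp (u $ 1 * fst (Z t \<omega>) + u $ 2 * snd (Z t \<omega>)))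
        = exp (complex_of_real t * characteristic_exponent b \<Sigma> \<nu> u))"


subsection \<open>The constants determined by the triple\<close>

definition gaussian_correlation :: "real ^ 2 ^ 2 \<Rightarrow> real" where
  "gaussian_correlation \<Sigma> =
     (if \<Sigma> $ 1 $ 1 * \<Sigma> $ 2 $ 2 > 0 then \<Sigma> $ 1 $ 2 / sqrt (\<Sigma> $ 1 $ 1 * \<Sigma> $ 2 $ 2) else 0)"

text \<open>
  The least constant exists: by Cauchy--Schwarz, the set of admissible constants contains 1,
  and it is closed and bounded below.
\<close>

definition Op :: "(real \<times> real) measure \<Rightarrow> real" where
  "Op \<nu> = (LEAST s. 0 \<le> s \<and>
     (\<forall>\<phi>\<in>borel_measurable borel. \<forall>\<psi>\<in>borel_measurable borel.
        \<phi> 0 = 0 \<and> \<psi> 0 = 0 \<and>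
        integrable \<nu> (\<lambda>(x, y). (\<phi> x)\<^sup>2) \<and> integrable \<nu> (\<lambda>(x, y). (\<psi> y)\<^sup>2) \<longrightarrow>
        (LINT (x, y)|\<nu>. \<phi> x * \<psi> y)
        \<le> s * sqrt ((LINT (x, y)|\<nu>. (\<phi> x)\<^sup>2) * (LINT (x, y)|\<nu>. (\<psi> y)\<^sup>2))))"

end

theory Submission
  imports Defs
begin

text \<open>
  The proof avoids the Levy--Ito decomposition and works with the characteristic exponent only.

  Upper bound. Let \<open>F\<close> and \<open>G\<close> be trigonometric polynomials in finitely many increments of \<open>X\<close> and of
  \<open>Y\<close>. Replacing both by their conditional expectations given the first fraction \<open>s\<close> of each increment
  interpolates between \<open>E F \<cdot> E G\<close> at \<open>s = 0\<close> and \<open>E (F G)\<close> at \<open>s = 1\<close>, and the derivative in \<open>s\<close> is the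
  expectation of the carre du champ
  \<open>\<Gamma>(F, G) = \<Sigma>\<^sub>1\<^sub>2 \<partial>F \<partial>G + \<integral> (F(\<cdot> + x) - F) (G(\<cdot> + y) - G) d\<nu>\<close>.
  The definitions of \<open>\<rho>\<close> and \<open>Op \<nu>\<close> give \<open>\<Gamma>(F, G) \<le> C/2 (\<Gamma>(F, F) + \<Gamma>(G, G))\<close> pointwise, with
  \<open>C = max \<bar>\<rho>\<bar> (Op \<nu>)\<close>. Integrating in \<open>s\<close> yields \<open>Cov(F, G) \<le> C/2 (Var F + Var G)\<close>, which extends to all
  square-integrable functionals because trigonometric polynomials are dense in \<open>L\<^sup>2\<close>.

  Lower bound. Conversely, an inequality of this form for \<open>f(X\<^sub>t)\<close> and \<open>g(Y\<^sub>t)\<close> gives the inequality for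
  \<open>\<Gamma>\<close> at the origin after division by \<open>t \<rightarrow> 0\<close>. The test functions \<open>sin (n x) / n\<close> isolate the Gaussian
  part, and trigonometric polynomials multiplied by \<open>1 - cos (x / n)\<close> isolate the jump part.
\<close>

subsection \<open>Square-integrable functions\<close>

text \<open>Estimates are carried in the additive form \<open>B \<le> C / 2 * (a + b)\<close> rather
  than as \<open>B \<le> C * sqrt (a * b)\<close>. The additive form is linear in the squared terms,
  so it can be summed over Gaussian and jump part, over real and imaginary part and over grid
  intervals, and integrated in \<omega> and in the interpolation time, always with the same
  \<open>C\<close>. Nothing is lost: multiplying one function by \<open>sqrt l\<close> and dividing
  the other by it leaves \<open>B\<close> unchanged and turns \<open>a + b\<close> into
  \<open>l * a + b / l\<close>, whose infimum over \<open>l > 0\<close> is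
  \<open>2 * sqrt (a * b)\<close>. Characters are the right test functions because conditioning on
  an earlier time multiplies a character by a deterministic factor, which the exponent alone
  determines. Every covariance of test functions is thus a finite sum of exponentials in the time
  parameter, and its derivative is computed by hand and only afterwards recognised as an expectation
  or as a carre du champ; no differentiation under an expectation occurs.\<close>

lemma le_sqrt_of_scaled:
  fixes a b B C :: real
  assumes "0 \<le> a" "0 \<le> b" "0 \<le> C"
    and le: "\<And>l. 0 < l \<Longrightarrow> B \<le> C / 2 * (l * a + b / l)"
  shows "B \<le> C * sqrt (a * b)"
proof (cases "a = 0 \<or> b = 0")
  case True
  have "B \<le> 0"
  proof (rule field_le_epsilon)
    fix e :: real assume e: "0 < e"
    \<comment> \<open>An optimal \<open>l\<close> need not exist here; \<open>K / e\<close> or its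
      reciprocal makes the surviving term at most \<open>e\<close>, and the summand 1 keeps
      \<open>K\<close> positive.\<close>
    define K where "K = C * (a + b) + 1"
    have K: "K > 0" using assms by (simp add: K_def add_nonneg_pos)
    show "B \<le> 0 + e"
    proof (cases "a = 0")
      case True
      have "B \<le> C / 2 * (b / (K / e))" using le[of "K/e"] K e True by simp
      also have "\<dots> = C * b / (2 * K) * e" by simp
      also have "\<dots> \<le> 1 * e"
        using K e assms True by (intro mult_right_mono) (auto simp: K_def divide_simps)
      finally show ?thesis by simp
    next
      case False
      hence "b = 0" using True \<open>a = 0 \<or> b = 0\<close> by simp
      have "B \<le> C / 2 * (e / K * a)" using le[of "e/K"] K e \<open>b = 0\<close> by simp
      also have "\<dots> = C * a / (2 * K) * e" by simp
      also have "\<dots> \<le> 1 * e"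
        using K e assms \<open>b = 0\<close> by (intro mult_right_mono) (auto simp: K_def divide_simps)
      finally show ?thesis by simp
    qed
  qed
  with True show ?thesis by auto
next
  case False
  with assms have ab: "a > 0" "b > 0" by auto
  \<comment> \<open>This \<open>l\<close> is the minimiser of \<open>l * a + b / l\<close>; both
    terms become \<open>sqrt a * sqrt b\<close>.\<close>
  have "B \<le> C / 2 * (sqrt b / sqrt a * a + b / (sqrt b / sqrt a))"
    using ab by (intro le) simp
  also have "sqrt b / sqrt a * a = sqrt a * sqrt b"
    using ab by (simp add: field_simps)
  also have "b / (sqrt b / sqrt a) = sqrt a * sqrt b"
    using ab by (simp add: field_simps)
  finally show ?thesis by (simp add: real_sqrt_mult)
qed

definition square_integrable :: "'a measure \<Rightarrow> ('a \<Rightarrow> real) \<Rightarrow> bool" where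
  "square_integrable M f \<longleftrightarrow> f \<in> borel_measurable M \<and> integrable M (\<lambda>x. (f x)\<^sup>2)"

lemma square_integrable_measurable [measurable_dest]:
  "square_integrable M f \<Longrightarrow> f \<in> borel_measurable M"
  by (simp add: square_integrable_def)

lemma square_integrable_mult:
  assumes "square_integrable M f" "square_integrable M g"
  shows "integrable M (\<lambda>x. f x * g x)"
proof (rule Bochner_Integration.integrable_bound)
  show "integrable M (\<lambda>x. (f x)\<^sup>2 + (g x)\<^sup>2)"
    using assms by (simp add: square_integrable_def)
  have "\<bar>a * b\<bar> \<le> a\<^sup>2 + b\<^sup>2" for a b :: real
  proof -
    have "2 * (\<bar>a\<bar> * \<bar>b\<bar>) \<le> a\<^sup>2 + b\<^sup>2" "0 \<le> \<bar>a\<bar> * \<bar>b\<bar>"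
      using sum_squares_bound[of "\<bar>a\<bar>" "\<bar>b\<bar>"] by simp_all
    then show ?thesis unfolding abs_mult by linarith
  qed
  then show "AE x in M. norm (f x * g x) \<le> norm ((f x)\<^sup>2 + (g x)\<^sup>2)"
    by (auto intro: order_trans[OF _ abs_ge_self])
qed (use assms in \<open>auto simp: square_integrable_def\<close>)

lemma square_integrable_cmult:
  "square_integrable M f \<Longrightarrow> square_integrable M (\<lambda>x. c * f x)"
  by (auto simp: square_integrable_def power_mult_distrib)

lemma square_integrable_add:
  assumes "square_integrable M f" "square_integrable M g"
  shows "square_integrable M (\<lambda>x. f x + g x)"
  using assms square_integrable_mult[OF assms]
  by (auto simp: square_integrable_def power2_sum mult.assoc)

lemma square_integrable_diff:
  assumes "square_integrable M f" "square_integrable M g"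
  shows "square_integrable M (\<lambda>x. f x - g x)"
  using square_integrable_add[OF assms(1) square_integrable_cmult[OF assms(2), of "-1"]] by simp

lemma square_integrable_bound:
  assumes "square_integrable M g" "f \<in> borel_measurable M" "\<And>x. x \<in> space M \<Longrightarrow> \<bar>f x\<bar> \<le> \<bar>g x\<bar>"
  shows "square_integrable M f"
  unfolding square_integrable_def
proof
  show "integrable M (\<lambda>x. (f x)\<^sup>2)"
  proof (rule Bochner_Integration.integrable_bound)
    show "integrable M (\<lambda>x. (g x)\<^sup>2)" using assms(1) by (simp add: square_integrable_def)
    show "AE x in M. norm ((f x)\<^sup>2) \<le> norm ((g x)\<^sup>2)"
      using assms(3) by (intro AE_I2) (simp add: abs_le_square_iff)
  qed (use assms(2) in measurable)
qed (fact assms(2))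

lemma integral_square_add_le:
  assumes "square_integrable M f" "square_integrable M g"
  shows "(LINT x|M. (f x + g x)\<^sup>2) \<le> 2 * (LINT x|M. (f x)\<^sup>2) + 2 * (LINT x|M. (g x)\<^sup>2)"
proof -
  have "(LINT x|M. (f x + g x)\<^sup>2) \<le> (LINT x|M. 2 * (f x)\<^sup>2 + 2 * (g x)\<^sup>2)"
  proof (rule integral_mono)
    show "(f x + g x)\<^sup>2 \<le> 2 * (f x)\<^sup>2 + 2 * (g x)\<^sup>2" for x
      using sum_squares_bound[of "f x" "g x"] by (simp add: power2_sum)
  qed (use assms square_integrable_add[OF assms] in \<open>auto simp: square_integrable_def\<close>)
  also have "\<dots> = 2 * (LINT x|M. (f x)\<^sup>2) + 2 * (LINT x|M. (g x)\<^sup>2)"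
    using assms by (simp add: square_integrable_def)
  finally show ?thesis .
qed

lemma integral_mult_le_scaled:
  assumes "square_integrable M f" "square_integrable M g" "0 < l"
  shows "(LINT x|M. f x * g x) \<le> 1 / 2 * (l * (LINT x|M. (f x)\<^sup>2) + (LINT x|M. (g x)\<^sup>2) / l)"
proof -
  have "(LINT x|M. f x * g x) \<le> (LINT x|M. 1/2 * (l * (f x)\<^sup>2 + (g x)\<^sup>2 / l))"
  proof (rule integral_mono)
    fix x
    have "2 * (sqrt l * f x) * (g x / sqrt l) \<le> (sqrt l * f x)\<^sup>2 + (g x / sqrt l)\<^sup>2"
      by (rule sum_squares_bound)
    also have "\<dots> = l * (f x)\<^sup>2 + (g x)\<^sup>2 / l"
      using assms by (simp add: power_mult_distrib power_divide)
    also have "2 * (sqrt l * f x) * (g x / sqrt l) = 2 * (f x * g x)"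
      using assms by simp
    finally show "f x * g x \<le> 1/2 * (l * (f x)\<^sup>2 + (g x)\<^sup>2 / l)" by simp
  qed (use assms square_integrable_mult[OF assms(1,2)] in \<open>auto simp: square_integrable_def\<close>)
  also have "\<dots> = 1 / 2 * (l * (LINT x|M. (f x)\<^sup>2) + (LINT x|M. (g x)\<^sup>2) / l)"
    using assms by (simp add: square_integrable_def)
  finally show ?thesis .
qed

lemma integral_Cauchy_Schwarz:
  assumes "square_integrable M f" "square_integrable M g"
  shows "(LINT x|M. f x * g x) \<le> sqrt ((LINT x|M. (f x)\<^sup>2) * (LINT x|M. (g x)\<^sup>2))"
  using le_sqrt_of_scaled[of "LINT x|M. (f x)\<^sup>2" "LINT x|M. (g x)\<^sup>2" 1 "LINT x|M. f x * g x"]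
    integral_mult_le_scaled[OF assms] by simp

lemma integral_Cauchy_Schwarz_abs:
  assumes "square_integrable M f" "square_integrable M g"
  shows "\<bar>LINT x|M. f x * g x\<bar> \<le> sqrt ((LINT x|M. (f x)\<^sup>2) * (LINT x|M. (g x)\<^sup>2))"
  using integral_Cauchy_Schwarz[OF assms]
    integral_Cauchy_Schwarz[OF square_integrable_cmult[OF assms(1), of "-1"] assms(2)]
  by simp

text \<open>Expanding \<open>f n * g n\<close> around \<open>f' * g'\<close> leaves three terms that
  contain a difference, and Cauchy-Schwarz sends each of them to 0. With the constant 1 as second
  factor the same statement yields convergence of means.\<close>

lemma tendsto_integral_mult:
  assumes f: "\<And>n. square_integrable M (f n)" "square_integrable M f'"
    and g: "\<And>n. square_integrable M (g n)" "square_integrable M g'"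
    and fl: "(\<lambda>n. LINT x|M. (f n x - f' x)\<^sup>2) \<longlonglongrightarrow> 0"
    and gl: "(\<lambda>n. LINT x|M. (g n x - g' x)\<^sup>2) \<longlonglongrightarrow> 0"
  shows "(\<lambda>n. LINT x|M. f n x * g n x) \<longlonglongrightarrow> (LINT x|M. f' x * g' x)"
proof -
  have df: "square_integrable M (\<lambda>x. f n x - f' x)" and dg: "square_integrable M (\<lambda>x. g n x - g' x)" for n
    using f g by (auto intro: square_integrable_diff)
  have *: "(\<lambda>n. LINT x|M. u n x * v n x) \<longlonglongrightarrow> 0"
    if u: "\<And>n. square_integrable M (u n)" and v: "\<And>n. square_integrable M (v n)"
      and lim: "(\<lambda>n. (LINT x|M. (u n x)\<^sup>2) * (LINT x|M. (v n x)\<^sup>2)) \<longlonglongrightarrow> 0" for u v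
  proof (rule tendsto_rabs_zero_cancel, rule tendsto_sandwich[where f="\<lambda>_. 0"])
    show "eventually (\<lambda>n. \<bar>LINT x|M. u n x * v n x\<bar>
        \<le> sqrt ((LINT x|M. (u n x)\<^sup>2) * (LINT x|M. (v n x)\<^sup>2))) sequentially"
      using integral_Cauchy_Schwarz_abs[OF u v] by simp
    show "(\<lambda>n. sqrt ((LINT x|M. (u n x)\<^sup>2) * (LINT x|M. (v n x)\<^sup>2))) \<longlonglongrightarrow> 0"
      using tendsto_real_sqrt[OF lim] by simp
  qed auto
  have "(\<lambda>n. (LINT x|M. (f n x - f' x) * (g n x - g' x)) + (LINT x|M. (f n x - f' x) * g' x)
      + (LINT x|M. f' x * (g n x - g' x)) + (LINT x|M. f' x * g' x)) \<longlonglongrightarrow> 0 + 0 + 0 + (LINT x|M. f' x * g' x)"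
    using tendsto_mult[OF fl gl] tendsto_mult[OF fl tendsto_const] tendsto_mult[OF tendsto_const gl]
    by (intro tendsto_intros *) (auto intro: df dg f g)
  also have "(\<lambda>n. (LINT x|M. (f n x - f' x) * (g n x - g' x)) + (LINT x|M. (f n x - f' x) * g' x)
      + (LINT x|M. f' x * (g n x - g' x)) + (LINT x|M. f' x * g' x)) = (\<lambda>n. LINT x|M. f n x * g n x)"
  proof
    fix n
    have "(LINT x|M. (f n x - f' x) * (g n x - g' x)) + (LINT x|M. (f n x - f' x) * g' x)
      + (LINT x|M. f' x * (g n x - g' x)) + (LINT x|M. f' x * g' x)
      = (LINT x|M. (f n x - f' x) * (g n x - g' x) + (f n x - f' x) * g' x
           + f' x * (g n x - g' x) + f' x * g' x)"
      using square_integrable_mult[OF df dg] square_integrable_mult[OF df g(2)]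
        square_integrable_mult[OF f(2) dg] square_integrable_mult[OF f(2) g(2)]
      by (simp add: Bochner_Integration.integral_add)
    also have "\<dots> = (LINT x|M. f n x * g n x)"
      by (intro Bochner_Integration.integral_cong) (auto simp: algebra_simps)
    finally show "(LINT x|M. (f n x - f' x) * (g n x - g' x)) + (LINT x|M. (f n x - f' x) * g' x)
      + (LINT x|M. f' x * (g n x - g' x)) + (LINT x|M. f' x * g' x) = (LINT x|M. f n x * g n x)" .
  qed
  finally show ?thesis by simp
qed

lemma (in finite_measure) square_integrable_bounded:
  assumes "f \<in> borel_measurable M" "\<And>x. x \<in> space M \<Longrightarrow> \<bar>f x\<bar> \<le> K"
  shows "square_integrable M f"
  by (rule square_integrable_bound[where g="\<lambda>_. K"])
     (use assms in \<open>auto simp: square_integrable_def intro: order_trans[OF _ abs_ge_self]\<close>)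

lemma square_integrable_mult_bounded:
  assumes "square_integrable M f" "g \<in> borel_measurable M" "\<And>x. x \<in> space M \<Longrightarrow> \<bar>g x\<bar> \<le> K"
  shows "square_integrable M (\<lambda>x. f x * g x)"
proof (rule square_integrable_bound[OF square_integrable_cmult[OF assms(1), of K]])
  fix x assume "x \<in> space M"
  then have "\<bar>g x\<bar> * \<bar>f x\<bar> \<le> \<bar>K\<bar> * \<bar>f x\<bar>"
    using assms(3)[of x] by (intro mult_right_mono) auto
  then show "\<bar>f x * g x\<bar> \<le> \<bar>K * f x\<bar>" by (simp add: abs_mult mult.commute)
qed (use assms in \<open>auto simp: square_integrable_def\<close>)

lemma tendsto_integral_square_dominated:
  fixes f :: "nat \<Rightarrow> 'a \<Rightarrow> real"
  assumes [measurable]: "\<And>n. f n \<in> borel_measurable M" "f' \<in> borel_measurable M"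
    and w: "square_integrable M w"
    and lim: "\<And>x. x \<in> space M \<Longrightarrow> (\<lambda>n. f n x) \<longlonglongrightarrow> f' x"
    and bd: "\<And>n x. x \<in> space M \<Longrightarrow> \<bar>f n x - f' x\<bar> \<le> \<bar>w x\<bar>"
  shows "(\<lambda>n. LINT x|M. (f n x - f' x)\<^sup>2) \<longlonglongrightarrow> 0"
proof -
  have "(\<lambda>n. LINT x|M. (f n x - f' x)\<^sup>2) \<longlonglongrightarrow> (LINT x|M. 0)"
  proof (rule integral_dominated_convergence[where w="\<lambda>x. (w x)\<^sup>2"])
    show "AE x in M. (\<lambda>n. (f n x - f' x)\<^sup>2) \<longlonglongrightarrow> 0"
    proof (rule AE_I2)
      fix x assume "x \<in> space M"
      from tendsto_power[OF tendsto_diff[OF lim[OF this] tendsto_const[of "f' x"]], of 2]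
      show "(\<lambda>n. (f n x - f' x)\<^sup>2) \<longlonglongrightarrow> 0" by simp
    qed
    show "AE x in M. norm ((f n x - f' x)\<^sup>2) \<le> (w x)\<^sup>2" for n
      using bd by (intro AE_I2) (simp add: abs_le_square_iff)
  qed (use w in \<open>auto simp: square_integrable_def\<close>)
  then show ?thesis by simp
qed

section \<open>L2 approximation by an algebra of bounded functions\<close>

locale bounded_algebra = finite_measure M for M :: "'a measure" +
  fixes A :: "('a \<Rightarrow> real) set"
  assumes const: "(\<lambda>_. c) \<in> A"
    and add: "f \<in> A \<Longrightarrow> g \<in> A \<Longrightarrow> (\<lambda>x. f x + g x) \<in> A"
    and mult: "f \<in> A \<Longrightarrow> g \<in> A \<Longrightarrow> (\<lambda>x. f x * g x) \<in> A"
    and measurable: "f \<in> A \<Longrightarrow> f \<in> borel_measurable M"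
    and bounded: "f \<in> A \<Longrightarrow> \<exists>K. \<forall>x. \<bar>f x\<bar> \<le> K"
begin

definition L2_closure :: "('a \<Rightarrow> real) set" where
  "L2_closure = {f. square_integrable M f \<and> (\<forall>e>0. \<exists>a\<in>A. (LINT x|M. (f x - a x)\<^sup>2) < e)}"

lemma square_integrable_A:
  assumes "a \<in> A"
  shows "square_integrable M a"
proof -
  obtain K where "\<And>x. \<bar>a x\<bar> \<le> K" using bounded[OF assms] by auto
  then show ?thesis by (intro square_integrable_bounded[of _ K] measurable assms)
qed

lemma closure_square_integrable: "f \<in> L2_closure \<Longrightarrow> square_integrable M f"
  by (simp add: L2_closure_def)

lemma subset_closure: "a \<in> A \<Longrightarrow> a \<in> L2_closure"
  by (auto simp: L2_closure_def square_integrable_A intro!: bexI[of _ a])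

lemma closure_closed:
  assumes f: "square_integrable M f"
    and ex: "\<And>e. e > 0 \<Longrightarrow> \<exists>g\<in>L2_closure. (LINT x|M. (f x - g x)\<^sup>2) < e"
  shows "f \<in> L2_closure"
  unfolding L2_closure_def
proof (intro CollectI conjI allI impI f)
  fix e :: real assume e: "e > 0"
  obtain g where g: "g \<in> L2_closure" "(LINT x|M. (f x - g x)\<^sup>2) < e / 4"
    using ex[of "e/4"] e by auto
  obtain a where a: "a \<in> A" "(LINT x|M. (g x - a x)\<^sup>2) < e / 4"
    using g(1) e unfolding L2_closure_def by (auto elim!: allE[of _ "e/4"])
  have "(LINT x|M. ((f x - g x) + (g x - a x))\<^sup>2) \<le> 2 * (LINT x|M. (f x - g x)\<^sup>2) + 2 * (LINT x|M. (g x - a x)\<^sup>2)"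
    using f g a by (intro integral_square_add_le square_integrable_diff)
      (auto simp: square_integrable_A closure_square_integrable)
  also have "\<dots> < e" using g(2) a(2) by simp
  finally show "\<exists>a\<in>A. (LINT x|M. (f x - a x)\<^sup>2) < e" using a(1) by auto
qed

lemma closure_limit:
  assumes "square_integrable M f" "\<And>n. g n \<in> L2_closure" "(\<lambda>n. LINT x|M. (g n x - f x)\<^sup>2) \<longlonglongrightarrow> 0"
  shows "f \<in> L2_closure"
proof (rule closure_closed[OF assms(1)])
  fix e :: real assume "e > 0"
  then have "eventually (\<lambda>n. (LINT x|M. (g n x - f x)\<^sup>2) < e) sequentially"
    using order_tendstoD(2)[OF assms(3)] by simp
  then obtain n where "(LINT x|M. (g n x - f x)\<^sup>2) < e" by (auto dest: eventually_happens)
  then show "\<exists>g\<in>L2_closure. (LINT x|M. (f x - g x)\<^sup>2) < e"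
    using assms(2) by (auto intro!: bexI[of _ "g n"] simp: power2_commute)
qed

text \<open>On a finite measure the constant \<open>2 * K\<close> is a square-integrable dominating
  function. Convergence is required only on \<open>space M\<close>, so a constant sequence also
  transfers membership between functions that agree there.\<close>

lemma closure_limit_bounded:
  assumes g: "\<And>n. g n \<in> L2_closure" and bd: "\<And>n x. x \<in> space M \<Longrightarrow> \<bar>g n x\<bar> \<le> K"
    and lim: "\<And>x. x \<in> space M \<Longrightarrow> (\<lambda>n. g n x) \<longlonglongrightarrow> f x"
  shows "f \<in> L2_closure"
proof -
  have gm: "g n \<in> borel_measurable M" for n
    using closure_square_integrable[OF g] by (simp add: square_integrable_def)
  have fm: "f \<in> borel_measurable M"
    using gm lim by (rule borel_measurable_LIMSEQ_metric)
  have fb: "\<bar>f x\<bar> \<le> K" if "x \<in> space M" for x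
    using LIMSEQ_le_const2[OF tendsto_rabs[OF lim[OF that]]] bd[OF that] by blast
  show ?thesis
  proof (rule closure_limit[OF square_integrable_bounded[OF fm fb] g])
    show "(\<lambda>n. LINT x|M. (g n x - f x)\<^sup>2) \<longlonglongrightarrow> 0"
    proof (rule tendsto_integral_square_dominated[OF gm fm _ lim])
      show "square_integrable M (\<lambda>_. 2 * K)" by (rule square_integrable_bounded) auto
      fix n x assume "x \<in> space M"
      with bd[of x n] fb[of x] show "\<bar>g n x - f x\<bar> \<le> \<bar>2 * K\<bar>" by simp
    qed
  qed
qed

lemma closure_add:
  assumes "f \<in> L2_closure" "g \<in> L2_closure"
  shows "(\<lambda>x. f x + g x) \<in> L2_closure"
proof (rule closure_closed)
  show "square_integrable M (\<lambda>x. f x + g x)"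
    using assms by (intro square_integrable_add closure_square_integrable)
  fix e :: real assume e: "e > 0"
  obtain a where a: "a \<in> A" "(LINT x|M. (f x - a x)\<^sup>2) < e / 4"
    using assms(1) e unfolding L2_closure_def by (auto elim!: allE[of _ "e/4"])
  obtain b where b: "b \<in> A" "(LINT x|M. (g x - b x)\<^sup>2) < e / 4"
    using assms(2) e unfolding L2_closure_def by (auto elim!: allE[of _ "e/4"])
  have "(LINT x|M. ((f x - a x) + (g x - b x))\<^sup>2) \<le> 2 * (LINT x|M. (f x - a x)\<^sup>2) + 2 * (LINT x|M. (g x - b x)\<^sup>2)"
    using assms a b by (intro integral_square_add_le square_integrable_diff)
      (auto simp: square_integrable_A closure_square_integrable)
  also have "\<dots> < e" using a b by simp
  finally show "\<exists>h\<in>L2_closure. (LINT x|M. (f x + g x - h x)\<^sup>2) < e"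
    using add[OF a(1) b(1)] by (intro bexI[of _ "\<lambda>x. a x + b x"] subset_closure) (simp add: algebra_simps)
qed

text \<open>Members of \<open>A\<close> that approximate a bounded function are bounded, but not
  uniformly in the error, so the two factors cannot be replaced at once. The factor \<open>f\<close>
  is replaced first, by some \<open>a\<close> in \<open>A\<close> while \<open>g\<close> is bounded;
  then \<open>g\<close> is approximated against the bound of this fixed \<open>a\<close>.\<close>

lemma closure_mult:
  assumes f: "f \<in> L2_closure" and fK: "\<And>x. x \<in> space M \<Longrightarrow> \<bar>f x\<bar> \<le> K"
    and g: "g \<in> L2_closure" and gL: "\<And>x. x \<in> space M \<Longrightarrow> \<bar>g x\<bar> \<le> L"
  shows "(\<lambda>x. f x * g x) \<in> L2_closure"
proof -
  have approx: "\<exists>a\<in>A. square_integrable M (\<lambda>x. (u x - a x) * v x) \<and> (LINT x|M. ((u x - a x) * v x)\<^sup>2) < e"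
    if u: "u \<in> L2_closure" and v: "v \<in> borel_measurable M" and vB: "\<And>x. x \<in> space M \<Longrightarrow> \<bar>v x\<bar> \<le> B"
      and e: "e > 0" for u v B and e :: real
  proof -
    obtain a where a: "a \<in> A" "(LINT x|M. (u x - a x)\<^sup>2) < e / (B\<^sup>2 + 1)"
      using u e unfolding L2_closure_def by (auto elim!: allE[of _ "e / (B\<^sup>2 + 1)"] simp: add_nonneg_pos)
    have s: "square_integrable M (\<lambda>x. u x - a x)"
      using u a by (intro square_integrable_diff closure_square_integrable square_integrable_A)
    note s2 = square_integrable_mult_bounded[OF s v vB]
    have "(LINT x|M. ((u x - a x) * v x)\<^sup>2) \<le> (LINT x|M. (B\<^sup>2 + 1) * (u x - a x)\<^sup>2)"
    proof (rule integral_mono)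
      fix x assume "x \<in> space M"
      then have "(v x)\<^sup>2 \<le> B\<^sup>2" using vB[of x] by (simp add: abs_le_square_iff[symmetric])
      then show "((u x - a x) * v x)\<^sup>2 \<le> (B\<^sup>2 + 1) * (u x - a x)\<^sup>2"
        unfolding power_mult_distrib by (subst mult.commute, intro mult_right_mono) auto
    qed (use s s2 in \<open>auto simp: square_integrable_def\<close>)
    also have "\<dots> < e"
      using a(2) by (simp add: pos_less_divide_eq add_nonneg_pos mult.commute)
    finally show ?thesis using a(1) s2 by blast
  qed
  have *: "(\<lambda>x. a x * g x) \<in> L2_closure" if a: "a \<in> A" for a
  proof (rule closure_closed)
    obtain B where B: "\<And>x. \<bar>a x\<bar> \<le> B" using bounded[OF a] by auto
    show "square_integrable M (\<lambda>x. a x * g x)"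
      using square_integrable_mult_bounded[OF closure_square_integrable[OF g] measurable[OF a] B]
      by (simp add: mult.commute)
    fix e :: real assume "e > 0"
    then obtain b where "b \<in> A" "(LINT x|M. ((g x - b x) * a x)\<^sup>2) < e"
      using approx[OF g measurable[OF a] B, of e] by auto
    then show "\<exists>h\<in>L2_closure. (LINT x|M. (a x * g x - h x)\<^sup>2) < e"
      using subset_closure[OF mult[OF a, of b]] by (intro bexI[of _ "\<lambda>x. a x * b x"]) (auto simp: algebra_simps)
  qed
  have gm: "g \<in> borel_measurable M"
    using closure_square_integrable[OF g] by (simp add: square_integrable_def)
  show ?thesis
  proof (rule closure_closed)
    show "square_integrable M (\<lambda>x. f x * g x)"
      by (rule square_integrable_mult_bounded[OF closure_square_integrable[OF f] gm gL])
    fix e :: real assume "e > 0"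
    then obtain a where "a \<in> A" "(LINT x|M. ((f x - a x) * g x)\<^sup>2) < e"
      using approx[OF f gm gL, of e] by auto
    then show "\<exists>h\<in>L2_closure. (LINT x|M. (f x * g x - h x)\<^sup>2) < e"
      using * by (intro bexI[of _ "\<lambda>x. a x * g x"]) (auto simp: algebra_simps)
  qed
qed

lemma closure_cmult: "f \<in> L2_closure \<Longrightarrow> (\<lambda>x. c * f x) \<in> L2_closure"
proof (rule closure_closed)
  assume f: "f \<in> L2_closure"
  show "square_integrable M (\<lambda>x. c * f x)"
    by (intro square_integrable_cmult closure_square_integrable f)
  fix e :: real assume e: "e > 0"
  obtain a where a: "a \<in> A" "(LINT x|M. (f x - a x)\<^sup>2) < e / (c\<^sup>2 + 1)"
    using f e unfolding L2_closure_def by (auto elim!: allE[of _ "e / (c\<^sup>2 + 1)"] simp: add_nonneg_pos)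
  have "(LINT x|M. (c * f x - c * a x)\<^sup>2) = c\<^sup>2 * (LINT x|M. (f x - a x)\<^sup>2)"
    by (simp add: right_diff_distrib[symmetric] power_mult_distrib)
  also have "\<dots> \<le> (c\<^sup>2 + 1) * (LINT x|M. (f x - a x)\<^sup>2)"
    by (intro mult_right_mono) auto
  also have "\<dots> < e" using a(2) by (simp add: pos_less_divide_eq add_nonneg_pos mult.commute)
  finally show "\<exists>h\<in>L2_closure. (LINT x|M. (c * f x - h x)\<^sup>2) < e"
    using mult[OF const a(1)] by (intro bexI[of _ "\<lambda>x. c * a x"] subset_closure) auto
qed

lemma closure_sum:
  "(\<And>i. i \<in> I \<Longrightarrow> f i \<in> L2_closure) \<Longrightarrow> (\<lambda>x. \<Sum>i\<in>I. f i x) \<in> L2_closure"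
  by (induction I rule: infinite_finite_induct)
     (auto intro: closure_add subset_closure const)

lemma closure_diff:
  assumes "f \<in> L2_closure" "g \<in> L2_closure"
  shows "(\<lambda>x. f x - g x) \<in> L2_closure"
  using closure_add[OF assms(1) closure_cmult[OF assms(2), of "-1"]] by simp

text \<open>Weierstrass on an interval that contains the range of \<open>a\<close>: polynomials in
  \<open>a\<close> stay in the algebra and converge uniformly. The aim is to reach ramp functions,
  whose limits are indicators of level sets.\<close>

lemma closure_continuous_comp:
  assumes a: "a \<in> A" and g: "continuous_on UNIV (g :: real \<Rightarrow> real)"
  shows "(\<lambda>x. g (a x)) \<in> L2_closure"
proof -
  obtain K where K: "\<And>x. \<bar>a x\<bar> \<le> K" using bounded[OF a] by auto
  have poly: "(\<lambda>x. p (a x)) \<in> A" if "real_polynomial_function p" for p :: "real \<Rightarrow> real"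
    using that
  proof induction
    case (linear f)
    then obtain c where "f = (\<lambda>x. x * c)"
      by (metis real_bounded_linear)
    with mult[OF a const] show ?case by simp
  qed (auto intro: const add mult)
  have gK: "continuous_on {-K..K} g" using g by (rule continuous_on_subset) auto
  have "\<exists>p. real_polynomial_function p \<and> (\<forall>x\<in>{-K..K}. \<bar>g x - p x\<bar> < 1 / real (Suc n))" for n
    using Stone_Weierstrass_real_polynomial_function[OF compact_Icc gK, of "1 / real (Suc n)"]
    by (metis of_nat_0_less_iff zero_less_Suc zero_less_divide_1_iff)
  then obtain p where p: "\<And>n. real_polynomial_function (p n)"
    "\<And>n x. x \<in> {-K..K} \<Longrightarrow> \<bar>g x - p n x\<bar> < 1 / real (Suc n)" by metis
  have ab: "a x \<in> {-K..K}" for x using K[of x] by auto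
  obtain B where "\<forall>y\<in>g ` {-K..K}. norm y \<le> B"
    using compact_imp_bounded[OF compact_continuous_image[OF gK compact_Icc]]
    unfolding bounded_iff by blast
  then have B: "\<And>x. x \<in> {-K..K} \<Longrightarrow> \<bar>g x\<bar> \<le> B" by simp
  show ?thesis
  proof (rule closure_limit_bounded)
    show "(\<lambda>x. p n (a x)) \<in> L2_closure" for n by (intro subset_closure poly p)
    fix n x
    have "1 / real (Suc n) \<le> 1" by simp
    with p(2)[OF ab[of x], of n] B[OF ab[of x]] show "\<bar>p n (a x)\<bar> \<le> B + 1" by linarith
  next
    fix x
    show "(\<lambda>n. p n (a x)) \<longlonglongrightarrow> g (a x)"
    proof (rule LIM_zero_cancel, rule Lim_null_comparison)
      show "eventually (\<lambda>n. norm (p n (a x) - g (a x)) \<le> 1 / real (Suc n)) sequentially"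
        using p(2)[OF ab[of x]] by (intro always_eventually) (auto simp: abs_minus_commute intro: less_imp_le)
      show "(\<lambda>n. 1 / real (Suc n)) \<longlonglongrightarrow> 0"
        using LIMSEQ_inverse_real_of_nat by (simp add: inverse_eq_divide)
    qed
  qed
qed

text \<open>Density is reduced to sets: once these sets form a sigma-algebra that makes every member
  of \<open>A\<close> measurable, simple functions carry the approximation to all square-integrable
  functions measurable for it.\<close>

definition closure_sets :: "'a set set" where
  "closure_sets = {B \<in> sets M. indicator B \<in> L2_closure}"

text \<open>Linearity and bounded limits give complements and disjoint unions, hence a Dynkin
  system; intersections come from \<open>closure_mult\<close> applied to indicators.\<close>

lemma sigma_algebra_closure_sets: "sigma_algebra (space M) closure_sets"
proof -
  have "Dynkin_system (space M) closure_sets"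
  proof (rule Dynkin_systemI')
    show "{} \<in> closure_sets" using subset_closure[OF const[of 0]] by (simp add: closure_sets_def indicator_def[abs_def])
    fix B assume B: "B \<in> closure_sets"
    have "(\<lambda>x. 1 - indicator B x) \<in> L2_closure"
      using B by (intro closure_diff subset_closure[OF const]) (auto simp: closure_sets_def)
    \<comment> \<open>\<open>1 - indicator B\<close> differs from this indicator outside
      \<open>space M\<close>; the constant sequence absorbs the difference.\<close>
    then have "indicator (space M - B) \<in> L2_closure"
      by (rule closure_limit_bounded[of "\<lambda>_ x. 1 - indicator B x" 1]) (auto simp: indicator_def)
    with B show "space M - B \<in> closure_sets" by (auto simp: closure_sets_def)
  next
    fix B :: "nat \<Rightarrow> 'a set"
    assume B: "disjoint_family B" "range B \<subseteq> closure_sets"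
    have "indicator (\<Union>i. B i) \<in> L2_closure"
    proof (rule closure_limit_bounded)
      show "indicator (\<Union>i<n. B i) \<in> L2_closure" for n
      proof -
        have "(\<lambda>x. \<Sum>i<n. indicator (B i) x) \<in> L2_closure"
          using B by (intro closure_sum) (auto simp: closure_sets_def)
        also have "(\<lambda>x. \<Sum>i<n. indicator (B i) x) = (indicator (\<Union>i<n. B i) :: _ \<Rightarrow> real)"
          using B(1) by (intro ext indicator_UN_disjoint[symmetric]) (auto intro: disjoint_family_on_mono)
        finally show ?thesis .
      qed
      show "(\<lambda>n. indicator (\<Union>i<n. B i) x) \<longlonglongrightarrow> (indicator (\<Union>i. B i) x :: real)" for x
        by (rule LIMSEQ_indicator_UN)
      show "\<bar>indicator (\<Union>i<n. B i) x\<bar> \<le> (1::real)" for n x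
        by (simp add: indicator_def)
    qed
    with B show "(\<Union>i. B i) \<in> closure_sets" by (auto simp: closure_sets_def)
  qed (auto simp: closure_sets_def dest: sets.sets_into_space)
  moreover have "Int_stable closure_sets"
  proof (rule Int_stableI)
    fix B C assume "B \<in> closure_sets" "C \<in> closure_sets"
    then show "B \<inter> C \<in> closure_sets"
      using closure_mult[of "indicator B" 1 "indicator C" 1]
      by (auto simp: closure_sets_def indicator_inter_arith[abs_def] intro!: indicator_le_1)
  qed
  ultimately show ?thesis by (simp add: Dynkin_system.sigma_algebra_eq_Int_stable)
qed

definition closure_algebra :: "'a measure" where
  "closure_algebra = sigma (space M) closure_sets"

lemma space_closure_algebra [simp]: "space closure_algebra = space M"
  and sets_closure_algebra: "sets closure_algebra = closure_sets"
  by (simp_all add: closure_algebra_def sigma_algebra.sets_measure_of_eq[OF sigma_algebra_closure_sets]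
      sigma_algebra.space_measure_of_eq[OF sigma_algebra_closure_sets])

text \<open>The indicator of \<open>c < a\<close> is the limit of the ramps
  \<open>min 1 (n * max 0 (a - c))\<close>, which are continuous functions of \<open>a\<close> with
  values between 0 and 1.\<close>

lemma measurable_closure_algebra:
  assumes a: "a \<in> A"
  shows "a \<in> borel_measurable closure_algebra"
proof (rule borel_measurableI_greater)
  fix c :: real
  have [measurable]: "a \<in> borel_measurable M" by (rule measurable[OF a])
  have "indicator {x \<in> space M. c < a x} \<in> L2_closure"
  proof (rule closure_limit_bounded)
    show "(\<lambda>x. min 1 (real n * max 0 (a x - c))) \<in> L2_closure" for n
      by (rule closure_continuous_comp[OF a, of "\<lambda>y. min 1 (real n * max 0 (y - c))"])
         (intro continuous_intros)
    show "\<bar>min 1 (real n * max 0 (a x - c))\<bar> \<le> 1" for n x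
    proof -
      have "0 \<le> real n * max 0 (a x - c)" by (intro mult_nonneg_nonneg) auto
      then show ?thesis by simp
    qed
    fix x assume x: "x \<in> space M"
    show "(\<lambda>n. min 1 (real n * max 0 (a x - c))) \<longlonglongrightarrow> indicator {x \<in> space M. c < a x} x"
    proof (cases "c < a x")
      case True
      obtain N where N: "1 / (a x - c) < real N" using reals_Archimedean2 by blast
      have "eventually (\<lambda>n. min 1 (real n * max 0 (a x - c)) = 1) sequentially"
        using eventually_ge_at_top[of N]
      proof eventually_elim
        case (elim n)
        then have "1 / (a x - c) \<le> real n" using N by linarith
        then have "1 \<le> real n * (a x - c)" using True by (simp add: pos_divide_le_eq)
        then show ?case using True by simp
      qed
      then show ?thesis using True x by (simp add: tendsto_eventually)
    qed auto
  qed
  then show "{x \<in> space closure_algebra. c < a x} \<in> sets closure_algebra"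
    by (simp add: sets_closure_algebra closure_sets_def)
qed

lemma measurable_closure_algebra_imp:
  "f \<in> measurable closure_algebra N \<Longrightarrow> f \<in> measurable M N"
  unfolding measurable_def by (auto simp: sets_closure_algebra closure_sets_def)

text \<open>Simple functions for the closure sigma-algebra belong to the closure by linearity. They
  can be chosen to converge to \<open>f\<close> with absolute value at most
  \<open>2 * \<bar>f\<bar>\<close>, so \<open>3 * f\<close> dominates the error.\<close>

lemma closure_of_measurable:
  assumes f: "f \<in> borel_measurable closure_algebra" and int: "integrable M (\<lambda>x. (f x)\<^sup>2)"
  shows "f \<in> L2_closure"
proof -
  have fM: "f \<in> borel_measurable M" by (rule measurable_closure_algebra_imp[OF f])
  have fL: "square_integrable M f" using fM int by (simp add: square_integrable_def)
  obtain s where "\<forall>i. simple_function closure_algebra (s i)"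
    "\<forall>x\<in>space closure_algebra. (\<lambda>i. s i x) \<longlonglongrightarrow> f x"
    "\<forall>i. \<forall>x\<in>space closure_algebra. dist (s i x) 0 \<le> 2 * dist (f x) 0"
    using borel_measurable_implies_sequence_metric[OF f, of 0] by blast
  then have s: "\<And>i. simple_function closure_algebra (s i)"
    "\<And>x. x \<in> space M \<Longrightarrow> (\<lambda>i. s i x) \<longlonglongrightarrow> f x"
    "\<And>i x. x \<in> space M \<Longrightarrow> dist (s i x) 0 \<le> 2 * dist (f x) 0"
    by simp_all
  have sm: "s i \<in> borel_measurable M" for i
    by (rule measurable_closure_algebra_imp[OF borel_measurable_simple_function[OF s(1)]])
  have sc: "s i \<in> L2_closure" for i
  proof -
    have fin: "finite (s i ` space M)" using s(1)[of i] by (auto simp: simple_function_def)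
    have h: "(\<lambda>x. \<Sum>y\<in>s i ` space M. y * indicator (s i -` {y} \<inter> space M) x) \<in> L2_closure" (is "?h \<in> _")
      using s(1)[of i] by (intro closure_sum closure_cmult)
        (auto simp: simple_function_def sets_closure_algebra closure_sets_def)
    have eq: "?h x = s i x" if "x \<in> space M" for x
      using fin that by (simp add: indicator_def if_distrib[of "\<lambda>t. _ * t"] sum.delta cong: if_cong)
    show ?thesis
    proof (rule closure_limit[OF _ h])
      show "square_integrable M (s i)"
        by (rule square_integrable_bound[OF square_integrable_cmult[OF fL, of 2] sm])
           (use s(3)[of _ i] in \<open>simp add: dist_real_def abs_mult\<close>)
      show "(\<lambda>n::nat. LINT x|M. (?h x - s i x)\<^sup>2) \<longlonglongrightarrow> 0"
        using eq by (simp add: Bochner_Integration.integral_cong[of M M "\<lambda>x. (?h x - s i x)\<^sup>2" "\<lambda>_. 0"])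
    qed
  qed
  show ?thesis
  proof (rule closure_limit[OF fL sc], rule tendsto_integral_square_dominated[OF sm fM _ s(2)])
    show "square_integrable M (\<lambda>x. 3 * f x)" by (rule square_integrable_cmult[OF fL])
    fix n x assume "x \<in> space M"
    with s(3)[of x n] show "\<bar>s n x - f x\<bar> \<le> \<bar>3 * f x\<bar>"
      by (simp add: dist_real_def abs_mult)
  qed
qed

lemma approx_sequence:
  assumes f: "f \<in> borel_measurable closure_algebra" and int: "integrable M (\<lambda>x. (f x)\<^sup>2)"
  obtains a where "\<And>n. a n \<in> A" "(\<lambda>n::nat. LINT x|M. (a n x - f x)\<^sup>2) \<longlonglongrightarrow> 0"
proof -
  have "\<exists>a\<in>A. (LINT x|M. (f x - a x)\<^sup>2) < 1 / real (Suc n)" for n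
    using closure_of_measurable[OF f int] unfolding L2_closure_def
    by (auto elim!: allE[of _ "1 / real (Suc n)"])
  then obtain a where a: "\<And>n. a n \<in> A" "\<And>n. (LINT x|M. (f x - a n x)\<^sup>2) < 1 / real (Suc n)" by metis
  have "(\<lambda>n::nat. LINT x|M. (a n x - f x)\<^sup>2) \<longlonglongrightarrow> 0"
  proof (rule tendsto_sandwich[where f="\<lambda>_. 0"])
    show "eventually (\<lambda>n. (LINT x|M. (a n x - f x)\<^sup>2) \<le> 1 / real (Suc n)) sequentially"
      using a(2) by (intro always_eventually) (auto simp: power2_commute intro: less_imp_le)
    show "(\<lambda>n. 1 / real (Suc n)) \<longlonglongrightarrow> 0"
      using LIMSEQ_inverse_real_of_nat by (simp add: inverse_eq_divide)
  qed auto
  with a(1) that show thesis by blast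
qed

end

subsection \<open>Trigonometric polynomials\<close>

text \<open>The complex span of the characters in finitely many coordinates; complex coefficients
  make a product of monomials a monomial again. The index set is arbitrary, so that the same closure
  results serve the time coordinates of a path and the single coordinate of the real line.\<close>

inductive_set trig_poly :: "('i \<Rightarrow> 'a \<Rightarrow> real) \<Rightarrow> 'i set \<Rightarrow> ('a \<Rightarrow> complex) set"
  for X :: "'i \<Rightarrow> 'a \<Rightarrow> real" and I :: "'i set" where
  monomial: "finite S \<Longrightarrow> S \<subseteq> I \<Longrightarrow> (\<lambda>x. a * cis (\<Sum>t\<in>S. u t * X t x)) \<in> trig_poly X I"
| add: "f \<in> trig_poly X I \<Longrightarrow> g \<in> trig_poly X I \<Longrightarrow> (\<lambda>x. f x + g x) \<in> trig_poly X I"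

lemma sum_extend_coeff:
  fixes u :: "'i \<Rightarrow> real"
  assumes "finite T" "S \<subseteq> T"
  shows "(\<Sum>t\<in>S. u t * X t x) = (\<Sum>t\<in>T. (if t \<in> S then u t else 0) * X t x)"
  using assms by (intro sum.mono_neutral_cong_left) auto

lemma trig_poly_monomial_mult:
  assumes "finite S" "S \<subseteq> I" "g \<in> trig_poly X I"
  shows "(\<lambda>x. a * cis (\<Sum>t\<in>S. u t * X t x) * g x) \<in> trig_poly X I"
  using assms(3)
proof induction
  case (monomial T b v)
  have fin: "finite (S \<union> T)" using assms(1) monomial(1) by simp
  have eq: "a * cis (\<Sum>t\<in>S. u t * X t x) * (b * cis (\<Sum>t\<in>T. v t * X t x))
    = (a * b) * cis (\<Sum>t\<in>S \<union> T. ((if t \<in> S then u t else 0) + (if t \<in> T then v t else 0)) * X t x)" for x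
  proof -
    have "cis (\<Sum>t\<in>S. u t * X t x) * cis (\<Sum>t\<in>T. v t * X t x)
      = cis ((\<Sum>t\<in>S. u t * X t x) + (\<Sum>t\<in>T. v t * X t x))" by (rule cis_mult)
    also have "(\<Sum>t\<in>S. u t * X t x) + (\<Sum>t\<in>T. v t * X t x)
      = (\<Sum>t\<in>S \<union> T. ((if t \<in> S then u t else 0) + (if t \<in> T then v t else 0)) * X t x)"
      unfolding sum_extend_coeff[OF fin Un_upper1] sum_extend_coeff[OF fin Un_upper2]
      by (simp only: sum.distrib distrib_right)
    finally show ?thesis by (simp add: mult_ac)
  qed
  show ?case unfolding eq using assms monomial by (intro trig_poly.monomial) auto
next
  case (add f g)
  then show ?case by (simp add: distrib_left trig_poly.add)
qed

lemma trig_poly_mult: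
  assumes "f \<in> trig_poly X I" "g \<in> trig_poly X I"
  shows "(\<lambda>x. f x * g x) \<in> trig_poly X I"
  using assms(1)
  by induction (auto simp: distrib_right intro: trig_poly_monomial_mult assms(2) trig_poly.add)

lemma trig_poly_const: "(\<lambda>_. c) \<in> trig_poly X I"
  using trig_poly.monomial[of "{}" I c _ X] by simp

lemma trig_poly_cmult: "f \<in> trig_poly X I \<Longrightarrow> (\<lambda>x. c * f x) \<in> trig_poly X I"
  by (rule trig_poly_mult[OF trig_poly_const])

lemma trig_poly_cis: "t \<in> I \<Longrightarrow> (\<lambda>x. cis (c * X t x)) \<in> trig_poly X I"
  using trig_poly.monomial[of "{t}" I 1 "\<lambda>_. c" X] by simp

lemma borel_measurable_cis [measurable (raw)]:
  "f \<in> borel_measurable M \<Longrightarrow> (\<lambda>x. cis (f x)) \<in> borel_measurable M"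
  by (erule measurable_compose) (intro borel_measurable_continuous_onI continuous_intros)

lemma trig_poly_measurable:
  assumes "f \<in> trig_poly X I" "\<And>t. t \<in> I \<Longrightarrow> X t \<in> borel_measurable M"
  shows "f \<in> borel_measurable M"
  using assms(1)
proof induction
  case (monomial S a u)
  have "(\<lambda>x. \<Sum>t\<in>S. u t * X t x) \<in> borel_measurable M"
    using assms(2) monomial(2) by (intro borel_measurable_sum borel_measurable_times) auto
  then show ?case by measurable
qed auto

lemma trig_poly_bounded:
  assumes "f \<in> trig_poly X I"
  shows "\<exists>K. \<forall>x. norm (f x) \<le> K"
  using assms
proof induction
  case (monomial S a u)
  then show ?case by (auto simp: norm_mult)
next
  case (add f g)
  then obtain K L where "\<And>x. norm (f x) \<le> K" "\<And>x. norm (g x) \<le> L" by auto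
  then have "norm (f x + g x) \<le> K + L" for x by (intro norm_triangle_mono)
  then show ?case by auto
qed

text \<open>Merging supports and padding frequencies with 0 gives all monomials one common finite
  index set, so that a single time grid will do for the whole polynomial.\<close>

lemma trig_poly_sum_rep:
  assumes "f \<in> trig_poly X I"
  shows "\<exists>S m a u. finite S \<and> S \<subseteq> I \<and> (\<forall>x. f x = (\<Sum>j<(m::nat). a j * cis (\<Sum>t\<in>S. u j t * X t x)))"
  using assms
proof induction
  case (monomial S a u)
  then show ?case
    by (intro exI[of _ S] exI[of _ 1] exI[of _ "\<lambda>_. a"] exI[of _ "\<lambda>_. u"]) simp
next
  case (add f g)
  from add.IH(1) obtain S m a u where S: "finite S" "S \<subseteq> I"
    and f: "\<And>x. f x = (\<Sum>j<(m::nat). a j * cis (\<Sum>t\<in>S. u j t * X t x))"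
    by blast
  from add.IH(2) obtain T n b v where T: "finite T" "T \<subseteq> I"
    and g: "\<And>x. g x = (\<Sum>j<(n::nat). b j * cis (\<Sum>t\<in>T. v j t * X t x))"
    by blast
  have fin: "finite (S \<union> T)" using S T by simp
  define c where "c j = (if j < m then a j else b (j - m))" for j
  define w where "w j t = (if j < m then if t \<in> S then u j t else 0 else if t \<in> T then v (j - m) t else 0)" for j t
  have split: "(\<Sum>j<m + n. h j) = (\<Sum>j<m. h j) + (\<Sum>j<n. h (m + j))" for h :: "nat \<Rightarrow> complex"
    by (induction n) (simp_all add: add_ac)
  have "f x + g x = (\<Sum>j<m+n. c j * cis (\<Sum>t\<in>S \<union> T. w j t * X t x))" for x
  proof -
    have "(\<Sum>j<m+n. c j * cis (\<Sum>t\<in>S \<union> T. w j t * X t x))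
      = (\<Sum>j<m. c j * cis (\<Sum>t\<in>S \<union> T. w j t * X t x)) + (\<Sum>j<n. c (m + j) * cis (\<Sum>t\<in>S \<union> T. w (m + j) t * X t x))"
      by (rule split)
    also have "(\<Sum>j<m. c j * cis (\<Sum>t\<in>S \<union> T. w j t * X t x)) = f x"
      unfolding f sum_extend_coeff[OF fin Un_upper1] by (intro sum.cong) (auto simp: c_def w_def)
    also have "(\<Sum>j<n. c (m + j) * cis (\<Sum>t\<in>S \<union> T. w (m + j) t * X t x)) = g x"
      unfolding g sum_extend_coeff[OF fin Un_upper2]
      by (intro sum.cong) (auto simp: c_def w_def cong: if_cong)
    finally show ?thesis ..
  qed
  with fin S T show ?case by (intro exI[of _ "S \<union> T"] exI[of _ "m + n"] exI[of _ c] exI[of _ w]) auto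
qed

definition real_trig_poly :: "('i \<Rightarrow> 'a \<Rightarrow> real) \<Rightarrow> 'i set \<Rightarrow> ('a \<Rightarrow> real) set" where
  "real_trig_poly X I = {f. (\<lambda>x. complex_of_real (f x)) \<in> trig_poly X I}"

lemma real_trig_poly_cos:
  assumes "t \<in> I"
  shows "(\<lambda>x. cos (c * X t x)) \<in> real_trig_poly X I"
proof -
  have "(\<lambda>x. 1/2 * cis (c * X t x) + 1/2 * cis (- c * X t x)) \<in> trig_poly X I"
    using assms by (intro trig_poly.add trig_poly_cmult trig_poly_cis)
  also have "(\<lambda>x. 1/2 * cis (c * X t x) + 1/2 * cis (- c * X t x)) = (\<lambda>x. complex_of_real (cos (c * X t x)))"
    by (auto simp: complex_eq_iff)
  finally show ?thesis by (simp add: real_trig_poly_def)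
qed

lemma real_trig_poly_sin:
  assumes "t \<in> I"
  shows "(\<lambda>x. sin (c * X t x)) \<in> real_trig_poly X I"
proof -
  have "(\<lambda>x. - \<i>/2 * cis (c * X t x) + \<i>/2 * cis (- c * X t x)) \<in> trig_poly X I"
    using assms by (intro trig_poly.add trig_poly_cmult trig_poly_cis)
  also have "(\<lambda>x. - \<i>/2 * cis (c * X t x) + \<i>/2 * cis (- c * X t x)) = (\<lambda>x. complex_of_real (sin (c * X t x)))"
    by (auto simp: complex_eq_iff)
  finally show ?thesis by (simp add: real_trig_poly_def)
qed

lemma real_trig_poly_const: "(\<lambda>_. c) \<in> real_trig_poly X I"
  by (simp add: real_trig_poly_def trig_poly_const)

lemma real_trig_poly_add:
  "f \<in> real_trig_poly X I \<Longrightarrow> g \<in> real_trig_poly X I \<Longrightarrow> (\<lambda>x. f x + g x) \<in> real_trig_poly X I"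
  by (simp add: real_trig_poly_def trig_poly.add)

lemma real_trig_poly_mult:
  "f \<in> real_trig_poly X I \<Longrightarrow> g \<in> real_trig_poly X I \<Longrightarrow> (\<lambda>x. f x * g x) \<in> real_trig_poly X I"
  by (simp add: real_trig_poly_def trig_poly_mult)

lemma bounded_algebra_real_trig_poly:
  assumes "finite_measure M" and X: "\<And>t. t \<in> I \<Longrightarrow> X t \<in> borel_measurable M"
  shows "bounded_algebra M (real_trig_poly X I)"
proof -
  interpret finite_measure M by fact
  show ?thesis
  proof
    fix f assume "f \<in> real_trig_poly X I"
    then have f: "(\<lambda>x. complex_of_real (f x)) \<in> trig_poly X I" by (simp add: real_trig_poly_def)
    show "f \<in> borel_measurable M"
      using measurable_compose[OF trig_poly_measurable[OF f X] borel_measurable_Re] by simp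
    show "\<exists>K. \<forall>x. \<bar>f x\<bar> \<le> K" using trig_poly_bounded[OF f] by simp
  qed (fact real_trig_poly_const real_trig_poly_add real_trig_poly_mult)+
qed

lemma tendsto_scaled_sin: "(\<lambda>n. real (Suc n) * sin (1 / real (Suc n) * x)) \<longlonglongrightarrow> x"
proof (cases "x = 0")
  case False
  have "(\<lambda>h. sin h / h) \<midarrow>0\<rightarrow> (1::real)"
    using DERIV_sin[of "0::real"] unfolding DERIV_def by simp
  moreover have "filterlim (\<lambda>n. 1 / real (Suc n) * x) (at 0) sequentially"
  proof (rule filterlim_atI)
    show "(\<lambda>n. 1 / real (Suc n) * x) \<longlonglongrightarrow> 0"
      using tendsto_mult_left_zero[OF LIMSEQ_inverse_real_of_nat, of x] by (simp add: inverse_eq_divide)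
  qed (use False in auto)
  ultimately have "(\<lambda>n. sin (1 / real (Suc n) * x) / (1 / real (Suc n) * x)) \<longlonglongrightarrow> 1"
    by (rule filterlim_compose)
  then have "(\<lambda>n. sin (1 / real (Suc n) * x) / (1 / real (Suc n) * x) * x) \<longlonglongrightarrow> 1 * x"
    by (rule tendsto_mult_right)
  also have "(\<lambda>n. sin (1 / real (Suc n) * x) / (1 / real (Suc n) * x) * x)
      = (\<lambda>n. real (Suc n) * sin (1 / real (Suc n) * x))"
    using False by (simp add: mult.commute del: of_nat_Suc)
  finally show ?thesis by simp
qed simp

text \<open>A coordinate may be unbounded, so it need not lie in the algebra; it is the pointwise
  limit of \<open>n * sin (x / n)\<close>. Consequently the closure sigma-algebra contains the one
  generated by the coordinates.\<close>

lemma measurable_closure_algebra_generator: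
  assumes "finite_measure M" and X: "\<And>t. t \<in> I \<Longrightarrow> X t \<in> borel_measurable M" and t: "t \<in> I"
  shows "X t \<in> borel_measurable (bounded_algebra.closure_algebra M (real_trig_poly X I))"
proof -
  interpret bounded_algebra M "real_trig_poly X I"
    by (rule bounded_algebra_real_trig_poly) fact+
  show ?thesis
  proof (rule borel_measurable_LIMSEQ_real)
    show "(\<lambda>n. real (Suc n) * sin (1 / real (Suc n) * X t x)) \<longlonglongrightarrow> X t x" for x
      by (rule tendsto_scaled_sin)
    show "(\<lambda>x. real (Suc n) * sin (1 / real (Suc n) * X t x)) \<in> borel_measurable closure_algebra" for n
      by (intro measurable_closure_algebra real_trig_poly_mult real_trig_poly_const real_trig_poly_sin t)
  qed
qed

subsection \<open>Levy triples and the carre du champ\<close>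

lemma norm_cis_minus_one_le: "norm (cis t - 1) \<le> \<bar>t\<bar>" "norm (cis t - 1) \<le> 2"
  using iexp_approx1[of t 0] iexp_approx2[of t 0] by (simp_all add: cis_conv_exp)

lemma norm_cis_minus_one_minus_le: "norm (cis t - 1 - \<i> * complex_of_real t) \<le> t\<^sup>2 / 2"
  using iexp_approx1[of t 1] by (simp add: cis_conv_exp diff_diff_eq power2_eq_square)

lemma linear_form_square_le:
  fixes u v x y :: real
  shows "(u * x + v * y)\<^sup>2 \<le> (u\<^sup>2 + v\<^sup>2) * (x\<^sup>2 + y\<^sup>2)"
proof -
  have "(u\<^sup>2 + v\<^sup>2) * (x\<^sup>2 + y\<^sup>2) - (u * x + v * y)\<^sup>2 = (u * y - v * x)\<^sup>2"
    by (simp add: power2_eq_square algebra_simps)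
  then show ?thesis by (metis diff_ge_0_iff_ge zero_le_power2)
qed

lemma borel_measurable_cnj [measurable (raw)]:
  "f \<in> borel_measurable M \<Longrightarrow> (\<lambda>x. cnj (f x)) \<in> borel_measurable M"
  by (erule measurable_compose) (intro borel_measurable_continuous_onI continuous_intros)

locale levy_triple =
  fixes b :: "real ^ 2" and \<Sigma> :: "real ^ 2 ^ 2" and \<nu> :: "(real \<times> real) measure"
  assumes symmetric: "transpose \<Sigma> = \<Sigma>"
    and psd: "0 \<le> v \<bullet> (\<Sigma> *v v)"
    and levy: "levy_measure \<nu>"
begin

lemma sets_nu [measurable_cong]: "sets \<nu> = sets (borel \<Otimes>\<^sub>M borel)"
  using levy unfolding levy_measure_def borel_prod by simp

lemma Sigma_sym: "\<Sigma> $ 2 $ 1 = \<Sigma> $ 1 $ 2"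
proof -
  have "transpose \<Sigma> $ 1 $ 2 = \<Sigma> $ 2 $ 1" by (simp add: transpose_def)
  then show ?thesis by (simp add: symmetric)
qed

lemma Sigma_psd: "0 \<le> \<Sigma> $ 1 $ 1 * x\<^sup>2 + 2 * \<Sigma> $ 1 $ 2 * x * y + \<Sigma> $ 2 $ 2 * y\<^sup>2"
  using psd[of "vector [x, y]"]
  by (simp add: inner_vec_def matrix_vector_mult_def sum_2 Sigma_sym power2_eq_square algebra_simps)

lemma Sigma_diag_nonneg: "0 \<le> \<Sigma> $ 1 $ 1" "0 \<le> \<Sigma> $ 2 $ 2"
  using Sigma_psd[of 1 0] Sigma_psd[of 0 1] by simp_all

text \<open>Up to constants this integrand of the Levy condition dominates the squared increments of
  characters and the compensated characters; it is the source of integrability for all expressions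
  built from them.\<close>

definition trunc :: "real \<times> real \<Rightarrow> real" where
  "trunc p = min 1 ((fst p)\<^sup>2 + (snd p)\<^sup>2)"

lemma trunc_nonneg [simp]: "0 \<le> trunc p" by (simp add: trunc_def)

lemma trunc_measurable [measurable]: "trunc \<in> borel_measurable \<nu>"
  unfolding trunc_def[abs_def] by measurable

lemma trunc_integrable: "integrable \<nu> trunc"
proof (rule integrableI_nonneg)
  show "(\<integral>\<^sup>+p. ennreal (trunc p) \<partial>\<nu>) < \<infinity>"
    using levy by (simp add: levy_measure_def trunc_def case_prod_unfold)
qed auto

lemma integrable_trunc_bound:
  fixes f :: "real \<times> real \<Rightarrow> 'b :: {banach, second_countable_topology}"
  assumes "f \<in> borel_measurable \<nu>" "\<And>p. norm (f p) \<le> K * trunc p"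
  shows "integrable \<nu> f"
proof (rule Bochner_Integration.integrable_bound)
  show "integrable \<nu> (\<lambda>p. K * trunc p)" by (intro integrable_mult_right trunc_integrable)
  show "AE p in \<nu>. norm (f p) \<le> norm (K * trunc p)"
    using assms(2) by (intro AE_I2) (auto intro: order_trans[OF _ abs_ge_self])
qed fact

definition jump_char :: "real \<Rightarrow> real \<Rightarrow> real \<times> real \<Rightarrow> complex" where
  "jump_char u v p = cis (u * fst p + v * snd p) - 1"

lemma jump_char_measurable [measurable]: "jump_char u v \<in> borel_measurable \<nu>"
  unfolding jump_char_def[abs_def] by measurable

text \<open>In the unit disc \<open>cis t - 1\<close> has norm at most \<open>\<bar>t\<bar>\<close>,
  and Cauchy-Schwarz for the linear form contributes \<open>u\<^sup>2 + v\<^sup>2\<close>; outside,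
  the trivial bound 2 contributes the 4.\<close>

lemma norm_jump_char_le: "(norm (jump_char u v p))\<^sup>2 \<le> (4 + u\<^sup>2 + v\<^sup>2) * trunc p"
proof (cases "(fst p)\<^sup>2 + (snd p)\<^sup>2 \<le> 1")
  case True
  have "(norm (jump_char u v p))\<^sup>2 \<le> \<bar>u * fst p + v * snd p\<bar>\<^sup>2"
    unfolding jump_char_def by (intro power_mono norm_cis_minus_one_le) simp
  also have "\<dots> \<le> (u\<^sup>2 + v\<^sup>2) * ((fst p)\<^sup>2 + (snd p)\<^sup>2)"
    by (simp add: linear_form_square_le)
  also have "\<dots> \<le> (4 + u\<^sup>2 + v\<^sup>2) * ((fst p)\<^sup>2 + (snd p)\<^sup>2)"
    by (intro mult_right_mono) auto
  finally show ?thesis using True by (simp add: trunc_def)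
next
  case False
  have "(norm (jump_char u v p))\<^sup>2 \<le> 2\<^sup>2"
    unfolding jump_char_def by (intro power_mono norm_cis_minus_one_le) simp
  also have "\<dots> \<le> (4 + u\<^sup>2 + v\<^sup>2) * trunc p"
    using False by (simp add: trunc_def)
  finally show ?thesis .
qed

lemma jump_char_mult_integrable: "integrable \<nu> (\<lambda>p. jump_char u v p * cnj (jump_char u' v' p))"
proof (rule integrable_trunc_bound)
  fix p
  let ?a = "norm (jump_char u v p)" and ?c = "norm (jump_char u' v' p)"
  have "norm (jump_char u v p * cnj (jump_char u' v' p)) = ?a * ?c" by (simp add: norm_mult)
  also have "\<dots> \<le> ?a\<^sup>2 + ?c\<^sup>2"
  proof -
    have "2 * (?a * ?c) \<le> ?a\<^sup>2 + ?c\<^sup>2" "0 \<le> ?a * ?c" using sum_squares_bound[of ?a ?c] by simp_all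
    then show ?thesis by linarith
  qed
  also have "\<dots> \<le> (4 + u\<^sup>2 + v\<^sup>2) * trunc p + (4 + u'\<^sup>2 + v'\<^sup>2) * trunc p"
    by (intro add_mono norm_jump_char_le)
  finally show "norm (jump_char u v p * cnj (jump_char u' v' p)) \<le> ((4 + u\<^sup>2 + v\<^sup>2) + (4 + u'\<^sup>2 + v'\<^sup>2)) * trunc p"
    by (simp only: distrib_right)
qed measurable

definition compensated :: "real \<Rightarrow> real \<Rightarrow> real \<times> real \<Rightarrow> complex" where
  "compensated u v p = jump_char u v p - \<i> * complex_of_real ((u * fst p + v * snd p)
     * of_bool (0 < (fst p)\<^sup>2 + (snd p)\<^sup>2 \<and> (fst p)\<^sup>2 + (snd p)\<^sup>2 \<le> 1))"

lemma compensated_measurable [measurable]: "compensated u v \<in> borel_measurable \<nu>"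
  unfolding compensated_def[abs_def] of_bool_def by measurable

text \<open>In the unit disc the compensator removes the linear term and leaves a quadratic
  remainder; outside there is no compensator and \<open>cis t - 1\<close> is bounded by 2.\<close>

lemma compensated_integrable: "integrable \<nu> (compensated u v)"
proof (rule integrable_trunc_bound)
  fix p
  let ?t = "u * fst p + v * snd p"
  show "norm (compensated u v p) \<le> (2 + u\<^sup>2 + v\<^sup>2) * trunc p"
  proof (cases "p = (0, 0) \<or> (fst p)\<^sup>2 + (snd p)\<^sup>2 > 1")
    case True
    then show ?thesis
    proof
      assume "p = (0, 0)"
      then show ?thesis by (simp add: compensated_def jump_char_def trunc_def)
    next
      assume "(fst p)\<^sup>2 + (snd p)\<^sup>2 > 1"
      then show ?thesis using norm_cis_minus_one_le(2)[of ?t]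
        by (simp add: compensated_def jump_char_def trunc_def) (simp add: add.assoc add_increasing2)
    qed
  next
    case False
    then have p: "0 < (fst p)\<^sup>2 + (snd p)\<^sup>2" "(fst p)\<^sup>2 + (snd p)\<^sup>2 \<le> 1"
      by (auto simp: prod_eq_iff sum_power2_gt_zero_iff)
    have "norm (compensated u v p) = norm (cis ?t - 1 - \<i> * complex_of_real ?t)"
      using p by (simp add: compensated_def jump_char_def)
    also have "\<dots> \<le> ?t\<^sup>2 / 2" by (rule norm_cis_minus_one_minus_le)
    also have "\<dots> \<le> ?t\<^sup>2" by simp
    also have "\<dots> \<le> (u\<^sup>2 + v\<^sup>2) * ((fst p)\<^sup>2 + (snd p)\<^sup>2)" by (rule linear_form_square_le)
    also have "\<dots> \<le> (2 + u\<^sup>2 + v\<^sup>2) * ((fst p)\<^sup>2 + (snd p)\<^sup>2)" by (intro mult_right_mono) auto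
    finally show ?thesis using p by (simp add: trunc_def)
  qed
qed measurable

definition exponent :: "real \<Rightarrow> real \<Rightarrow> complex" where
  "exponent u v = characteristic_exponent b \<Sigma> \<nu> (vector [u, v])"

lemma exponent_eq:
  "exponent u v = \<i> * complex_of_real (b $ 1 * u + b $ 2 * v)
     - complex_of_real (1 / 2 * (\<Sigma> $ 1 $ 1 * u\<^sup>2 + 2 * \<Sigma> $ 1 $ 2 * u * v + \<Sigma> $ 2 $ 2 * v\<^sup>2))
     + (LINT p|\<nu>. compensated u v p)"
  unfolding exponent_def characteristic_exponent_def compensated_def jump_char_def cis_conv_exp
  by (simp add: sum_2 Sigma_sym case_prod_unfold power2_eq_square algebra_simps)

lemma cnj_exponent: "cnj (exponent u v) = exponent (- u) (- v)"
proof -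
  have "cnj (LINT p|\<nu>. compensated u v p) = (LINT p|\<nu>. cnj (compensated u v p))" by simp
  also have "\<dots> = (LINT p|\<nu>. compensated (- u) (- v) p)"
    by (intro Bochner_Integration.integral_cong)
       (simp_all add: compensated_def jump_char_def cis_cnj algebra_simps)
  finally show ?thesis unfolding exponent_eq by (simp add: algebra_simps)
qed

text \<open>The carre du champ of the generator evaluated at the origin on the character with frequency
  \<open>(u, v)\<close> and the conjugate of the character with frequency \<open>(u', v')\<close>.\<close>
definition gamma :: "real \<Rightarrow> real \<Rightarrow> real \<Rightarrow> real \<Rightarrow> complex" where
  "gamma u v u' v' = exponent (u - u') (v - v') - exponent u v - exponent (- u') (- v')"

text \<open>Drift and compensator are linear in the frequency and cancel, and the quadratic form
  leaves its polarisation. The jump part factorises because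
  \<open>(z * w - 1) - (z - 1) - (w - 1) = (z - 1) * (w - 1)\<close>.\<close>

lemma gamma_eq:
  "gamma u v u' v' = complex_of_real (\<Sigma> $ 1 $ 1 * u * u' + \<Sigma> $ 1 $ 2 * (u * v' + v * u') + \<Sigma> $ 2 $ 2 * v * v')
     + (LINT p|\<nu>. jump_char u v p * cnj (jump_char u' v' p))"
proof -
  have "(LINT p|\<nu>. compensated (u - u') (v - v') p) - (LINT p|\<nu>. compensated u v p)
      - (LINT p|\<nu>. compensated (- u') (- v') p)
    = (LINT p|\<nu>. compensated (u - u') (v - v') p - compensated u v p - compensated (- u') (- v') p)"
    by (simp add: compensated_integrable)
  also have "\<dots> = (LINT p|\<nu>. jump_char u v p * cnj (jump_char u' v' p))"
  proof (intro Bochner_Integration.integral_cong refl)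
    fix p :: "real \<times> real"
    have "cis ((u - u') * fst p + (v - v') * snd p)
      = cis (u * fst p + v * snd p) * cis (- u' * fst p + - v' * snd p)"
      by (simp add: cis_mult algebra_simps)
    then show "compensated (u - u') (v - v') p - compensated u v p - compensated (- u') (- v') p
      = jump_char u v p * cnj (jump_char u' v' p)"
      by (simp add: compensated_def jump_char_def cis_cnj algebra_simps)
  qed
  finally have "(LINT p|\<nu>. compensated (u - u') (v - v') p) - (LINT p|\<nu>. compensated u v p)
      - (LINT p|\<nu>. compensated (- u') (- v') p) = (LINT p|\<nu>. jump_char u v p * cnj (jump_char u' v' p))" .
  then show ?thesis
    unfolding gamma_def exponent_eq by (simp add: power2_eq_square algebra_simps)
qed

text \<open>Sesquilinear extension from characters to trigonometric polynomials \<open>F\<close> and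
  \<open>G\<close>. The sums of \<open>a j * u j\<close> and \<open>a j * v j\<close> are
  \<open>- \<i>\<close> times the partial derivatives of \<open>F\<close> at the origin, and the sum
  of \<open>a j * jump_char\<close> is the increment of \<open>F\<close> from the origin, so the
  right-hand side is the carre du champ of \<open>F\<close> and \<open>G\<close> there.\<close>

lemma gamma_sum:
  fixes a :: "'j \<Rightarrow> complex" and c :: "'k \<Rightarrow> complex"
  shows "(\<Sum>j\<in>J. \<Sum>k\<in>K. a j * cnj (c k) * gamma (u j) (v j) (u' k) (v' k))
    = \<Sigma> $ 1 $ 1 * (\<Sum>j\<in>J. a j * u j) * cnj (\<Sum>k\<in>K. c k * u' k)
    + \<Sigma> $ 1 $ 2 * ((\<Sum>j\<in>J. a j * u j) * cnj (\<Sum>k\<in>K. c k * v' k)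
        + (\<Sum>j\<in>J. a j * v j) * cnj (\<Sum>k\<in>K. c k * u' k))
    + \<Sigma> $ 2 $ 2 * (\<Sum>j\<in>J. a j * v j) * cnj (\<Sum>k\<in>K. c k * v' k)
    + (LINT p|\<nu>. (\<Sum>j\<in>J. a j * jump_char (u j) (v j) p) * cnj (\<Sum>k\<in>K. c k * jump_char (u' k) (v' k) p))"
proof -
  have I: "(LINT p|\<nu>. (\<Sum>j\<in>J. a j * jump_char (u j) (v j) p) * cnj (\<Sum>k\<in>K. c k * jump_char (u' k) (v' k) p))
    = (\<Sum>j\<in>J. \<Sum>k\<in>K. a j * cnj (c k) * (LINT p|\<nu>. jump_char (u j) (v j) p * cnj (jump_char (u' k) (v' k) p)))"
  proof -
    have "(LINT p|\<nu>. (\<Sum>j\<in>J. a j * jump_char (u j) (v j) p) * cnj (\<Sum>k\<in>K. c k * jump_char (u' k) (v' k) p))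
      = (LINT p|\<nu>. (\<Sum>j\<in>J. \<Sum>k\<in>K. a j * cnj (c k) * (jump_char (u j) (v j) p * cnj (jump_char (u' k) (v' k) p))))"
      by (simp add: sum_product mult_ac)
    also have "\<dots> = (\<Sum>j\<in>J. \<Sum>k\<in>K. a j * cnj (c k) * (LINT p|\<nu>. jump_char (u j) (v j) p * cnj (jump_char (u' k) (v' k) p)))"
      by (simp add: Bochner_Integration.integral_sum jump_char_mult_integrable)
    finally show ?thesis .
  qed
  show ?thesis
    unfolding I gamma_eq
    by (simp add: sum_product sum_distrib_left sum_distrib_right sum.distrib distrib_left distrib_right mult_ac)
       (simp add: sum.swap[of _ K J])
qed

end

section \<open>The two constants as bilinear inequalities\<close>

definition op_bound :: "(real \<times> real) measure \<Rightarrow> real \<Rightarrow> bool" where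
  "op_bound \<nu> s \<longleftrightarrow> 0 \<le> s \<and>
     (\<forall>\<phi>\<in>borel_measurable borel. \<forall>\<psi>\<in>borel_measurable borel.
        \<phi> 0 = 0 \<and> \<psi> 0 = 0 \<and>
        integrable \<nu> (\<lambda>(x, y). (\<phi> x)\<^sup>2) \<and> integrable \<nu> (\<lambda>(x, y). (\<psi> y)\<^sup>2) \<longrightarrow>
        (LINT (x, y)|\<nu>. \<phi> x * \<psi> y)
        \<le> s * sqrt ((LINT (x, y)|\<nu>. (\<phi> x)\<^sup>2) * (LINT (x, y)|\<nu>. (\<psi> y)\<^sup>2)))"

lemma square_integrable_zero: "square_integrable M (\<lambda>_. 0)"
  by (simp add: square_integrable_def)

lemma square_integrable_sum:
  "(\<And>i. i \<in> I \<Longrightarrow> square_integrable M (f i)) \<Longrightarrow> square_integrable M (\<lambda>x. \<Sum>i\<in>I. f i x)"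
  by (induction I rule: infinite_finite_induct)
     (auto intro!: square_integrable_add square_integrable_zero)

lemma Re_integral_mult_cnj:
  fixes f g :: "'a \<Rightarrow> complex"
  assumes "integrable M (\<lambda>x. f x * cnj (g x))"
    and "square_integrable M (\<lambda>x. Re (f x))" "square_integrable M (\<lambda>x. Im (f x))"
    and "square_integrable M (\<lambda>x. Re (g x))" "square_integrable M (\<lambda>x. Im (g x))"
  shows "Re (LINT x|M. f x * cnj (g x)) = (LINT x|M. Re (f x) * Re (g x)) + (LINT x|M. Im (f x) * Im (g x))"
proof -
  have "Re (LINT x|M. f x * cnj (g x)) = (LINT x|M. Re (f x * cnj (g x)))"
    by (rule integral_bounded_linear[OF bounded_linear_Re assms(1), symmetric])
  also have "\<dots> = (LINT x|M. Re (f x) * Re (g x) + Im (f x) * Im (g x))" by simp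
  also have "\<dots> = (LINT x|M. Re (f x) * Re (g x)) + (LINT x|M. Im (f x) * Im (g x))"
    by (intro Bochner_Integration.integral_add square_integrable_mult assms)
  finally show ?thesis .
qed

context levy_triple
begin

lemma op_bound_one: "op_bound \<nu> 1"
  unfolding op_bound_def
proof (intro conjI ballI impI)
  fix \<phi> \<psi> :: "real \<Rightarrow> real"
  assume [measurable]: "\<phi> \<in> borel_measurable borel" "\<psi> \<in> borel_measurable borel"
    and "\<phi> 0 = 0 \<and> \<psi> 0 = 0 \<and> integrable \<nu> (\<lambda>(x, y). (\<phi> x)\<^sup>2) \<and> integrable \<nu> (\<lambda>(x, y). (\<psi> y)\<^sup>2)"
  then have "square_integrable \<nu> (\<lambda>p. \<phi> (fst p))" "square_integrable \<nu> (\<lambda>p. \<psi> (snd p))"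
    by (auto simp: square_integrable_def case_prod_unfold)
  from integral_Cauchy_Schwarz[OF this]
  show "(LINT (x, y)|\<nu>. \<phi> x * \<psi> y)
      \<le> 1 * sqrt ((LINT (x, y)|\<nu>. (\<phi> x)\<^sup>2) * (LINT (x, y)|\<nu>. (\<psi> y)\<^sup>2))"
    by (simp add: case_prod_unfold)
qed simp

text \<open>For fixed test functions the inequality is a closed condition on \<open>s\<close>, so
  the infimum is admissible and the \<open>LEAST\<close> in \<open>Op\<close> is a true minimum. If
  the root on the right is 0, no division is possible, and admissibility of 1 shows that the
  left-hand side is at most 0.\<close>

lemma op_bound_Inf: "op_bound \<nu> (Inf {s. op_bound \<nu> s})"
proof -
  let ?S = "{s. op_bound \<nu> s}"
  have ne: "?S \<noteq> {}" using op_bound_one by auto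
  show ?thesis
    unfolding op_bound_def[of _ "Inf ?S"]
  proof (intro conjI ballI impI)
    show "0 \<le> Inf ?S" using ne by (intro cInf_greatest) (auto simp: op_bound_def)
    fix \<phi> \<psi> :: "real \<Rightarrow> real"
    assume \<phi>: "\<phi> \<in> borel_measurable borel" and \<psi>: "\<psi> \<in> borel_measurable borel"
      and int: "\<phi> 0 = 0 \<and> \<psi> 0 = 0 \<and> integrable \<nu> (\<lambda>(x, y). (\<phi> x)\<^sup>2) \<and> integrable \<nu> (\<lambda>(x, y). (\<psi> y)\<^sup>2)"
    let ?l = "LINT (x, y)|\<nu>. \<phi> x * \<psi> y"
    let ?r = "sqrt ((LINT (x, y)|\<nu>. (\<phi> x)\<^sup>2) * (LINT (x, y)|\<nu>. (\<psi> y)\<^sup>2))"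
    have le: "?l \<le> s * ?r" if "s \<in> ?S" for s
      using that \<phi> \<psi> int unfolding op_bound_def by blast
    have r0: "0 \<le> ?r" by (simp add: case_prod_unfold)
    show "?l \<le> Inf ?S * ?r"
    proof (cases "?r = 0")
      case True
      have "?l \<le> 1 * ?r" using le[of 1] op_bound_one by blast
      then show ?thesis unfolding True by simp
    next
      case False
      have r: "0 < ?r" by (rule le_neq_trans[OF r0 False[symmetric]])
      have "?l / ?r \<le> Inf ?S"
        using le r ne by (intro cInf_greatest) (auto simp only: pos_divide_le_eq)
      then show ?thesis using r by (simp only: pos_divide_le_eq)
    qed
  qed
qed

lemma Op_eq_Inf: "Op \<nu> = Inf {s. op_bound \<nu> s}"
  unfolding Op_def op_bound_def[symmetric]
proof (rule Least_equality)
  fix s assume "op_bound \<nu> s"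
  then show "Inf {s. op_bound \<nu> s} \<le> s"
    by (intro cInf_lower bdd_belowI[of _ 0]) (auto simp: op_bound_def)
qed (rule op_bound_Inf)

lemma op_bound_Op: "op_bound \<nu> (Op \<nu>)"
  using op_bound_Inf by (simp add: Op_eq_Inf)

lemma Op_nonneg: "0 \<le> Op \<nu>"
  using op_bound_Op by (simp add: op_bound_def)

lemma Op_le: "op_bound \<nu> s \<Longrightarrow> Op \<nu> \<le> s"
  unfolding Op_eq_Inf by (intro cInf_lower bdd_belowI[of _ 0]) (auto simp: op_bound_def)

lemma Op_arith_mean:
  assumes "\<phi> \<in> borel_measurable borel" "\<psi> \<in> borel_measurable borel" "\<phi> 0 = 0" "\<psi> 0 = 0"
    and "square_integrable \<nu> (\<lambda>p. \<phi> (fst p))" "square_integrable \<nu> (\<lambda>p. \<psi> (snd p))"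
  shows "(LINT p|\<nu>. \<phi> (fst p) * \<psi> (snd p))
    \<le> Op \<nu> / 2 * ((LINT p|\<nu>. (\<phi> (fst p))\<^sup>2) + (LINT p|\<nu>. (\<psi> (snd p))\<^sup>2))"
proof -
  have "(LINT p|\<nu>. \<phi> (fst p) * \<psi> (snd p))
    \<le> Op \<nu> * sqrt ((LINT p|\<nu>. (\<phi> (fst p))\<^sup>2) * (LINT p|\<nu>. (\<psi> (snd p))\<^sup>2))"
    using op_bound_Op assms unfolding op_bound_def case_prod_unfold square_integrable_def by blast
  also have "\<dots> \<le> Op \<nu> * (((LINT p|\<nu>. (\<phi> (fst p))\<^sup>2) + (LINT p|\<nu>. (\<psi> (snd p))\<^sup>2)) / 2)"
    by (intro mult_left_mono arith_geo_mean_sqrt Op_nonneg) auto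
  finally show ?thesis by simp
qed

text \<open>Also true where the correlation is 0 by convention: a positive semidefinite form with a
  vanishing diagonal entry has no mixed term.\<close>

lemma abs_Sigma_12: "\<bar>\<Sigma> $ 1 $ 2\<bar> = \<bar>gaussian_correlation \<Sigma>\<bar> * (sqrt (\<Sigma> $ 1 $ 1) * sqrt (\<Sigma> $ 2 $ 2))"
proof (cases "\<Sigma> $ 1 $ 1 * \<Sigma> $ 2 $ 2 > 0")
  case True
  then have "0 < \<Sigma> $ 1 $ 1" "0 < \<Sigma> $ 2 $ 2"
    using Sigma_diag_nonneg by (auto simp: zero_less_mult_iff)
  then show ?thesis
    by (simp add: gaussian_correlation_def real_sqrt_mult abs_divide abs_mult)
next
  case False
  have "\<Sigma> $ 1 $ 2 = 0"
  proof (rule ccontr)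
    assume ne: "\<Sigma> $ 1 $ 2 \<noteq> 0"
    \<comment> \<open>If a diagonal entry vanishes, the form is affine in the corresponding
      variable; these arguments give it the value -1.\<close>
    let ?x = "- (\<Sigma> $ 2 $ 2 + 1) / (2 * \<Sigma> $ 1 $ 2)" and ?y = "- (\<Sigma> $ 1 $ 1 + 1) / (2 * \<Sigma> $ 1 $ 2)"
    have "\<Sigma> $ 1 $ 1 * \<Sigma> $ 2 $ 2 = 0"
      using False mult_nonneg_nonneg[OF Sigma_diag_nonneg] by linarith
    then consider "\<Sigma> $ 1 $ 1 = 0" | "\<Sigma> $ 2 $ 2 = 0" by auto
    then show False
    proof cases
      case 1
      then show False using Sigma_psd[of ?x 1] ne by (simp add: field_simps)
    next
      case 2
      then show False using Sigma_psd[of 1 ?y] ne by (simp add: field_simps)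
    qed
  qed
  moreover have "gaussian_correlation \<Sigma> = 0" using False by (simp add: gaussian_correlation_def)
  ultimately show ?thesis by simp
qed

lemma gaussian_arith_mean:
  "\<Sigma> $ 1 $ 2 * (x * y) \<le> \<bar>gaussian_correlation \<Sigma>\<bar> / 2 * (\<Sigma> $ 1 $ 1 * x\<^sup>2 + \<Sigma> $ 2 $ 2 * y\<^sup>2)"
proof -
  let ?r = "\<bar>gaussian_correlation \<Sigma>\<bar>" and ?p = "sqrt (\<Sigma> $ 1 $ 1)" and ?q = "sqrt (\<Sigma> $ 2 $ 2)"
  have "\<Sigma> $ 1 $ 2 * (x * y) \<le> \<bar>\<Sigma> $ 1 $ 2\<bar> * (\<bar>x\<bar> * \<bar>y\<bar>)"
    by (metis abs_ge_self abs_mult)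
  also have "\<dots> = ?r / 2 * (2 * (?p * \<bar>x\<bar>) * (?q * \<bar>y\<bar>))"
    unfolding abs_Sigma_12 by simp
  also have "\<dots> \<le> ?r / 2 * ((?p * \<bar>x\<bar>)\<^sup>2 + (?q * \<bar>y\<bar>)\<^sup>2)"
    by (intro mult_left_mono sum_squares_bound) simp
  also have "\<dots> = ?r / 2 * (\<Sigma> $ 1 $ 1 * x\<^sup>2 + \<Sigma> $ 2 $ 2 * y\<^sup>2)"
    by (simp add: power_mult_distrib Sigma_diag_nonneg)
  finally show ?thesis .
qed

lemma jump_char_square_integrable:
  "square_integrable \<nu> (\<lambda>p. Re (a * jump_char u v p))" "square_integrable \<nu> (\<lambda>p. Im (a * jump_char u v p))"
proof -
  have le: "(norm (a * jump_char u v p))\<^sup>2 \<le> (norm a)\<^sup>2 * (4 + u\<^sup>2 + v\<^sup>2) * trunc p" for p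
    using mult_left_mono[OF norm_jump_char_le[of u v p], of "(norm a)\<^sup>2"]
    by (simp add: norm_mult power_mult_distrib mult.assoc)
  have re: "(Re z)\<^sup>2 \<le> (norm z)\<^sup>2" and im: "(Im z)\<^sup>2 \<le> (norm z)\<^sup>2" for z
    by (simp_all add: cmod_power2)
  show "square_integrable \<nu> (\<lambda>p. Re (a * jump_char u v p))"
    unfolding square_integrable_def
    by (intro conjI integrable_trunc_bound[where K="(norm a)\<^sup>2 * (4 + u\<^sup>2 + v\<^sup>2)"])
       (use order_trans[OF re le] in auto)
  show "square_integrable \<nu> (\<lambda>p. Im (a * jump_char u v p))"
    unfolding square_integrable_def
    by (intro conjI integrable_trunc_bound[where K="(norm a)\<^sup>2 * (4 + u\<^sup>2 + v\<^sup>2)"])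
       (use order_trans[OF im le] in auto)
qed

lemma jump_sum_square_integrable:
  "square_integrable \<nu> (\<lambda>p. Re (\<Sum>j\<in>J. a j * jump_char (u j) (v j) p))"
  "square_integrable \<nu> (\<lambda>p. Im (\<Sum>j\<in>J. a j * jump_char (u j) (v j) p))"
  unfolding Re_sum Im_sum by (intro square_integrable_sum jump_char_square_integrable)+

lemma jump_sum_mult_integrable:
  "integrable \<nu> (\<lambda>p. (\<Sum>j\<in>J. a j * jump_char (u j) (v j) p) * cnj (\<Sum>k\<in>K. c k * jump_char (u' k) (v' k) p))"
proof -
  have "(\<Sum>j\<in>J. a j * jump_char (u j) (v j) p) * cnj (\<Sum>k\<in>K. c k * jump_char (u' k) (v' k) p)
    = (\<Sum>j\<in>J. \<Sum>k\<in>K. a j * cnj (c k) * (jump_char (u j) (v j) p * cnj (jump_char (u' k) (v' k) p)))" for p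
    by (simp add: sum_product mult_ac)
  then show ?thesis
    by (simp only:) (intro Bochner_Integration.integrable_sum integrable_mult_right jump_char_mult_integrable)
qed

text \<open>With \<open>F\<close> a function of \<open>x\<close> and \<open>G\<close> a function of
  \<open>y\<close>, only the mixed entry of \<Sigma> and the mixed jump integral remain on the left.
  Since \<open>Re (z * cnj w) = Re z * Re w + Im z * Im w\<close>, real and imaginary parts
  separate. Each of the resulting two Gaussian and two jump products obeys the arithmetic-mean bound
  with its own constant, which is at most \<open>C\<close>. Subtracting the value at 0 makes
  \<open>F\<close> and \<open>G\<close> admissible for \<open>Op\<close>.\<close>

lemma gamma_ineq:
  fixes a :: "'j \<Rightarrow> complex" and c :: "'k \<Rightarrow> complex"
  defines "C \<equiv> max \<bar>gaussian_correlation \<Sigma>\<bar> (Op \<nu>)"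
  shows "Re (\<Sum>j\<in>J. \<Sum>k\<in>K. a j * cnj (c k) * gamma (u j) 0 0 (v k))
    \<le> C / 2 * (Re (\<Sum>j\<in>J. \<Sum>k\<in>J. a j * cnj (a k) * gamma (u j) 0 (u k) 0)
              + Re (\<Sum>j\<in>K. \<Sum>k\<in>K. c j * cnj (c k) * gamma 0 (v j) 0 (v k)))"
proof -
  define P where "P = (\<Sum>j\<in>J. a j * u j)"
  define Q where "Q = (\<Sum>k\<in>K. c k * v k)"
  define F where "F x = (\<Sum>j\<in>J. a j * (cis (u j * x) - 1))" for x
  define G where "G y = (\<Sum>k\<in>K. c k * (cis (v k * y) - 1))" for y
  have F: "(\<Sum>j\<in>J. a j * jump_char (u j) 0 p) = F (fst p)" for p by (simp add: F_def jump_char_def)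
  have G: "(\<Sum>k\<in>K. c k * jump_char 0 (v k) p) = G (snd p)" for p by (simp add: G_def jump_char_def)
  have Fm [measurable]: "F \<in> borel_measurable borel" unfolding F_def[abs_def] by measurable
  have Gm [measurable]: "G \<in> borel_measurable borel" unfolding G_def[abs_def] by measurable
  have Fs: "square_integrable \<nu> (\<lambda>p. Re (F (fst p)))" "square_integrable \<nu> (\<lambda>p. Im (F (fst p)))"
    using jump_sum_square_integrable[of a u "\<lambda>_. 0" J] by (simp_all add: F)
  have Gs: "square_integrable \<nu> (\<lambda>p. Re (G (snd p)))" "square_integrable \<nu> (\<lambda>p. Im (G (snd p)))"
    using jump_sum_square_integrable[of c "\<lambda>_. 0" v K] by (simp_all add: G)
  have FG: "integrable \<nu> (\<lambda>p. F (fst p) * cnj (G (snd p)))"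
    using jump_sum_mult_integrable[of a u "\<lambda>_. 0" J c "\<lambda>_. 0" v K] by (simp only: F G)
  have FF: "integrable \<nu> (\<lambda>p. F (fst p) * cnj (F (fst p)))"
    using jump_sum_mult_integrable[of a u "\<lambda>_. 0" J a u "\<lambda>_. 0" J] by (simp only: F)
  have GG: "integrable \<nu> (\<lambda>p. G (snd p) * cnj (G (snd p)))"
    using jump_sum_mult_integrable[of c "\<lambda>_. 0" v K c "\<lambda>_. 0" v K] by (simp only: G)
  have C: "\<bar>gaussian_correlation \<Sigma>\<bar> \<le> C" "Op \<nu> \<le> C" by (simp_all add: C_def)
  have 1: "Re (\<Sum>j\<in>J. \<Sum>k\<in>K. a j * cnj (c k) * gamma (u j) 0 0 (v k))
    = \<Sigma> $ 1 $ 2 * (Re P * Re Q) + \<Sigma> $ 1 $ 2 * (Im P * Im Q)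
      + (LINT p|\<nu>. Re (F (fst p)) * Re (G (snd p))) + (LINT p|\<nu>. Im (F (fst p)) * Im (G (snd p)))"
    using gamma_sum[of a c u "\<lambda>_. 0" "\<lambda>_. 0" v K J] Re_integral_mult_cnj[OF FG Fs Gs]
    unfolding F G P_def[symmetric] Q_def[symmetric] by (simp add: distrib_left)
  have 2: "Re (\<Sum>j\<in>J. \<Sum>k\<in>J. a j * cnj (a k) * gamma (u j) 0 (u k) 0)
    = \<Sigma> $ 1 $ 1 * (Re P)\<^sup>2 + \<Sigma> $ 1 $ 1 * (Im P)\<^sup>2
      + (LINT p|\<nu>. (Re (F (fst p)))\<^sup>2) + (LINT p|\<nu>. (Im (F (fst p)))\<^sup>2)"
    using gamma_sum[of a a u "\<lambda>_. 0" u "\<lambda>_. 0" J J] Re_integral_mult_cnj[OF FF Fs Fs]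
    unfolding F P_def[symmetric] by (simp add: power2_eq_square mult.assoc distrib_left)
  have 3: "Re (\<Sum>j\<in>K. \<Sum>k\<in>K. c j * cnj (c k) * gamma 0 (v j) 0 (v k))
    = \<Sigma> $ 2 $ 2 * (Re Q)\<^sup>2 + \<Sigma> $ 2 $ 2 * (Im Q)\<^sup>2
      + (LINT p|\<nu>. (Re (G (snd p)))\<^sup>2) + (LINT p|\<nu>. (Im (G (snd p)))\<^sup>2)"
    using gamma_sum[of c c "\<lambda>_. 0" v "\<lambda>_. 0" v K K] Re_integral_mult_cnj[OF GG Gs Gs]
    unfolding G Q_def[symmetric] by (simp add: power2_eq_square mult.assoc distrib_left)
  have g: "\<Sigma> $ 1 $ 2 * (x * y) \<le> C / 2 * (\<Sigma> $ 1 $ 1 * x\<^sup>2 + \<Sigma> $ 2 $ 2 * y\<^sup>2)" for x y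
    by (rule order_trans[OF gaussian_arith_mean])
       (use C(1) in \<open>intro mult_right_mono add_nonneg_nonneg mult_nonneg_nonneg Sigma_diag_nonneg, auto\<close>)
  have o: "(LINT p|\<nu>. \<phi> (fst p) * \<psi> (snd p))
      \<le> C / 2 * ((LINT p|\<nu>. (\<phi> (fst p))\<^sup>2) + (LINT p|\<nu>. (\<psi> (snd p))\<^sup>2))"
    if "\<phi> \<in> borel_measurable borel" "\<psi> \<in> borel_measurable borel" "\<phi> 0 = 0" "\<psi> 0 = 0"
      "square_integrable \<nu> (\<lambda>p. \<phi> (fst p))" "square_integrable \<nu> (\<lambda>p. \<psi> (snd p))" for \<phi> \<psi>
    by (rule order_trans[OF Op_arith_mean[OF that]])
       (use C(2) in \<open>intro mult_right_mono add_nonneg_nonneg, auto\<close>)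
  have F0: "F 0 = 0" "G 0 = 0" by (simp_all add: F_def G_def)
  have oR: "(LINT p|\<nu>. Re (F (fst p)) * Re (G (snd p)))
      \<le> C / 2 * ((LINT p|\<nu>. (Re (F (fst p)))\<^sup>2) + (LINT p|\<nu>. (Re (G (snd p)))\<^sup>2))"
    by (rule o) (use Fs Gs F0 in auto)
  have oI: "(LINT p|\<nu>. Im (F (fst p)) * Im (G (snd p)))
      \<le> C / 2 * ((LINT p|\<nu>. (Im (F (fst p)))\<^sup>2) + (LINT p|\<nu>. (Im (G (snd p)))\<^sup>2))"
    by (rule o) (use Fs Gs F0 in auto)
  show ?thesis
    unfolding 1 2 3
    using g[of "Re P" "Re Q"] g[of "Im P" "Im Q"] oR oI by (simp add: algebra_simps)
qed

end

subsection \<open>The upper bound\<close>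

lemma cis_sum: "cis (\<Sum>i\<in>I. f i) = (\<Prod>i\<in>I. cis (f i))"
  by (induction I rule: infinite_finite_induct) (simp_all add: cis_mult[symmetric])

locale levy_pair =
  fixes M :: "'a measure" and X Y :: "real \<Rightarrow> 'a \<Rightarrow> real"
    and b :: "real ^ 2" and \<Sigma> :: "real ^ 2 ^ 2" and \<nu> :: "(real \<times> real) measure"
  assumes process: "levy_process M (\<lambda>t \<omega>. (X t \<omega>, Y t \<omega>))"
    and char_triple: "has_characteristic_triple M (\<lambda>t \<omega>. (X t \<omega>, Y t \<omega>)) b \<Sigma> \<nu>"

sublocale levy_pair \<subseteq> prob_space M
  using process by (simp add: levy_process_def)

sublocale levy_pair \<subseteq> levy_triple b \<Sigma> \<nu>
  using char_triple by unfold_locales (simp_all add: has_characteristic_triple_def)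

context levy_pair
begin

lemma pair_measurable: "0 \<le> t \<Longrightarrow> (\<lambda>\<omega>. (X t \<omega>, Y t \<omega>)) \<in> borel_measurable M"
  using process by (simp add: levy_process_def)

lemma X_measurable: "0 \<le> t \<Longrightarrow> X t \<in> borel_measurable M"
  using measurable_compose[OF pair_measurable borel_measurable_continuous_onI[of fst]]
  by (simp add: continuous_on_fst continuous_on_id)

lemma Y_measurable: "0 \<le> t \<Longrightarrow> Y t \<in> borel_measurable M"
  using measurable_compose[OF pair_measurable borel_measurable_continuous_onI[of snd]]
  by (simp add: continuous_on_snd continuous_on_id)

lemma char_function:
  assumes "0 \<le> t"
  shows "(LINT \<omega>|M. cis (u * X t \<omega> + v * Y t \<omega>)) = exp (t * exponent u v)"
proof -
  have "\<forall>w. (LINT \<omega>|M. iexp (w $ 1 * X t \<omega> + w $ 2 * Y t \<omega>))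
      = exp (complex_of_real t * characteristic_exponent b \<Sigma> \<nu> w)"
    using char_triple assms by (simp add: has_characteristic_triple_def)
  from spec[OF this, of "vector [u, v]"] show ?thesis
    by (simp add: exponent_def cis_conv_exp)
qed

definition increment :: "(nat \<Rightarrow> real) \<Rightarrow> nat \<Rightarrow> (nat \<Rightarrow> real) \<Rightarrow> (nat \<Rightarrow> real) \<Rightarrow> 'a \<Rightarrow> real" where
  "increment \<tau> n u v \<omega> =
     (\<Sum>i<n. u i * (X (\<tau> (Suc i)) \<omega> - X (\<tau> i) \<omega>) + v i * (Y (\<tau> (Suc i)) \<omega> - Y (\<tau> i) \<omega>))"

definition grid_exponent :: "(nat \<Rightarrow> real) \<Rightarrow> nat \<Rightarrow> (nat \<Rightarrow> real) \<Rightarrow> (nat \<Rightarrow> real) \<Rightarrow> complex" where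
  "grid_exponent \<tau> n u v = (\<Sum>i<n. (\<tau> (Suc i) - \<tau> i) * exponent (u i) (v i))"

lemma increment_measurable:
  assumes "mono \<tau>" "0 \<le> \<tau> 0"
  shows "increment \<tau> n u v \<in> borel_measurable M"
proof -
  have "0 \<le> \<tau> i" for i using assms monoD[OF assms(1), of 0 i] by simp
  then show ?thesis
    unfolding increment_def[abs_def]
    by (intro borel_measurable_sum borel_measurable_add borel_measurable_times borel_measurable_diff
        X_measurable Y_measurable borel_measurable_const)
qed

lemma cis_increment_integrable:
  assumes "mono \<tau>" "0 \<le> \<tau> 0"
  shows "integrable M (\<lambda>\<omega>. cis (increment \<tau> n u v \<omega>))"
  using increment_measurable[OF assms] by (intro integrable_const_bound[of _ 1]) auto

text \<open>The triple only describes the law of the pair at a single time: independence splits the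
  expectation into one factor per grid interval, and stationarity moves each factor to an interval
  that starts at 0.\<close>

lemma increment_char:
  assumes \<tau>: "mono \<tau>" "0 \<le> \<tau> 0"
  shows "(LINT \<omega>|M. cis (increment \<tau> n u v \<omega>)) = exp (grid_exponent \<tau> n u v)"
proof -
  define Z where "Z t \<omega> = (X t \<omega>, Y t \<omega>)" for t \<omega>
  define g where "g i p = cis (u i * fst p + v i * snd p)" for i and p :: "real \<times> real"
  have g: "g i \<in> borel_measurable borel" for i
    unfolding g_def[abs_def] by (intro borel_measurable_continuous_onI continuous_intros)
  have \<tau>0: "0 \<le> \<tau> i" for i using \<tau> monoD[OF \<tau>(1), of 0 i] by simp
  have Zm: "Z t \<in> borel_measurable M" if "0 \<le> t" for t
    using pair_measurable[OF that] by (simp add: Z_def[abs_def])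
  have indep: "indep_vars (\<lambda>_. borel) (\<lambda>i \<omega>. Z (\<tau> (Suc i)) \<omega> - Z (\<tau> i) \<omega>) {..<n}"
    using process \<tau> unfolding levy_process_def Z_def by blast
  have "(LINT \<omega>|M. g i (Z (\<tau> (Suc i)) \<omega> - Z (\<tau> i) \<omega>)) = exp ((\<tau> (Suc i) - \<tau> i) * exponent (u i) (v i))" for i
  proof -
    define s where "s = \<tau> (Suc i) - \<tau> i"
    have s: "0 \<le> s" "\<tau> (Suc i) = \<tau> i + s" using monoD[OF \<tau>(1), of i "Suc i"] by (simp_all add: s_def)
    have "(LINT \<omega>|M. g i (Z (\<tau> i + s) \<omega> - Z (\<tau> i) \<omega>))
        = (LINT p|distr M borel (\<lambda>\<omega>. Z (\<tau> i + s) \<omega> - Z (\<tau> i) \<omega>). g i p)"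
      using Zm \<tau>0 s by (intro integral_distr[symmetric] g) simp_all
    also have "distr M borel (\<lambda>\<omega>. Z (\<tau> i + s) \<omega> - Z (\<tau> i) \<omega>) = distr M borel (Z s)"
      using process \<tau>0[of i] s(1) unfolding levy_process_def Z_def by blast
    also have "(LINT p|distr M borel (Z s). g i p) = (LINT \<omega>|M. g i (Z s \<omega>))"
      using Zm s by (intro integral_distr g)
    also have "\<dots> = exp (s * exponent (u i) (v i))"
      using char_function[OF s(1)] by (simp add: g_def Z_def)
    finally show ?thesis unfolding s(2) by simp
  qed
  then have "(\<Prod>i<n. LINT \<omega>|M. g i (Z (\<tau> (Suc i)) \<omega> - Z (\<tau> i) \<omega>)) = exp (grid_exponent \<tau> n u v)"
    by (simp add: grid_exponent_def exp_sum)
  moreover have "(LINT \<omega>|M. (\<Prod>i<n. g i (Z (\<tau> (Suc i)) \<omega> - Z (\<tau> i) \<omega>)))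
      = (\<Prod>i<n. LINT \<omega>|M. g i (Z (\<tau> (Suc i)) \<omega> - Z (\<tau> i) \<omega>))"
  proof (rule indep_vars_lebesgue_integral)
    show "indep_vars (\<lambda>_. borel) (\<lambda>i \<omega>. g i (Z (\<tau> (Suc i)) \<omega> - Z (\<tau> i) \<omega>)) {..<n}"
      by (rule indep_vars_compose2[OF indep g])
    show "integrable M (\<lambda>\<omega>. g i (Z (\<tau> (Suc i)) \<omega> - Z (\<tau> i) \<omega>))" for i
      using Zm \<tau>0 by (intro integrable_const_bound[of _ 1] measurable_compose[OF _ g]) (simp_all add: g_def)
  qed simp
  ultimately show ?thesis by (simp add: increment_def cis_sum g_def Z_def)
qed

lemma grid_exponent_gamma:
  "grid_exponent \<tau> n (\<lambda>i. u i - u' i) (\<lambda>i. v i - v' i) - grid_exponent \<tau> n u v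
     - grid_exponent \<tau> n (\<lambda>i. - u' i) (\<lambda>i. - v' i)
   = (\<Sum>i<n. (\<tau> (Suc i) - \<tau> i) * gamma (u i) (v i) (u' i) (v' i))"
  by (simp add: grid_exponent_def gamma_def right_diff_distrib sum_subtractf)

lemma grid_exponent_scale:
  "grid_exponent (\<lambda>i. s * \<tau> i) n u v = s * grid_exponent \<tau> n u v"
  by (simp add: grid_exponent_def sum_distrib_left algebra_simps)

lemma cnj_grid_exponent:
  "cnj (grid_exponent \<tau> n u v) = grid_exponent \<tau> n (\<lambda>i. - u i) (\<lambda>i. - v i)"
  by (simp add: grid_exponent_def cnj_exponent)

lemma cis_increment_mult_cnj:
  "cis (increment \<tau> n u v \<omega>) * cnj (cis (increment \<tau> n u' v' \<omega>))
    = cis (increment \<tau> n (\<lambda>i. u i - u' i) (\<lambda>i. v i - v' i) \<omega>)"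
proof -
  have "increment \<tau> n u v \<omega> + - increment \<tau> n u' v' \<omega> = increment \<tau> n (\<lambda>i. u i - u' i) (\<lambda>i. v i - v' i) \<omega>"
    unfolding increment_def sum_negf[symmetric] sum.distrib[symmetric]
    by (intro sum.cong refl) (simp add: algebra_simps)
  then show ?thesis by (simp add: cis_cnj cis_mult)
qed

text \<open>For \<open>s \<in> [0, 1]\<close> this is \<open>E (F\<^sub>s cnj G\<^sub>s)\<close>, where \<open>F\<^sub>s\<close> and \<open>G\<^sub>s\<close> are the conditional expectations of two
  trigonometric polynomials in the increments, given the first fraction \<open>s\<close> of each increment.\<close>
definition interpolation ::
  "(nat \<Rightarrow> real) \<Rightarrow> nat \<Rightarrow> 'j set \<Rightarrow> ('j \<Rightarrow> complex) \<Rightarrow> ('j \<Rightarrow> nat \<Rightarrow> real) \<Rightarrow> ('j \<Rightarrow> nat \<Rightarrow> real) \<Rightarrow>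
     'k set \<Rightarrow> ('k \<Rightarrow> complex) \<Rightarrow> ('k \<Rightarrow> nat \<Rightarrow> real) \<Rightarrow> ('k \<Rightarrow> nat \<Rightarrow> real) \<Rightarrow> real \<Rightarrow> complex" where
  "interpolation \<tau> n J a u v K c u' v' s = (\<Sum>j\<in>J. \<Sum>k\<in>K. a j * cnj (c k) *
     exp ((1 - s) * (grid_exponent \<tau> n (u j) (v j) + grid_exponent \<tau> n (\<lambda>i. - u' k i) (\<lambda>i. - v' k i))
          + s * grid_exponent \<tau> n (\<lambda>i. u j i - u' k i) (\<lambda>i. v j i - v' k i)))"

definition trig_increment ::
  "(nat \<Rightarrow> real) \<Rightarrow> nat \<Rightarrow> 'j set \<Rightarrow> ('j \<Rightarrow> complex) \<Rightarrow> ('j \<Rightarrow> nat \<Rightarrow> real) \<Rightarrow> ('j \<Rightarrow> nat \<Rightarrow> real) \<Rightarrow> 'a \<Rightarrow> complex" where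
  "trig_increment \<tau> n J a u v \<omega> = (\<Sum>j\<in>J. a j * cis (increment \<tau> n (u j) (v j) \<omega>))"

lemma trig_increment_mult_cnj:
  "trig_increment \<tau> n J a u v \<omega> * cnj (trig_increment \<tau> n K c u' v' \<omega>)
   = (\<Sum>j\<in>J. \<Sum>k\<in>K. a j * cnj (c k) * cis (increment \<tau> n (\<lambda>i. u j i - u' k i) (\<lambda>i. v j i - v' k i) \<omega>))"
  unfolding trig_increment_def sum_product cnj_sum complex_cnj_mult cis_increment_mult_cnj[symmetric]
  by (simp add: mult_ac)

lemma interpolation_1:
  assumes "mono \<tau>" "0 \<le> \<tau> 0"
  shows "interpolation \<tau> n J a u v K c u' v' 1
    = (LINT \<omega>|M. trig_increment \<tau> n J a u v \<omega> * cnj (trig_increment \<tau> n K c u' v' \<omega>))"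
  unfolding trig_increment_mult_cnj
  by (simp add: interpolation_def increment_char[OF assms] cis_increment_integrable[OF assms]
      Bochner_Integration.integral_sum)

lemma integral_trig_increment:
  assumes "mono \<tau>" "0 \<le> \<tau> 0"
  shows "(LINT \<omega>|M. trig_increment \<tau> n J a u v \<omega>) = (\<Sum>j\<in>J. a j * exp (grid_exponent \<tau> n (u j) (v j)))"
  unfolding trig_increment_def
  by (simp add: increment_char[OF assms] cis_increment_integrable[OF assms])

lemma interpolation_0:
  assumes "mono \<tau>" "0 \<le> \<tau> 0"
  shows "interpolation \<tau> n J a u v K c u' v' 0
    = (LINT \<omega>|M. trig_increment \<tau> n J a u v \<omega>) * cnj (LINT \<omega>|M. trig_increment \<tau> n K c u' v' \<omega>)"
  unfolding integral_trig_increment[OF assms] interpolation_def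
  by (simp add: sum_product exp_add exp_cnj cnj_grid_exponent mult_ac)

text \<open>The carre du champ of the conditional expectations in \<open>interpolation\<close>,
  summed over the grid intervals with their lengths as weights. Given the first fraction
  \<open>s\<close> of each increment, a character becomes the character of these fractions times
  \<open>exp ((1 - s) * grid_exponent)\<close>. The increments on the scaled grid
  \<open>s * \<tau> i\<close> stand in for the fractions: they have the same joint law, which is all
  that the expectation sees.\<close>

definition interpolation_gamma ::
  "(nat \<Rightarrow> real) \<Rightarrow> nat \<Rightarrow> 'j set \<Rightarrow> ('j \<Rightarrow> complex) \<Rightarrow> ('j \<Rightarrow> nat \<Rightarrow> real) \<Rightarrow> ('j \<Rightarrow> nat \<Rightarrow> real) \<Rightarrow>
     'k set \<Rightarrow> ('k \<Rightarrow> complex) \<Rightarrow> ('k \<Rightarrow> nat \<Rightarrow> real) \<Rightarrow> ('k \<Rightarrow> nat \<Rightarrow> real) \<Rightarrow> real \<Rightarrow> 'a \<Rightarrow> complex" where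
  "interpolation_gamma \<tau> n J a u v K c u' v' s \<omega> = (\<Sum>i<n. (\<tau> (Suc i) - \<tau> i) * (\<Sum>j\<in>J. \<Sum>k\<in>K.
     (a j * exp ((1 - s) * grid_exponent \<tau> n (u j) (v j)) * cis (increment (\<lambda>i. s * \<tau> i) n (u j) (v j) \<omega>))
     * cnj (c k * exp ((1 - s) * grid_exponent \<tau> n (u' k) (v' k)) * cis (increment (\<lambda>i. s * \<tau> i) n (u' k) (v' k) \<omega>))
     * gamma (u j i) (v j i) (u' k i) (v' k i)))"

lemma interpolation_gamma_eq:
  "interpolation_gamma \<tau> n J a u v K c u' v' s \<omega> = (\<Sum>i<n. \<Sum>j\<in>J. \<Sum>k\<in>K.
     (\<tau> (Suc i) - \<tau> i) * (a j * cnj (c k)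
     * exp ((1 - s) * (grid_exponent \<tau> n (u j) (v j) + grid_exponent \<tau> n (\<lambda>i. - u' k i) (\<lambda>i. - v' k i)))
     * gamma (u j i) (v j i) (u' k i) (v' k i))
     * cis (increment (\<lambda>i. s * \<tau> i) n (\<lambda>i. u j i - u' k i) (\<lambda>i. v j i - v' k i) \<omega>))"
  unfolding interpolation_gamma_def sum_distrib_left cis_increment_mult_cnj[symmetric]
  by (simp add: exp_cnj cnj_grid_exponent exp_add distrib_left mult_ac)

lemma interpolation_gamma_integrable:
  assumes \<tau>: "mono \<tau>" "0 \<le> \<tau> 0" and s: "0 \<le> s"
  shows "integrable M (interpolation_gamma \<tau> n J a u v K c u' v' s)"
proof -
  have "mono (\<lambda>i. s * \<tau> i)" "0 \<le> s * \<tau> 0"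
    using assms by (auto simp: mono_def intro: mult_left_mono)
  then show ?thesis
    unfolding interpolation_gamma_eq[abs_def]
    by (intro Bochner_Integration.integrable_sum integrable_mult_right cis_increment_integrable)
qed

text \<open>Differentiation brings down \<open>?B j k - ?A j k\<close>, which by
  \<open>grid_exponent_gamma\<close> is the sum of the \<open>gamma\<close> terms weighted by
  interval lengths. The factor \<open>exp (s * ?B j k)\<close> is the characteristic function of the
  increments on the scaled grid, and this turns the derivative back into an expectation.\<close>

lemma interpolation_deriv:
  assumes \<tau>: "mono \<tau>" "0 \<le> \<tau> 0" and s: "0 \<le> s"
  shows "(interpolation \<tau> n J a u v K c u' v' has_vector_derivative
    (LINT \<omega>|M. interpolation_gamma \<tau> n J a u v K c u' v' s \<omega>)) (at s)"
proof -
  have s\<tau>: "mono (\<lambda>i. s * \<tau> i)" "0 \<le> s * \<tau> 0"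
    using assms by (auto simp: mono_def intro: mult_left_mono)
  let ?A = "\<lambda>j k. grid_exponent \<tau> n (u j) (v j) + grid_exponent \<tau> n (\<lambda>i. - u' k i) (\<lambda>i. - v' k i)"
  let ?B = "\<lambda>j k. grid_exponent \<tau> n (\<lambda>i. u j i - u' k i) (\<lambda>i. v j i - v' k i)"
  have d: "((\<lambda>s. exp ((1 - complex_of_real s) * A + complex_of_real s * B)) has_vector_derivative
      (B - A) * exp ((1 - s) * A + s * B)) (at s)" for A B :: complex
    by (rule has_vector_derivative_real_field[of "\<lambda>z. exp ((1 - z) * A + z * B)"])
       (auto intro!: derivative_eq_intros simp: algebra_simps)
  have "(LINT \<omega>|M. interpolation_gamma \<tau> n J a u v K c u' v' s \<omega>)
    = (\<Sum>i<n. \<Sum>j\<in>J. \<Sum>k\<in>K. (\<tau> (Suc i) - \<tau> i) * (a j * cnj (c k) * exp ((1 - s) * ?A j k)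
         * gamma (u j i) (v j i) (u' k i) (v' k i)) * exp (s * ?B j k))"
    unfolding interpolation_gamma_eq
    by (simp add: Bochner_Integration.integral_sum cis_increment_integrable[OF s\<tau>] increment_char[OF s\<tau>] grid_exponent_scale)
  also have "\<dots> = (\<Sum>j\<in>J. \<Sum>k\<in>K. \<Sum>i<n. (\<tau> (Suc i) - \<tau> i) * (a j * cnj (c k) * exp ((1 - s) * ?A j k)
         * gamma (u j i) (v j i) (u' k i) (v' k i)) * exp (s * ?B j k))"
    by (subst sum.swap) (intro sum.cong refl sum.swap)
  also have "\<dots> = (\<Sum>j\<in>J. \<Sum>k\<in>K. a j * cnj (c k) * ((?B j k - ?A j k) * exp ((1 - s) * ?A j k + s * ?B j k)))"
  proof (intro sum.cong refl)
    fix j k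
    have eq: "?B j k - ?A j k = (\<Sum>i<n. (\<tau> (Suc i) - \<tau> i) * gamma (u j i) (v j i) (u' k i) (v' k i))"
      using grid_exponent_gamma[of \<tau> n "u j" "u' k" "v j" "v' k"] by (simp add: diff_diff_eq)
    show "(\<Sum>i<n. (\<tau> (Suc i) - \<tau> i) * (a j * cnj (c k) * exp ((1 - s) * ?A j k)
         * gamma (u j i) (v j i) (u' k i) (v' k i)) * exp (s * ?B j k))
      = a j * cnj (c k) * ((?B j k - ?A j k) * exp ((1 - s) * ?A j k + s * ?B j k))"
      unfolding eq exp_add sum_distrib_left sum_distrib_right
      by (intro sum.cong refl) (simp only: mult_ac)
  qed
  finally have eq: "(LINT \<omega>|M. interpolation_gamma \<tau> n J a u v K c u' v' s \<omega>) = \<dots>" .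
  show ?thesis
    unfolding eq interpolation_def[abs_def]
    by (intro has_vector_derivative_sum has_vector_derivative_mult_right d)
qed

lemma covariance_trig_increment:
  fixes a :: "'j \<Rightarrow> complex" and c :: "'k \<Rightarrow> complex"
    and J :: "'j set" and K :: "'k set" and n :: nat
    and u :: "'j \<Rightarrow> nat \<Rightarrow> real" and v :: "'k \<Rightarrow> nat \<Rightarrow> real"
  assumes \<tau>: "mono \<tau>" "0 \<le> \<tau> 0"
  defines "F \<equiv> trig_increment \<tau> n J a u (\<lambda>_ _. 0)"
    and "G \<equiv> trig_increment \<tau> n K c (\<lambda>_ _. 0) v"
    and "C \<equiv> max \<bar>gaussian_correlation \<Sigma>\<bar> (Op \<nu>)"
  shows "Re (LINT \<omega>|M. F \<omega> * cnj (G \<omega>)) - Re ((LINT \<omega>|M. F \<omega>) * cnj (LINT \<omega>|M. G \<omega>))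
    \<le> C / 2 * ((Re (LINT \<omega>|M. F \<omega> * cnj (F \<omega>)) - Re ((LINT \<omega>|M. F \<omega>) * cnj (LINT \<omega>|M. F \<omega>)))
      + (Re (LINT \<omega>|M. G \<omega> * cnj (G \<omega>)) - Re ((LINT \<omega>|M. G \<omega>) * cnj (LINT \<omega>|M. G \<omega>))))"
proof -
  let ?z = "\<lambda>_ _. 0 :: real"
  let ?FF = "interpolation \<tau> n J a u ?z J a u ?z" and ?GG = "interpolation \<tau> n K c ?z v K c ?z v"
    and ?FG = "interpolation \<tau> n J a u ?z K c ?z v"
  \<comment> \<open>\<open>D 1 - D 0\<close> is the right-hand side of the claim minus the left-hand
    side, so monotonicity of \<open>D\<close> is what has to be shown.\<close>
  define D where "D s = C / 2 * (Re (?FF s) + Re (?GG s)) - Re (?FG s)" for s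
  have "D 0 \<le> D 1"
  proof (rule DERIV_nonneg_imp_nondecreasing[of 0 1 D])
    fix s :: real assume s: "0 \<le> s" "s \<le> 1"
    let ?dF = "interpolation_gamma \<tau> n J a u ?z J a u ?z s" and ?dG = "interpolation_gamma \<tau> n K c ?z v K c ?z v s"
      and ?dFG = "interpolation_gamma \<tau> n J a u ?z K c ?z v s"
    note der = bounded_linear.has_vector_derivative[OF bounded_linear_Re interpolation_deriv[OF \<tau> s(1)],
        folded has_real_derivative_iff_has_vector_derivative]
    have d: "(D has_real_derivative C / 2 * (Re (LINT \<omega>|M. ?dF \<omega>) + Re (LINT \<omega>|M. ?dG \<omega>)) - Re (LINT \<omega>|M. ?dFG \<omega>)) (at s)"
      unfolding D_def[abs_def] by (intro DERIV_diff DERIV_cmult DERIV_add der)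
    note int = interpolation_gamma_integrable[OF \<tau> s(1)]
    note Re_int = integral_bounded_linear[OF bounded_linear_Re int, symmetric]
      integrable_bounded_linear[OF bounded_linear_Re int]
    have "0 \<le> (LINT \<omega>|M. C / 2 * (Re (?dF \<omega>) + Re (?dG \<omega>)) - Re (?dFG \<omega>))"
    proof (rule integral_nonneg_AE, rule AE_I2)
      fix \<omega>
      \<comment> \<open>For a fixed \<omega> the damped characters are mere complex coefficients, so
        \<open>gamma_ineq\<close> applies separately on each grid interval, with the frequencies of
        that interval.\<close>
      define \<alpha> where "\<alpha> j = a j * exp ((1 - s) * grid_exponent \<tau> n (u j) (\<lambda>_. 0))
        * cis (increment (\<lambda>i. s * \<tau> i) n (u j) (\<lambda>_. 0) \<omega>)" for j
      define \<beta> where "\<beta> k = c k * exp ((1 - s) * grid_exponent \<tau> n (\<lambda>_. 0) (v k))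
        * cis (increment (\<lambda>i. s * \<tau> i) n (\<lambda>_. 0) (v k) \<omega>)" for k
      have dFG: "Re (?dFG \<omega>) = (\<Sum>i<n. (\<tau> (Suc i) - \<tau> i)
          * Re (\<Sum>j\<in>J. \<Sum>k\<in>K. \<alpha> j * cnj (\<beta> k) * gamma (u j i) 0 0 (v k i)))"
        unfolding interpolation_gamma_def \<alpha>_def \<beta>_def Re_sum[of _ "{..<n}"] by simp
      have dF: "Re (?dF \<omega>) = (\<Sum>i<n. (\<tau> (Suc i) - \<tau> i)
          * Re (\<Sum>j\<in>J. \<Sum>k\<in>J. \<alpha> j * cnj (\<alpha> k) * gamma (u j i) 0 (u k i) 0))"
        unfolding interpolation_gamma_def \<alpha>_def Re_sum[of _ "{..<n}"] by simp
      have dG: "Re (?dG \<omega>) = (\<Sum>i<n. (\<tau> (Suc i) - \<tau> i)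
          * Re (\<Sum>j\<in>K. \<Sum>k\<in>K. \<beta> j * cnj (\<beta> k) * gamma 0 (v j i) 0 (v k i)))"
        unfolding interpolation_gamma_def \<beta>_def Re_sum[of _ "{..<n}"] by simp
      have "Re (?dFG \<omega>) \<le> (\<Sum>i<n. (\<tau> (Suc i) - \<tau> i) * (C / 2 *
          (Re (\<Sum>j\<in>J. \<Sum>k\<in>J. \<alpha> j * cnj (\<alpha> k) * gamma (u j i) 0 (u k i) 0)
           + Re (\<Sum>j\<in>K. \<Sum>k\<in>K. \<beta> j * cnj (\<beta> k) * gamma 0 (v j i) 0 (v k i)))))"
        unfolding dFG C_def
        by (intro sum_mono mult_left_mono gamma_ineq) (simp add: monoD[OF \<tau>(1)])
      also have "\<dots> = C / 2 * (Re (?dF \<omega>) + Re (?dG \<omega>))"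
        unfolding dF dG sum.distrib[symmetric] sum_distrib_left[of "C / 2"]
        by (intro sum.cong refl) (simp only: distrib_left mult_ac)
      finally have "Re (?dFG \<omega>) \<le> C / 2 * (Re (?dF \<omega>) + Re (?dG \<omega>))" .
      then show "0 \<le> C / 2 * (Re (?dF \<omega>) + Re (?dG \<omega>)) - Re (?dFG \<omega>)" by simp
    qed
    also have "\<dots> = C / 2 * (Re (LINT \<omega>|M. ?dF \<omega>) + Re (LINT \<omega>|M. ?dG \<omega>)) - Re (LINT \<omega>|M. ?dFG \<omega>)"
      unfolding Re_int(1) by (simp add: Re_int(2))
    finally show "\<exists>y. (D has_real_derivative y) (at s) \<and> 0 \<le> y" using d by blast
  qed simp
  then show ?thesis
    unfolding D_def interpolation_0[OF \<tau>] interpolation_1[OF \<tau>] F_def G_def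
    by (simp add: algebra_simps)
qed

end

text \<open>Independence is available for increments only, and both processes must use the same
  grid. Values at the given times are therefore telescoped: \<open>of_bool (\<tau> i < t)\<close>
  selects the intervals to the left of \<open>t\<close>, and 0 is added as starting point.\<close>

lemma finite_times_grid:
  fixes S :: "real set"
  assumes S: "finite S" "S \<subseteq> {0..}"
  shows "\<exists>(\<tau> :: nat \<Rightarrow> real) n. mono \<tau> \<and> \<tau> 0 = 0 \<and>
    (\<forall>t\<in>S. \<forall>f :: real \<Rightarrow> real. f t - f 0 = (\<Sum>i<n. of_bool (\<tau> i < t) * (f (\<tau> (Suc i)) - f (\<tau> i))))"
proof -
  define xs where "xs = sorted_list_of_set (insert 0 S)"
  have set: "set xs = insert 0 S" and sorted: "sorted_wrt (<) xs"
    using S(1) unfolding xs_def by (simp_all del: sorted_list_of_set_insert_remove)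
  define n where "n = length xs - 1"
  have len: "length xs = Suc n"
    using set by (cases xs) (auto simp: n_def)
  \<comment> \<open>The sequence stays constant after the last of the \<open>n + 1\<close> points,
    so it is monotone on all naturals.\<close>
  define \<tau> where "\<tau> i = xs ! min i n" for i
  have less: "xs ! i < xs ! j" if "i < j" "j \<le> n" for i j
    using sorted_wrt_nth_less[OF sorted that(1)] that(2) len by simp
  have le: "xs ! i \<le> xs ! j" if "i \<le> j" "j \<le> n" for i j
    using less[of i j] that by (cases "i = j") auto
  have "mono \<tau>"
    unfolding \<tau>_def by (intro monoI le) auto
  moreover have "\<tau> 0 = 0"
  proof -
    obtain k where k: "k \<le> n" "xs ! k = 0"
      using set len in_set_conv_nth[of 0 xs] by (auto simp: less_Suc_eq_le)
    have "xs ! 0 \<in> insert 0 S" using nth_mem[of 0 xs] set len by simp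
    with S(2) have "0 \<le> xs ! 0" by auto
    with le[of 0 k] k show ?thesis by (simp add: \<tau>_def)
  qed
  moreover have "f t - f 0 = (\<Sum>i<n. of_bool (\<tau> i < t) * (f (\<tau> (Suc i)) - f (\<tau> i)))"
    if "t \<in> S" for t and f :: "real \<Rightarrow> real"
  proof -
    obtain m where m: "m \<le> n" "xs ! m = t"
      using \<open>t \<in> S\<close> set len in_set_conv_nth[of t xs] by (auto simp: less_Suc_eq_le)
    have tm: "\<tau> m = t" using m by (simp add: \<tau>_def)
    have iff: "\<tau> i < t \<longleftrightarrow> i < m" if "i < n" for i
    proof (cases "i < m")
      case True
      then show ?thesis using less[of i m] m that by (simp add: \<tau>_def)
    next
      case False
      then show ?thesis using le[of m i] m that by (simp add: \<tau>_def)
    qed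
    have "(\<Sum>i<n. of_bool (\<tau> i < t) * (f (\<tau> (Suc i)) - f (\<tau> i)))
        = (\<Sum>i<m. of_bool (\<tau> i < t) * (f (\<tau> (Suc i)) - f (\<tau> i)))"
      using m(1) iff by (intro sum.mono_neutral_right) auto
    also have "\<dots> = (\<Sum>i<m. f (\<tau> (Suc i)) - f (\<tau> i))"
      using m(1) iff by (intro sum.cong) auto
    also have "\<dots> = f (\<tau> m) - f (\<tau> 0)" by (rule sum_lessThan_telescope)
    finally show ?thesis using \<open>\<tau> 0 = 0\<close> tm by simp
  qed
  ultimately show ?thesis by blast
qed

text \<open>\<open>sample_path\<close> changes the values at negative times. The cadlag property is
  insensitive to this, because at \<open>t > 0\<close> a left neighbourhood can be kept inside the
  positive times and at \<open>t \<ge> 0\<close> only right neighbourhoods are involved.\<close>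

lemma cadlag_restrict:
  assumes "cadlag f" and t: "\<And>t. 0 \<le> t \<Longrightarrow> g t = f t"
  shows "cadlag g"
  unfolding cadlag_def
proof (intro conjI allI impI)
  fix t :: real assume "0 \<le> t"
  then have "(f \<longlongrightarrow> g t) (at_right t)" using assms by (simp add: cadlag_def)
  moreover have "eventually (\<lambda>s. f s = g s) (at_right t)"
    using t \<open>0 \<le> t\<close> unfolding eventually_at_filter by (auto intro!: always_eventually)
  ultimately show "(g \<longlongrightarrow> g t) (at_right t)" by (rule Lim_transform_eventually)
next
  fix t :: real assume t0: "0 < t"
  then obtain l where "(f \<longlongrightarrow> l) (at_left t)" using assms by (auto simp: cadlag_def)
  moreover have "eventually (\<lambda>s. f s = g s) (at_left t)"
    using eventually_at_left_real[OF t0] by eventually_elim (simp add: t)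
  ultimately have "(g \<longlongrightarrow> l) (at_left t)" by (rule Lim_transform_eventually)
  then show "\<exists>l. (g \<longlongrightarrow> l) (at_left t)" ..
qed

lemma sample_path_measurable:
  assumes "\<And>t. 0 \<le> t \<Longrightarrow> X t \<in> borel_measurable N"
    and "\<And>\<omega>. \<omega> \<in> space N \<Longrightarrow> cadlag (\<lambda>t. X t \<omega>)"
  shows "sample_path X \<in> measurable N cadlag_space"
  unfolding cadlag_space_def
proof (rule measurable_restrict_space2)
  show "sample_path X \<in> space N \<rightarrow> {f. cadlag f}"
    unfolding sample_path_def
    by (intro funcsetI CollectI, rule cadlag_restrict[OF assms(2)]) auto
  show "sample_path X \<in> measurable N (Pi\<^sub>M {0..} (\<lambda>_. borel))"
    unfolding sample_path_def[abs_def] using assms(1) by (intro measurable_restrict) auto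
qed

section \<open>The covariance inequality for path functionals\<close>

context levy_pair
begin

lemma X_zero: "AE \<omega> in M. X 0 \<omega> = 0" and Y_zero: "AE \<omega> in M. Y 0 \<omega> = 0"
  using process by (auto simp: levy_process_def zero_prod_def)

lemma cadlag_X: "\<omega> \<in> space M \<Longrightarrow> cadlag (\<lambda>t. X t \<omega>)"
  and cadlag_Y: "\<omega> \<in> space M \<Longrightarrow> cadlag (\<lambda>t. Y t \<omega>)"
proof -
  assume "\<omega> \<in> space M"
  then have c: "cadlag (\<lambda>t. (X t \<omega>, Y t \<omega>))" using process by (simp add: levy_process_def)
  show "cadlag (\<lambda>t. X t \<omega>)"
    using c unfolding cadlag_def by (fastforce dest: tendsto_fst)
  show "cadlag (\<lambda>t. Y t \<omega>)"
    using c unfolding cadlag_def by (fastforce dest: tendsto_snd)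
qed

text \<open>Exchanging the sum over times with the telescoping sum rewrites each phase in
  \<open>X t\<close> as a combination of grid increments. The start at 0 holds only almost
  everywhere, so \<open>f\<close> and \<open>g\<close> are matched with increment polynomials up to
  null sets, which the integrals ignore.\<close>

lemma covariance_trig:
  assumes f: "f \<in> real_trig_poly X {0..}" and g: "g \<in> real_trig_poly Y {0..}"
  defines "C \<equiv> max \<bar>gaussian_correlation \<Sigma>\<bar> (Op \<nu>)"
  shows "(LINT \<omega>|M. f \<omega> * g \<omega>) - (LINT \<omega>|M. f \<omega>) * (LINT \<omega>|M. g \<omega>)
    \<le> C / 2 * (((LINT \<omega>|M. f \<omega> * f \<omega>) - (LINT \<omega>|M. f \<omega>) * (LINT \<omega>|M. f \<omega>))
      + ((LINT \<omega>|M. g \<omega> * g \<omega>) - (LINT \<omega>|M. g \<omega>) * (LINT \<omega>|M. g \<omega>)))"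
proof -
  obtain S m a u where S: "finite S" "S \<subseteq> {0..}"
    and f': "\<And>\<omega>. complex_of_real (f \<omega>) = (\<Sum>j<(m::nat). a j * cis (\<Sum>t\<in>S. u j t * X t \<omega>))"
    using trig_poly_sum_rep[OF f[unfolded real_trig_poly_def mem_Collect_eq]] by blast
  obtain T l c v where T: "finite T" "T \<subseteq> {0..}"
    and g': "\<And>\<omega>. complex_of_real (g \<omega>) = (\<Sum>j<(l::nat). c j * cis (\<Sum>t\<in>T. v j t * Y t \<omega>))"
    using trig_poly_sum_rep[OF g[unfolded real_trig_poly_def mem_Collect_eq]] by blast
  have "finite (S \<union> T)" "S \<union> T \<subseteq> {0..}" using S T by auto
  from finite_times_grid[OF this] obtain \<tau> n where \<tau>: "mono \<tau>" "\<tau> 0 = 0"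
    and tele: "\<And>t (h :: real \<Rightarrow> real). t \<in> S \<union> T \<Longrightarrow>
      h t - h 0 = (\<Sum>i<n. of_bool (\<tau> i < t) * (h (\<tau> (Suc i)) - h (\<tau> i)))"
    by blast
  have \<tau>0: "0 \<le> \<tau> 0" using \<tau>(2) by simp
  have phase: "(\<Sum>t\<in>R. w t * h t) = (\<Sum>i<n. (\<Sum>t\<in>R. w t * of_bool (\<tau> i < t)) * (h (\<tau> (Suc i)) - h (\<tau> i)))"
    if "h 0 = 0" "R \<subseteq> S \<union> T" for w h :: "real \<Rightarrow> real" and R
  proof -
    have "(\<Sum>t\<in>R. w t * h t) = (\<Sum>t\<in>R. w t * (\<Sum>i<n. of_bool (\<tau> i < t) * (h (\<tau> (Suc i)) - h (\<tau> i))))"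
      using tele[of _ h] that by (intro sum.cong) auto
    also have "\<dots> = (\<Sum>i<n. \<Sum>t\<in>R. w t * (of_bool (\<tau> i < t) * (h (\<tau> (Suc i)) - h (\<tau> i))))"
      unfolding sum_distrib_left by (rule sum.swap)
    finally show ?thesis by (simp only: sum_distrib_right mult.assoc)
  qed
  define F where "F = trig_increment \<tau> n {..<m} a (\<lambda>j i. \<Sum>t\<in>S. u j t * of_bool (\<tau> i < t)) (\<lambda>_ _. 0)"
  define G where "G = trig_increment \<tau> n {..<l} c (\<lambda>_ _. 0) (\<lambda>j i. \<Sum>t\<in>T. v j t * of_bool (\<tau> i < t))"
  have F: "AE \<omega> in M. F \<omega> = complex_of_real (f \<omega>)"
    using X_zero
  proof eventually_elim
    case (elim \<omega>)
    show ?case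
      unfolding f' F_def trig_increment_def increment_def
      using phase[of "\<lambda>t. X t \<omega>" S] elim by simp
  qed
  have G: "AE \<omega> in M. G \<omega> = complex_of_real (g \<omega>)"
    using Y_zero
  proof eventually_elim
    case (elim \<omega>)
    show ?case
      unfolding g' G_def trig_increment_def increment_def
      using phase[of "\<lambda>t. Y t \<omega>" T] elim by simp
  qed
  have [measurable]: "F \<in> borel_measurable M" "G \<in> borel_measurable M"
    using increment_measurable[OF \<tau>(1) \<tau>0] unfolding F_def G_def trig_increment_def[abs_def]
    by (auto intro!: borel_measurable_sum borel_measurable_times borel_measurable_cis)
  have [measurable]: "f \<in> borel_measurable M" "g \<in> borel_measurable M"
    using bounded_algebra.measurable[OF bounded_algebra_real_trig_poly[OF finite_measure_axioms] f]
      bounded_algebra.measurable[OF bounded_algebra_real_trig_poly[OF finite_measure_axioms] g]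
      X_measurable Y_measurable by auto
  have I: "(LINT \<omega>|M. F \<omega>) = complex_of_real (LINT \<omega>|M. f \<omega>)" "(LINT \<omega>|M. G \<omega>) = complex_of_real (LINT \<omega>|M. g \<omega>)"
    unfolding integral_complex_of_real[symmetric] by (intro integral_cong_AE F G; measurable)+
  have II: "(LINT \<omega>|M. F \<omega> * cnj (G \<omega>)) = complex_of_real (LINT \<omega>|M. f \<omega> * g \<omega>)"
    "(LINT \<omega>|M. F \<omega> * cnj (F \<omega>)) = complex_of_real (LINT \<omega>|M. f \<omega> * f \<omega>)"
    "(LINT \<omega>|M. G \<omega> * cnj (G \<omega>)) = complex_of_real (LINT \<omega>|M. g \<omega> * g \<omega>)"
    unfolding integral_complex_of_real[symmetric]
    using F G by (intro integral_cong_AE; force)+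
  show ?thesis
    using covariance_trig_increment[OF \<tau>(1) \<tau>0, of n "{..<m}" a "\<lambda>j i. \<Sum>t\<in>S. u j t * of_bool (\<tau> i < t)"
      "{..<l}" c "\<lambda>j i. \<Sum>t\<in>T. v j t * of_bool (\<tau> i < t)"]
    unfolding F_def[symmetric] G_def[symmetric] C_def[symmetric] I II by simp
qed

text \<open>\<open>cadlag_space\<close> carries the sigma-field of the coordinates, and these are
  measurable for the closure sigma-algebra of the trigonometric polynomials. The path map is then
  measurable for it too, and so is every measurable functional of the path.\<close>

lemma approx_by_trig:
  assumes Z: "\<And>t. 0 \<le> t \<Longrightarrow> Z t \<in> borel_measurable M" "\<And>\<omega>. \<omega> \<in> space M \<Longrightarrow> cadlag (\<lambda>t. Z t \<omega>)"
    and \<phi>: "\<phi> \<in> borel_measurable cadlag_space" "integrable M (\<lambda>\<omega>. (\<phi> (sample_path Z \<omega>))\<^sup>2)"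
  shows "\<exists>f. (\<forall>n. f n \<in> real_trig_poly Z {0..}) \<and> (\<forall>n. square_integrable M (f n)) \<and>
    (\<lambda>n::nat. LINT \<omega>|M. (f n \<omega> - \<phi> (sample_path Z \<omega>))\<^sup>2) \<longlonglongrightarrow> 0"
    and "square_integrable M (\<lambda>\<omega>. \<phi> (sample_path Z \<omega>))"
proof -
  interpret A: bounded_algebra M "real_trig_poly Z {0..}"
    by (rule bounded_algebra_real_trig_poly[OF finite_measure_axioms]) (simp add: Z(1))
  have "sample_path Z \<in> measurable A.closure_algebra cadlag_space"
  proof (rule sample_path_measurable)
    show "Z t \<in> borel_measurable A.closure_algebra" if "0 \<le> t" for t
      by (rule measurable_closure_algebra_generator[OF finite_measure_axioms]) (use Z(1) that in simp_all)
  qed (simp add: Z(2))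
  then have m: "(\<lambda>\<omega>. \<phi> (sample_path Z \<omega>)) \<in> borel_measurable A.closure_algebra"
    using \<phi>(1) by (rule measurable_compose)
  obtain f where f: "\<And>n. f n \<in> real_trig_poly Z {0..}"
    "(\<lambda>n::nat. LINT \<omega>|M. (f n \<omega> - \<phi> (sample_path Z \<omega>))\<^sup>2) \<longlonglongrightarrow> 0"
    using A.approx_sequence[OF m \<phi>(2)] by blast
  then show "\<exists>f. (\<forall>n. f n \<in> real_trig_poly Z {0..}) \<and> (\<forall>n. square_integrable M (f n)) \<and>
      (\<lambda>n::nat. LINT \<omega>|M. (f n \<omega> - \<phi> (sample_path Z \<omega>))\<^sup>2) \<longlonglongrightarrow> 0"
    using A.square_integrable_A by blast
  show "square_integrable M (\<lambda>\<omega>. \<phi> (sample_path Z \<omega>))"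
    by (rule A.closure_square_integrable[OF A.closure_of_measurable[OF m \<phi>(2)]])
qed

lemma covariance_le:
  assumes \<phi>: "\<phi> \<in> borel_measurable cadlag_space" "integrable M (\<lambda>\<omega>. (\<phi> (sample_path X \<omega>))\<^sup>2)"
    and \<psi>: "\<psi> \<in> borel_measurable cadlag_space" "integrable M (\<lambda>\<omega>. (\<psi> (sample_path Y \<omega>))\<^sup>2)"
  defines "C \<equiv> max \<bar>gaussian_correlation \<Sigma>\<bar> (Op \<nu>)"
    and "U \<equiv> \<lambda>\<omega>. \<phi> (sample_path X \<omega>)" and "V \<equiv> \<lambda>\<omega>. \<psi> (sample_path Y \<omega>)"
  shows "(LINT \<omega>|M. U \<omega> * V \<omega>) - (LINT \<omega>|M. U \<omega>) * (LINT \<omega>|M. V \<omega>)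
    \<le> C / 2 * (((LINT \<omega>|M. U \<omega> * U \<omega>) - (LINT \<omega>|M. U \<omega>) * (LINT \<omega>|M. U \<omega>))
      + ((LINT \<omega>|M. V \<omega> * V \<omega>) - (LINT \<omega>|M. V \<omega>) * (LINT \<omega>|M. V \<omega>)))"
proof -
  obtain f where f: "\<And>n. f n \<in> real_trig_poly X {0..}" "\<And>n. square_integrable M (f n)"
    "(\<lambda>n::nat. LINT \<omega>|M. (f n \<omega> - U \<omega>)\<^sup>2) \<longlonglongrightarrow> 0" "square_integrable M U"
    using approx_by_trig[of X, OF X_measurable cadlag_X \<phi>] unfolding U_def by blast
  obtain g where g: "\<And>n. g n \<in> real_trig_poly Y {0..}" "\<And>n. square_integrable M (g n)"
    "(\<lambda>n::nat. LINT \<omega>|M. (g n \<omega> - V \<omega>)\<^sup>2) \<longlonglongrightarrow> 0" "square_integrable M V"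
    using approx_by_trig[of Y, OF Y_measurable cadlag_Y \<psi>] unfolding V_def by blast
  have one: "square_integrable M (\<lambda>_. 1)" by (simp add: square_integrable_def)
  have mean: "(\<lambda>n. LINT \<omega>|M. h n \<omega>) \<longlonglongrightarrow> (LINT \<omega>|M. H \<omega>)"
    if "\<And>n. square_integrable M (h n)" "(\<lambda>n::nat. LINT \<omega>|M. (h n \<omega> - H \<omega>)\<^sup>2) \<longlonglongrightarrow> 0" "square_integrable M H" for h H
    using tendsto_integral_mult[OF that(1,3) one one that(2)] by simp
  note lims = tendsto_integral_mult[OF f(2,4) g(2,4) f(3) g(3)] tendsto_integral_mult[OF f(2,4) f(2,4) f(3) f(3)]
    tendsto_integral_mult[OF g(2,4) g(2,4) g(3) g(3)] mean[OF f(2,3,4)] mean[OF g(2,3,4)]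
  show ?thesis
  proof (rule LIMSEQ_le)
    show "(\<lambda>n. (LINT \<omega>|M. f n \<omega> * g n \<omega>) - (LINT \<omega>|M. f n \<omega>) * (LINT \<omega>|M. g n \<omega>))
      \<longlonglongrightarrow> (LINT \<omega>|M. U \<omega> * V \<omega>) - (LINT \<omega>|M. U \<omega>) * (LINT \<omega>|M. V \<omega>)"
      by (intro tendsto_intros lims)
    show "(\<lambda>n. C / 2 * (((LINT \<omega>|M. f n \<omega> * f n \<omega>) - (LINT \<omega>|M. f n \<omega>) * (LINT \<omega>|M. f n \<omega>))
      + ((LINT \<omega>|M. g n \<omega> * g n \<omega>) - (LINT \<omega>|M. g n \<omega>) * (LINT \<omega>|M. g n \<omega>))))
      \<longlonglongrightarrow> C / 2 * (((LINT \<omega>|M. U \<omega> * U \<omega>) - (LINT \<omega>|M. U \<omega>) * (LINT \<omega>|M. U \<omega>))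
      + ((LINT \<omega>|M. V \<omega> * V \<omega>) - (LINT \<omega>|M. V \<omega>) * (LINT \<omega>|M. V \<omega>)))"
      by (intro tendsto_intros lims)
    show "\<exists>N. \<forall>n\<ge>N. (LINT \<omega>|M. f n \<omega> * g n \<omega>) - (LINT \<omega>|M. f n \<omega>) * (LINT \<omega>|M. g n \<omega>)
      \<le> C / 2 * (((LINT \<omega>|M. f n \<omega> * f n \<omega>) - (LINT \<omega>|M. f n \<omega>) * (LINT \<omega>|M. f n \<omega>))
      + ((LINT \<omega>|M. g n \<omega> * g n \<omega>) - (LINT \<omega>|M. g n \<omega>) * (LINT \<omega>|M. g n \<omega>)))"
      using covariance_trig[OF f(1) g(1)] unfolding C_def by blast
  qed
qed

end

subsection \<open>The lower bound\<close>

text \<open>The family with a single coordinate, the identity of the line; this form makes the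
  density results applicable to measures on the line.\<close>

definition line_trig_poly :: "(real \<Rightarrow> real) set" where
  "line_trig_poly = real_trig_poly (\<lambda>(_::unit) x. x) UNIV"

lemma line_trig_poly_rep:
  assumes "f \<in> line_trig_poly"
  shows "\<exists>m a u. \<forall>x. complex_of_real (f x) = (\<Sum>j<(m::nat). a j * cis (u j * x))"
proof -
  obtain S m a u where "\<And>x. complex_of_real (f x) = (\<Sum>j<(m::nat). a j * cis (\<Sum>t\<in>S. u j (t::unit) * x))"
    using trig_poly_sum_rep[OF assms[unfolded line_trig_poly_def real_trig_poly_def mem_Collect_eq]] by blast
  then show ?thesis
    by (intro exI[of _ m] exI[of _ a] exI[of _ "\<lambda>j. \<Sum>t\<in>S. u j t"]) (simp add: sum_distrib_right)
qed

lemma cis_has_vector_derivative: "((\<lambda>x. cis (w * x)) has_vector_derivative \<i> * w) (at 0)"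
proof -
  have "((\<lambda>x. exp (\<i> * w * complex_of_real x)) has_vector_derivative \<i> * w) (at 0)"
    by (rule has_vector_derivative_real_field[of "\<lambda>z. exp (\<i> * w * z)"])
       (auto intro!: derivative_eq_intros)
  then show ?thesis by (simp add: cis_conv_exp mult.assoc)
qed

lemma cis_sum_has_vector_derivative:
  "((\<lambda>x. \<Sum>j<m. a j * cis (u j * x)) has_vector_derivative (\<Sum>j<m. a j * (\<i> * u j))) (at 0)"
  by (intro has_vector_derivative_sum has_vector_derivative_mult_right cis_has_vector_derivative)

text \<open>By uniqueness of derivatives the weighted frequency sum, which enters through
  \<open>gamma_sum\<close>, depends on \<open>f\<close> only and not on the chosen
  representation.\<close>

lemma line_trig_poly_deriv:
  assumes f: "\<And>x. complex_of_real (f x) = (\<Sum>j<(m::nat). a j * cis (u j * x))"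
    and d: "(f has_real_derivative d) (at 0)"
  shows "(\<Sum>j<m. a j * u j) = - \<i> * d"
proof -
  have f': "((\<lambda>x. complex_of_real (f x)) has_vector_derivative complex_of_real d) (at 0)"
    using d by (intro has_vector_derivative_of_real) (simp add: has_real_derivative_iff_has_vector_derivative)
  have "complex_of_real d = (\<Sum>j<m. a j * (\<i> * u j))"
    by (rule vector_derivative_unique_at[OF f'[unfolded f] cis_sum_has_vector_derivative])
  also have "\<dots> = \<i> * (\<Sum>j<m. a j * u j)" by (simp add: sum_distrib_left mult_ac)
  finally show ?thesis by simp
qed

lemma line_trig_poly_Re_rep:
  assumes "f \<in> line_trig_poly"
  shows "\<exists>m a u. f = (\<lambda>x. Re (\<Sum>j<(m::nat). a j * cis (u j * x)))"
proof -
  obtain m a u where f: "\<And>x. complex_of_real (f x) = (\<Sum>j<(m::nat). a j * cis (u j * x))"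
    using line_trig_poly_rep[OF assms] by blast
  have "f = (\<lambda>x. Re (\<Sum>j<m. a j * cis (u j * x)))"
    unfolding f[symmetric] by simp
  then show ?thesis by blast
qed

lemma line_trig_poly_measurable: "f \<in> line_trig_poly \<Longrightarrow> f \<in> borel_measurable borel"
  by (drule line_trig_poly_Re_rep) auto

lemma line_trig_poly_differentiable:
  assumes "f \<in> line_trig_poly"
  shows "\<exists>d. (f has_real_derivative d) (at 0)"
proof -
  obtain m a u where f: "f = (\<lambda>x. Re (\<Sum>j<(m::nat). a j * cis (u j * x)))"
    using line_trig_poly_Re_rep[OF assms] by blast
  show ?thesis
    using bounded_linear.has_vector_derivative[OF bounded_linear_Re cis_sum_has_vector_derivative[of a u m]]
    unfolding f has_real_derivative_iff_has_vector_derivative by blast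
qed

section \<open>Small-time derivatives of covariances\<close>

context levy_pair
begin

definition char_sum :: "nat \<Rightarrow> (nat \<Rightarrow> complex) \<Rightarrow> (nat \<Rightarrow> real) \<Rightarrow> (nat \<Rightarrow> real) \<Rightarrow> real \<Rightarrow> 'a \<Rightarrow> complex" where
  "char_sum m a u v t \<omega> = (\<Sum>j<m. a j * cis (u j * X t \<omega> + v j * Y t \<omega>))"

text \<open>The covariance of two character sums at time \<open>t\<close>. Written through the
  exponents instead of an expectation, it makes sense for negative \<open>t\<close> as well and has
  a two-sided derivative at 0.\<close>

definition char_covariance ::
  "nat \<Rightarrow> (nat \<Rightarrow> complex) \<Rightarrow> (nat \<Rightarrow> real) \<Rightarrow> (nat \<Rightarrow> real) \<Rightarrow>
   nat \<Rightarrow> (nat \<Rightarrow> complex) \<Rightarrow> (nat \<Rightarrow> real) \<Rightarrow> (nat \<Rightarrow> real) \<Rightarrow> real \<Rightarrow> complex" where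
  "char_covariance m a u v l c u' v' t = (\<Sum>j<m. \<Sum>k<l. a j * cnj (c k) *
     (exp (t * exponent (u j - u' k) (v j - v' k))
      - exp (t * (exponent (u j) (v j) + exponent (- u' k) (- v' k)))))"

lemma cis_integrable:
  assumes "0 \<le> t"
  shows "integrable M (\<lambda>\<omega>. cis (u * X t \<omega> + v * Y t \<omega>))"
proof (rule integrable_const_bound[of _ 1])
  show "(\<lambda>\<omega>. cis (u * X t \<omega> + v * Y t \<omega>)) \<in> borel_measurable M"
    by (intro borel_measurable_cis borel_measurable_add borel_measurable_times borel_measurable_const
        X_measurable Y_measurable assms)
qed simp

lemma char_covariance_eq:
  assumes t: "0 \<le> t"
  shows "char_covariance m a u v l c u' v' t =
    (LINT \<omega>|M. char_sum m a u v t \<omega> * cnj (char_sum l c u' v' t \<omega>))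
     - (LINT \<omega>|M. char_sum m a u v t \<omega>) * cnj (LINT \<omega>|M. char_sum l c u' v' t \<omega>)"
proof -
  have mean: "(LINT \<omega>|M. char_sum m a u v t \<omega>) = (\<Sum>j<m. a j * exp (t * exponent (u j) (v j)))" for m a u v
    unfolding char_sum_def by (simp add: cis_integrable[OF t] char_function[OF t])
  have cm: "cis x * cnj (cis y) = cis (x - y)" for x y by (simp add: cis_cnj cis_mult)
  have "char_sum m a u v t \<omega> * cnj (char_sum l c u' v' t \<omega>)
    = (\<Sum>j<m. \<Sum>k<l. a j * cnj (c k) * cis ((u j - u' k) * X t \<omega> + (v j - v' k) * Y t \<omega>))" for \<omega>
  proof -
    have "char_sum m a u v t \<omega> * cnj (char_sum l c u' v' t \<omega>)
      = (\<Sum>j<m. \<Sum>k<l. a j * cnj (c k) * (cis (u j * X t \<omega> + v j * Y t \<omega>) * cnj (cis (u' k * X t \<omega> + v' k * Y t \<omega>))))"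
      by (simp add: char_sum_def sum_product mult_ac)
    then show ?thesis unfolding cm by (simp add: algebra_simps)
  qed
  then have "(LINT \<omega>|M. char_sum m a u v t \<omega> * cnj (char_sum l c u' v' t \<omega>))
    = (\<Sum>j<m. \<Sum>k<l. a j * cnj (c k) * exp (t * exponent (u j - u' k) (v j - v' k)))"
    by (simp add: cis_integrable[OF t] char_function[OF t] Bochner_Integration.integral_sum)
  then show ?thesis
    unfolding mean char_covariance_def
    by (simp add: sum_product exp_cnj cnj_exponent exp_add right_diff_distrib sum_subtractf distrib_left mult_ac)
qed

lemma char_covariance_deriv:
  "(char_covariance m a u v l c u' v' has_vector_derivative
    (\<Sum>j<m. \<Sum>k<l. a j * cnj (c k) * gamma (u j) (v j) (u' k) (v' k))) (at 0)"
proof -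
  have "((\<lambda>t. exp (complex_of_real t * A) - exp (complex_of_real t * B)) has_vector_derivative A - B) (at 0)" for A B
    by (rule has_vector_derivative_real_field[of "\<lambda>z. exp (z * A) - exp (z * B)"])
       (auto intro!: derivative_eq_intros)
  then have "((\<lambda>t. exp (complex_of_real t * exponent (u j - u' k) (v j - v' k))
      - exp (complex_of_real t * (exponent (u j) (v j) + exponent (- u' k) (- v' k))))
    has_vector_derivative gamma (u j) (v j) (u' k) (v' k)) (at 0)" for j k
    unfolding gamma_def diff_diff_eq .
  then show ?thesis
    unfolding char_covariance_def[abs_def]
    by (intro has_vector_derivative_sum has_vector_derivative_mult_right)
qed

text \<open>Both sides of the covariance inequality vanish at \<open>t = 0\<close>, so their
  difference \<open>D\<close>, nonnegative for \<open>t > 0\<close>, has a nonnegative derivative at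
  0. The derivatives of the covariances are carre du champ terms at the origin; the factors
  \<open>- \<i>\<close> from \<open>line_trig_poly_deriv\<close> cancel against their
  conjugates.\<close>

lemma small_time_ineq:
  assumes cov: "\<And>t f g. 0 < t \<Longrightarrow> f \<in> line_trig_poly \<Longrightarrow> g \<in> line_trig_poly \<Longrightarrow>
      (LINT \<omega>|M. f (X t \<omega>) * g (Y t \<omega>)) - (LINT \<omega>|M. f (X t \<omega>)) * (LINT \<omega>|M. g (Y t \<omega>))
      \<le> C / 2 * (((LINT \<omega>|M. f (X t \<omega>) * f (X t \<omega>)) - (LINT \<omega>|M. f (X t \<omega>)) * (LINT \<omega>|M. f (X t \<omega>)))
        + ((LINT \<omega>|M. g (Y t \<omega>) * g (Y t \<omega>)) - (LINT \<omega>|M. g (Y t \<omega>)) * (LINT \<omega>|M. g (Y t \<omega>))))"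
    and f: "f \<in> line_trig_poly" and g: "g \<in> line_trig_poly"
    and d: "(f has_real_derivative d) (at 0)" and e: "(g has_real_derivative e) (at 0)"
  shows "\<Sigma> $ 1 $ 2 * d * e + (LINT p|\<nu>. (f (fst p) - f 0) * (g (snd p) - g 0))
    \<le> C / 2 * ((\<Sigma> $ 1 $ 1 * d\<^sup>2 + (LINT p|\<nu>. (f (fst p) - f 0)\<^sup>2))
            + (\<Sigma> $ 2 $ 2 * e\<^sup>2 + (LINT p|\<nu>. (g (snd p) - g 0)\<^sup>2)))"
proof -
  obtain m a u where f': "\<And>x. complex_of_real (f x) = (\<Sum>j<(m::nat). a j * cis (u j * x))"
    using line_trig_poly_rep[OF f] by blast
  obtain l c v where g': "\<And>x. complex_of_real (g x) = (\<Sum>j<(l::nat). c j * cis (v j * x))"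
    using line_trig_poly_rep[OF g] by blast
  let ?z = "\<lambda>_. 0 :: real"
  define FF where "FF = char_covariance m a u ?z m a u ?z"
  define GG where "GG = char_covariance l c ?z v l c ?z v"
  define FG where "FG = char_covariance m a u ?z l c ?z v"
  have F: "char_sum m a u ?z t \<omega> = complex_of_real (f (X t \<omega>))" for t \<omega>
    by (simp add: char_sum_def f')
  have G: "char_sum l c ?z v t \<omega> = complex_of_real (g (Y t \<omega>))" for t \<omega>
    by (simp add: char_sum_def g')
  note cc = integral_complex_of_real of_real_mult[symmetric] complex_cnj_complex_of_real of_real_diff[symmetric]
    Re_complex_of_real
  define D where "D t = C / 2 * (Re (FF t) + Re (GG t)) - Re (FG t)" for t
  have D0: "D 0 = 0" by (simp add: D_def FF_def GG_def FG_def char_covariance_def)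
  have Dt: "0 \<le> D t" if "0 < t" for t
    using cov[OF that f g] char_covariance_eq[of t] that
    unfolding D_def FF_def GG_def FG_def by (simp only: F G cc less_imp_le diff_ge_0_iff_ge)
  define dFF where "dFF = (\<Sum>j<m. \<Sum>k<m. a j * cnj (a k) * gamma (u j) 0 (u k) 0)"
  define dGG where "dGG = (\<Sum>j<l. \<Sum>k<l. c j * cnj (c k) * gamma 0 (v j) 0 (v k))"
  define dFG where "dFG = (\<Sum>j<m. \<Sum>k<l. a j * cnj (c k) * gamma (u j) 0 0 (v k))"
  note der = bounded_linear.has_vector_derivative[OF bounded_linear_Re char_covariance_deriv,
    folded has_real_derivative_iff_has_vector_derivative]
  have dD: "(D has_real_derivative C / 2 * (Re dFF + Re dGG) - Re dFG) (at 0)"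
    unfolding D_def[abs_def] FF_def GG_def FG_def dFF_def dGG_def dFG_def
    by (intro DERIV_diff DERIV_cmult DERIV_add der)
  have D': "0 \<le> C / 2 * (Re dFF + Re dGG) - Re dFG"
  proof (rule ccontr)
    assume "\<not> ?thesis"
    then obtain r where r: "0 < r" "\<And>h. 0 < h \<Longrightarrow> h < r \<Longrightarrow> D (0 + h) < D 0"
      using DERIV_neg_dec_right[OF dD] by auto
    then have "D (r/2) < 0" using r(2)[of "r/2"] D0 by simp
    with Dt[of "r/2"] r(1) show False by simp
  qed
  have jF: "(\<Sum>j<m. a j * jump_char (u j) 0 p) = complex_of_real (f (fst p) - f 0)" for p
    by (simp add: jump_char_def f' right_diff_distrib sum_subtractf)
  have jG: "(\<Sum>j<l. c j * jump_char 0 (v j) p) = complex_of_real (g (snd p) - g 0)" for p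
    by (simp add: jump_char_def g' right_diff_distrib sum_subtractf)
  have P: "(\<Sum>j<m. a j * u j) = - \<i> * d" by (rule line_trig_poly_deriv[OF f' d])
  have Q: "(\<Sum>j<l. c j * v j) = - \<i> * e" by (rule line_trig_poly_deriv[OF g' e])
  have 1: "Re dFG = \<Sigma> $ 1 $ 2 * d * e + (LINT p|\<nu>. (f (fst p) - f 0) * (g (snd p) - g 0))"
    unfolding dFG_def gamma_sum[of a c u "\<lambda>_. 0" "\<lambda>_. 0" v "{..<l}" "{..<m}"] jF jG P Q
    by (simp add: of_real_mult[symmetric] of_real_diff[symmetric] del: of_real_mult of_real_diff)
  have 2: "Re dFF = \<Sigma> $ 1 $ 1 * d\<^sup>2 + (LINT p|\<nu>. (f (fst p) - f 0)\<^sup>2)"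
    unfolding dFF_def gamma_sum[of a a u "\<lambda>_. 0" u "\<lambda>_. 0" "{..<m}" "{..<m}"] jF P
    by (simp add: of_real_mult[symmetric] of_real_diff[symmetric] power2_eq_square del: of_real_mult of_real_diff)
  have 3: "Re dGG = \<Sigma> $ 2 $ 2 * e\<^sup>2 + (LINT p|\<nu>. (g (snd p) - g 0)\<^sup>2)"
    unfolding dGG_def gamma_sum[of c c "\<lambda>_. 0" v "\<lambda>_. 0" v "{..<l}" "{..<l}"] jG Q
    by (simp add: of_real_mult[symmetric] of_real_diff[symmetric] power2_eq_square del: of_real_mult of_real_diff)
  show ?thesis using D' unfolding 1 2 3 by simp
qed

end

lemma line_trig_poly_bounded: "f \<in> line_trig_poly \<Longrightarrow> \<exists>K. \<forall>x. \<bar>f x\<bar> \<le> K"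
  using trig_poly_bounded[of "\<lambda>x. complex_of_real (f x)"]
  by (auto simp: line_trig_poly_def real_trig_poly_def)

lemma line_trig_poly_sin: "(\<lambda>x. c * sin (r * x)) \<in> line_trig_poly"
  unfolding line_trig_poly_def
  by (intro real_trig_poly_mult real_trig_poly_const real_trig_poly_sin[of "()" UNIV r "\<lambda>_ x. x"]) simp

lemma line_trig_poly_one_minus_cos: "(\<lambda>x. 1 - cos (r * x)) \<in> line_trig_poly"
proof -
  have "(\<lambda>x. 1 + - 1 * cos (r * x)) \<in> line_trig_poly"
    unfolding line_trig_poly_def
    by (intro real_trig_poly_add real_trig_poly_mult real_trig_poly_const real_trig_poly_cos[of "()" UNIV r "\<lambda>_ x. x"]) simp
  then show ?thesis by simp
qed

lemma line_trig_poly_mult: "f \<in> line_trig_poly \<Longrightarrow> g \<in> line_trig_poly \<Longrightarrow> (\<lambda>x. f x * g x) \<in> line_trig_poly"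
  unfolding line_trig_poly_def by (rule real_trig_poly_mult)

section \<open>Recovering the two constants from test functions\<close>

context levy_triple
begin

text \<open>Multiplying by \<open>\<kappa> = 1 - cos (r x)\<close>, which vanishes to second order at 0, turns the trigonometric
  polynomials, dense in \<open>L\<^sup>2(\<kappa>\<^sup>2 d\<nu>)\<close>, into functions that vanish at 0 together with their derivative.\<close>
lemma line_approx:
  fixes h :: "real \<times> real \<Rightarrow> real"
  assumes h [measurable]: "h \<in> borel_measurable \<nu>"
    and \<kappa>: "square_integrable \<nu> (\<lambda>p. 1 - cos (r * h p))"
    and \<phi> [measurable]: "\<phi> \<in> borel_measurable borel" and int: "square_integrable \<nu> (\<lambda>p. \<phi> (h p))"
  shows "\<exists>f. (\<forall>n. f n \<in> line_trig_poly \<and> f n 0 = 0 \<and> (f n has_real_derivative 0) (at 0)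
      \<and> square_integrable \<nu> (\<lambda>p. f n (h p)))
    \<and> (\<lambda>n::nat. LINT p|\<nu>. (f n (h p) - \<phi> (h p) * of_bool (1 - cos (r * h p) \<noteq> 0))\<^sup>2) \<longlonglongrightarrow> 0"
proof -
  define k where "k x = 1 - cos (r * x)" for x
  have k [measurable]: "k \<in> borel_measurable borel" unfolding k_def[abs_def] by measurable
  \<comment> \<open>The measure \<nu> may be infinite, while this weighted image on the line is
    finite because \<open>k (h p)\<close> is square-integrable; the density theorem applies to
    it.\<close>
  define N where "N = density (distr \<nu> borel h) (\<lambda>x. ennreal ((k x)\<^sup>2))"
  have [measurable_cong, simp]: "sets N = sets borel" by (simp add: N_def)
  have N: "(LINT x|N. w x) = (LINT p|\<nu>. (k (h p))\<^sup>2 * w (h p))"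
    and Ni: "integrable N w \<longleftrightarrow> integrable \<nu> (\<lambda>p. (k (h p))\<^sup>2 * w (h p))"
    if [measurable]: "w \<in> borel_measurable borel" for w :: "real \<Rightarrow> real"
    by (simp_all add: N_def integral_density integrable_density integral_distr integrable_distr_eq)
  have fin: "finite_measure N"
  proof
    have "emeasure N (space N) = (\<integral>\<^sup>+p. ennreal ((k (h p))\<^sup>2) \<partial>\<nu>)"
      by (simp add: N_def emeasure_density nn_integral_distr)
    also have "\<dots> = ennreal (LINT p|\<nu>. (k (h p))\<^sup>2)"
      using \<kappa> by (intro nn_integral_eq_integral) (auto simp: square_integrable_def k_def)
    finally show "emeasure N (space N) \<noteq> \<infinity>" by simp
  qed
  have id: "(\<lambda>x. x) \<in> borel_measurable N" by simp
  have "bounded_algebra N line_trig_poly"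
    unfolding line_trig_poly_def by (rule bounded_algebra_real_trig_poly[OF fin]) (rule id)
  then interpret A: bounded_algebra N line_trig_poly .
  have "(\<lambda>x. x) \<in> borel_measurable A.closure_algebra"
    unfolding line_trig_poly_def
    by (rule measurable_closure_algebra_generator[OF fin _ UNIV_I[of "()"]]) (rule id)
  then have quot: "(\<lambda>x. \<phi> x / k x) \<in> borel_measurable A.closure_algebra"
    by (rule measurable_compose[where g="\<lambda>y. \<phi> y / k y"]) measurable
  have qint: "integrable N (\<lambda>x. (\<phi> x / k x)\<^sup>2)"
  proof (subst Ni)
    have "integrable \<nu> (\<lambda>p. (\<phi> (h p) * of_bool (k (h p) \<noteq> 0))\<^sup>2)"
    proof (rule Bochner_Integration.integrable_bound)
      show "integrable \<nu> (\<lambda>p. (\<phi> (h p))\<^sup>2)" using int by (simp add: square_integrable_def)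
    qed auto
    also have "(\<lambda>p. (\<phi> (h p) * of_bool (k (h p) \<noteq> 0))\<^sup>2) = (\<lambda>p. (k (h p))\<^sup>2 * (\<phi> (h p) / k (h p))\<^sup>2)"
      by (auto simp: power_divide)
    finally show "integrable \<nu> (\<lambda>p. (k (h p))\<^sup>2 * (\<phi> (h p) / k (h p))\<^sup>2)" .
  qed measurable
  obtain a where a: "\<And>n. a n \<in> line_trig_poly"
    and lim: "(\<lambda>n::nat. LINT x|N. (a n x - \<phi> x / k x)\<^sup>2) \<longlonglongrightarrow> 0"
    using A.approx_sequence[OF quot qint] by blast
  have am [measurable]: "a n \<in> borel_measurable borel" for n by (rule line_trig_poly_measurable[OF a])
  \<comment> \<open>Approximating the quotient \<open>\<phi> / k\<close> in L2 of \<open>N\<close>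
    is the same as approximating \<phi> by \<open>k * a n\<close> in L2 of \<nu>, except where
    \<open>k\<close> vanishes; there the weight is 0, and the factor \<open>of_bool\<close> discards
    \<phi>.\<close>
  have eq: "(LINT x|N. (a n x - \<phi> x / k x)\<^sup>2) = (LINT p|\<nu>. (k (h p) * a n (h p) - \<phi> (h p) * of_bool (k (h p) \<noteq> 0))\<^sup>2)" for n
  proof -
    have "(k x)\<^sup>2 * (a n x - \<phi> x / k x)\<^sup>2 = (k x * a n x - \<phi> x * of_bool (k x \<noteq> 0))\<^sup>2" for x
      by (cases "k x = 0") (simp_all add: power_mult_distrib[symmetric] right_diff_distrib)
    then show ?thesis by (simp add: N)
  qed
  have kt: "k \<in> line_trig_poly" using line_trig_poly_one_minus_cos[of r] by (simp add: k_def[abs_def])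
  have k0: "k 0 = 0" "(k has_real_derivative 0) (at 0)"
    unfolding k_def[abs_def] by (auto intro!: derivative_eq_intros)
  have "((\<lambda>x. k x * a n x) has_real_derivative 0) (at 0)" for n
  proof -
    obtain d where "(a n has_real_derivative d) (at 0)" using line_trig_poly_differentiable[OF a] by blast
    from DERIV_mult[OF k0(2) this] k0(1) show ?thesis by simp
  qed
  moreover have "square_integrable \<nu> (\<lambda>p. k (h p) * a n (h p))" for n
  proof -
    obtain K where K: "\<And>x. \<bar>a n x\<bar> \<le> K" using line_trig_poly_bounded[OF a] by blast
    show ?thesis
      using \<kappa> by (intro square_integrable_mult_bounded[where K=K]) (simp_all add: k_def K)
  qed
  ultimately show ?thesis
    using lim unfolding eq k_def[symmetric]
    by (intro exI[of _ "\<lambda>n x. k x * a n x"] conjI allI line_trig_poly_mult kt a) (simp_all add: k0)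
qed

text \<open>These functions keep the derivative \<open>c\<close> in \<open>h\<close> at 0 while they
  are uniformly small, so the Gaussian terms persist and the jump integrals disappear. Domination is
  by \<open>\<bar>c\<bar> * sqrt (trunc p)\<close>, since \<open>\<bar>sin (m * x)\<bar> / m\<close>
  is at most both 1 and \<open>\<bar>x\<bar>\<close> for every integer
  \<open>m \<ge> 1\<close>.\<close>

lemma scaled_sin_tendsto:
  fixes h :: "real \<times> real \<Rightarrow> real" and c :: real and n :: nat
  assumes h [measurable]: "h \<in> borel_measurable \<nu>" and le: "\<And>p. (h p)\<^sup>2 \<le> (fst p)\<^sup>2 + (snd p)\<^sup>2"
  defines "s \<equiv> \<lambda>n p. c / real (Suc n) * sin (real (Suc n) * h p)"
  shows "(\<lambda>n. LINT p|\<nu>. (s n p - 0)\<^sup>2) \<longlonglongrightarrow> 0" and "square_integrable \<nu> (s n)"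
proof -
  have w: "square_integrable \<nu> (\<lambda>p. \<bar>c\<bar> * sqrt (trunc p))"
    using trunc_integrable by (intro square_integrable_cmult) (simp add: square_integrable_def)
  have sm [measurable]: "s n \<in> borel_measurable \<nu>" for n unfolding s_def by measurable
  have bd: "\<bar>s n p\<bar> \<le> \<bar>c\<bar> / real (Suc n)" for n p
    unfolding s_def by (simp add: abs_mult mult_left_le divide_right_mono del: of_nat_Suc)
  have bw: "\<bar>s n p - 0\<bar> \<le> \<bar>\<bar>c\<bar> * sqrt (trunc p)\<bar>" for n p
  proof -
    have "\<bar>sin (real (Suc n) * h p)\<bar> \<le> real (Suc n) * \<bar>h p\<bar>"
      using abs_sin_x_le_abs_x[of "real (Suc n) * h p"] by (simp add: abs_mult del: of_nat_Suc)
    moreover have "\<bar>sin (real (Suc n) * h p)\<bar> \<le> real (Suc n) * 1"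
      using abs_sin_le_one[of "real (Suc n) * h p"] by (simp del: abs_sin_le_one)
    ultimately have "\<bar>sin (real (Suc n) * h p)\<bar> \<le> real (Suc n) * min 1 \<bar>h p\<bar>" by (simp add: min_def)
    also have "min 1 \<bar>h p\<bar> \<le> sqrt (trunc p)"
    proof (rule real_le_rsqrt)
      show "(min 1 \<bar>h p\<bar>)\<^sup>2 \<le> trunc p"
      proof (cases "\<bar>h p\<bar> \<le> 1")
        case True
        then show ?thesis using le[of p] abs_square_le_1[of "h p"] by (simp add: trunc_def min_def)
      next
        case False
        then show ?thesis using le[of p] abs_square_le_1[of "h p"] by (simp add: trunc_def min_def)
      qed
    qed
    finally have "\<bar>sin (real (Suc n) * h p)\<bar> / real (Suc n) \<le> sqrt (trunc p)"
      by (simp add: pos_divide_le_eq mult.commute del: of_nat_Suc)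
    then have "\<bar>c\<bar> * (\<bar>sin (real (Suc n) * h p)\<bar> / real (Suc n)) \<le> \<bar>c\<bar> * sqrt (trunc p)"
      by (intro mult_left_mono) auto
    then show ?thesis by (simp add: s_def abs_mult del: of_nat_Suc)
  qed
  show "square_integrable \<nu> (s n)"
    by (rule square_integrable_bound[OF w sm]) (use bw[of n] in simp)
  show "(\<lambda>n. LINT p|\<nu>. (s n p - 0)\<^sup>2) \<longlonglongrightarrow> 0"
  proof (rule tendsto_integral_square_dominated[OF sm _ w _ bw])
    fix p
    show "(\<lambda>n. s n p) \<longlonglongrightarrow> 0"
    proof (rule Lim_null_comparison)
      show "eventually (\<lambda>n. norm (s n p) \<le> \<bar>c\<bar> / real (Suc n)) sequentially"
        using bd by (simp add: del: of_nat_Suc)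
      show "(\<lambda>n. \<bar>c\<bar> / real (Suc n)) \<longlonglongrightarrow> 0"
        using tendsto_mult_right_zero[OF LIMSEQ_inverse_real_of_nat, of "\<bar>c\<bar>"] by (simp add: divide_inverse)
    qed
  qed simp
qed

text \<open>The zeros of the cutoff are the multiples of \<open>2 * pi * Suc n\<close>; all except 0
  move off to infinity and eventually miss \<open>x\<close>.\<close>

lemma tendsto_indicator_cos:
  assumes "x \<noteq> 0"
  shows "eventually (\<lambda>n. 1 - cos (1 / real (Suc n) * x) \<noteq> 0) sequentially"
proof -
  have "(\<lambda>n. 1 / real (Suc n) * x) \<longlonglongrightarrow> 0"
    using tendsto_mult_left_zero[OF LIMSEQ_inverse_real_of_nat, of x] by (simp add: inverse_eq_divide)
  then have "eventually (\<lambda>n. \<bar>1 / real (Suc n) * x\<bar> < 2 * pi) sequentially"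
    by (intro order_tendstoD(2)[OF tendsto_rabs_zero]) auto
  then show ?thesis
  proof eventually_elim
    case (elim n)
    let ?y = "1 / real (Suc n) * x"
    have "?y \<noteq> 0" using assms by simp
    show ?case
    proof
      assume "1 - cos ?y = 0"
      then have "cos ?y = 1" by simp
      then obtain m :: int where m: "?y = of_int m * 2 * pi" using cos_one_2pi_int[of ?y] by auto
      with \<open>?y \<noteq> 0\<close> have "1 \<le> \<bar>real_of_int m\<bar>" by (cases "m = 0") auto
      then have "2 * pi \<le> \<bar>real_of_int m\<bar> * (2 * pi)" by simp
      also have "\<dots> = \<bar>?y\<bar>" unfolding m by (simp add: abs_mult)
      finally show False using elim by linarith
    qed
  qed
qed

text \<open>In the limit the cutoff removes only the points with \<open>h p = 0\<close>, and there
  \<phi> contributes nothing because \<open>\<phi> 0 = 0\<close>.\<close>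

lemma tendsto_cos_cutoff:
  fixes h :: "real \<times> real \<Rightarrow> real"
  assumes h [measurable]: "h \<in> borel_measurable \<nu>" and \<phi> [measurable]: "\<phi> \<in> borel_measurable borel"
    and "\<phi> 0 = 0" and int: "square_integrable \<nu> (\<lambda>p. \<phi> (h p))"
  defines "s \<equiv> \<lambda>n p. \<phi> (h p) * of_bool (1 - cos (1 / real (Suc n) * h p) \<noteq> 0)"
  shows "(\<lambda>n. LINT p|\<nu>. (s n p - \<phi> (h p))\<^sup>2) \<longlonglongrightarrow> 0" and "square_integrable \<nu> (s n)"
proof -
  have sm [measurable]: "s n \<in> borel_measurable \<nu>" for n unfolding s_def by measurable
  show "square_integrable \<nu> (s n)"
    by (rule square_integrable_bound[OF int sm]) (simp add: s_def abs_mult)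
  show "(\<lambda>n. LINT p|\<nu>. (s n p - \<phi> (h p))\<^sup>2) \<longlonglongrightarrow> 0"
  proof (rule tendsto_integral_square_dominated[OF sm _ int])
    fix p
    show "(\<lambda>n. s n p) \<longlonglongrightarrow> \<phi> (h p)"
    proof (cases "h p = 0")
      case False
      have "eventually (\<lambda>n. s n p = \<phi> (h p)) sequentially"
        using tendsto_indicator_cos[OF False] by eventually_elim (simp add: s_def)
      then show ?thesis by (rule tendsto_eventually)
    qed (simp add: s_def \<open>\<phi> 0 = 0\<close>)
  qed (auto simp: s_def)
qed

lemma trig_ineq_imp_bounds:
  assumes C: "0 \<le> C"
    and ineq: "\<And>f g d e. f \<in> line_trig_poly \<Longrightarrow> g \<in> line_trig_poly \<Longrightarrow>
      (f has_real_derivative d) (at 0) \<Longrightarrow> (g has_real_derivative e) (at 0) \<Longrightarrow>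
      \<Sigma> $ 1 $ 2 * d * e + (LINT p|\<nu>. (f (fst p) - f 0) * (g (snd p) - g 0))
      \<le> C / 2 * ((\<Sigma> $ 1 $ 1 * d\<^sup>2 + (LINT p|\<nu>. (f (fst p) - f 0)\<^sup>2))
            + (\<Sigma> $ 2 $ 2 * e\<^sup>2 + (LINT p|\<nu>. (g (snd p) - g 0)\<^sup>2)))"
  shows "\<bar>gaussian_correlation \<Sigma>\<bar> \<le> C" and "Op \<nu> \<le> C"
proof -
  have fst [measurable]: "fst \<in> borel_measurable \<nu>" and snd [measurable]: "snd \<in> borel_measurable \<nu>"
    by measurable
  have gauss: "\<Sigma> $ 1 $ 2 * d * e \<le> C / 2 * (\<Sigma> $ 1 $ 1 * d\<^sup>2 + \<Sigma> $ 2 $ 2 * e\<^sup>2)" for d e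
  proof -
    define f where "f c n x = c / real (Suc n) * sin (real (Suc n) * x)" for c x and n :: nat
    have f: "f c n \<in> line_trig_poly" for c n unfolding f_def by (rule line_trig_poly_sin)
    have fd: "(f c n has_real_derivative c) (at 0)" for c n
      unfolding f_def by (auto intro!: derivative_eq_intros simp del: of_nat_Suc)
    have f0: "f c n 0 = 0" for c n by (simp add: f_def)
    have l: "(\<lambda>n. LINT p|\<nu>. (f d n (fst p) - 0)\<^sup>2) \<longlonglongrightarrow> 0" "square_integrable \<nu> (\<lambda>p. f d n (fst p))"
      "(\<lambda>n. LINT p|\<nu>. (f e n (snd p) - 0)\<^sup>2) \<longlonglongrightarrow> 0" "square_integrable \<nu> (\<lambda>p. f e n (snd p))" for n
      unfolding f_def by (intro scaled_sin_tendsto fst snd; simp)+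
    have m: "(\<lambda>n. LINT p|\<nu>. f d n (fst p) * f e n (snd p)) \<longlonglongrightarrow> (LINT p|\<nu>. 0 * 0)"
      by (rule tendsto_integral_mult[OF l(2) _ l(4) _ l(1) l(3)]) (simp_all add: square_integrable_zero)
    have "\<Sigma> $ 1 $ 2 * d * e + (LINT p|\<nu>. f d n (fst p) * f e n (snd p))
      \<le> C / 2 * ((\<Sigma> $ 1 $ 1 * d\<^sup>2 + (LINT p|\<nu>. (f d n (fst p) - 0)\<^sup>2))
            + (\<Sigma> $ 2 $ 2 * e\<^sup>2 + (LINT p|\<nu>. (f e n (snd p) - 0)\<^sup>2)))" for n
      using ineq[OF f f fd[of d n] fd[of e n]] by (simp add: f0)
    then have "\<Sigma> $ 1 $ 2 * d * e + (LINT p|\<nu>. 0 * 0) \<le> C / 2 * ((\<Sigma> $ 1 $ 1 * d\<^sup>2 + 0) + (\<Sigma> $ 2 $ 2 * e\<^sup>2 + 0))"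
      by (intro LIMSEQ_le[OF tendsto_add[OF tendsto_const m] tendsto_mult[OF tendsto_const
            tendsto_add[OF tendsto_add[OF tendsto_const l(1)] tendsto_add[OF tendsto_const l(3)]]]]) blast
    then show ?thesis by simp
  qed
  show "\<bar>gaussian_correlation \<Sigma>\<bar> \<le> C"
  proof (cases "\<Sigma> $ 1 $ 1 * \<Sigma> $ 2 $ 2 > 0")
    case True
    then have pos: "0 < \<Sigma> $ 1 $ 1" "0 < \<Sigma> $ 2 $ 2"
      using Sigma_diag_nonneg by (auto simp: zero_less_mult_iff)
    \<comment> \<open>The arguments make both diagonal terms equal to 1; the signs
      \<open>s = 1\<close> and \<open>s = -1\<close> bound the correlation and its negative.\<close>
    have "\<Sigma> $ 1 $ 2 * (s / sqrt (\<Sigma> $ 1 $ 1)) * (1 / sqrt (\<Sigma> $ 2 $ 2)) \<le> C" if "s\<^sup>2 = 1" for s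
      using gauss[of "s / sqrt (\<Sigma> $ 1 $ 1)" "1 / sqrt (\<Sigma> $ 2 $ 2)"] pos that by (simp add: power_divide)
    from this[of 1] this[of "-1"] True show ?thesis
      by (simp add: gaussian_correlation_def real_sqrt_mult)
  qed (simp add: gaussian_correlation_def C)
  \<comment> \<open>Two successive limits. For fixed \<open>n\<close>, polynomials that vanish to
    second order at 0 approximate the cut-off functions; their zero derivatives remove all entries
    of \<Sigma> from the inequality. Then \<open>n\<close> tends to infinity and the cutoff
    disappears.\<close>
  have jump: "(LINT p|\<nu>. \<phi> (fst p) * \<psi> (snd p))
      \<le> C / 2 * ((LINT p|\<nu>. (\<phi> (fst p))\<^sup>2) + (LINT p|\<nu>. (\<psi> (snd p))\<^sup>2))"
    if \<phi>: "\<phi> \<in> borel_measurable borel" "\<phi> 0 = 0" "square_integrable \<nu> (\<lambda>p. \<phi> (fst p))"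
      and \<psi>: "\<psi> \<in> borel_measurable borel" "\<psi> 0 = 0" "square_integrable \<nu> (\<lambda>p. \<psi> (snd p))" for \<phi> \<psi>
  proof -
    define F where "F n p = \<phi> (fst p) * of_bool (1 - cos (1 / real (Suc n) * fst p) \<noteq> 0)" for n and p :: "real \<times> real"
    define G where "G n p = \<psi> (snd p) * of_bool (1 - cos (1 / real (Suc n) * snd p) \<noteq> 0)" for n and p :: "real \<times> real"
    have F: "(\<lambda>n. LINT p|\<nu>. (F n p - \<phi> (fst p))\<^sup>2) \<longlonglongrightarrow> 0" "square_integrable \<nu> (F n)" for n
      unfolding F_def by (rule tendsto_cos_cutoff[OF fst \<phi>])+
    have G: "(\<lambda>n. LINT p|\<nu>. (G n p - \<psi> (snd p))\<^sup>2) \<longlonglongrightarrow> 0" "square_integrable \<nu> (G n)" for n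
      unfolding G_def by (rule tendsto_cos_cutoff[OF snd \<psi>])+
    have le: "(LINT p|\<nu>. F n p * G n p) \<le> C / 2 * ((LINT p|\<nu>. F n p * F n p) + (LINT p|\<nu>. G n p * G n p))" for n
    proof -
      \<comment> \<open>\<open>1 - cos\<close> is the real part of \<open>-1 * jump_char\<close>,
        which is square-integrable for every Levy measure.\<close>
      have "square_integrable \<nu> (\<lambda>p. 1 - cos (1 / real (Suc n) * fst p))"
        using jump_char_square_integrable(1)[of "-1" "1 / real (Suc n)" 0] by (simp add: jump_char_def)
      from line_approx[OF fst this \<phi>(1,3)] obtain f where f: "\<And>m. f m \<in> line_trig_poly" "\<And>m. f m 0 = 0"
        "\<And>m. (f m has_real_derivative 0) (at 0)" "\<And>m. square_integrable \<nu> (\<lambda>p. f m (fst p))"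
        and fl: "(\<lambda>m::nat. LINT p|\<nu>. (f m (fst p) - F n p)\<^sup>2) \<longlonglongrightarrow> 0"
        unfolding F_def by blast
      have "square_integrable \<nu> (\<lambda>p. 1 - cos (1 / real (Suc n) * snd p))"
        using jump_char_square_integrable(1)[of "-1" 0 "1 / real (Suc n)"] by (simp add: jump_char_def)
      from line_approx[OF snd this \<psi>(1,3)] obtain g where g: "\<And>m. g m \<in> line_trig_poly" "\<And>m. g m 0 = 0"
        "\<And>m. (g m has_real_derivative 0) (at 0)" "\<And>m. square_integrable \<nu> (\<lambda>p. g m (snd p))"
        and gl: "(\<lambda>m::nat. LINT p|\<nu>. (g m (snd p) - G n p)\<^sup>2) \<longlonglongrightarrow> 0"
        unfolding G_def by blast
      note lims = tendsto_integral_mult[OF f(4) F(2) g(4) G(2) fl gl]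
        tendsto_integral_mult[OF f(4) F(2) f(4) F(2) fl fl] tendsto_integral_mult[OF g(4) G(2) g(4) G(2) gl gl]
      have "(LINT p|\<nu>. f m (fst p) * g m (snd p))
        \<le> C / 2 * ((LINT p|\<nu>. f m (fst p) * f m (fst p)) + (LINT p|\<nu>. g m (snd p) * g m (snd p)))" for m
        using ineq[OF f(1) g(1) f(3) g(3), of m m] by (simp add: f(2) g(2) power2_eq_square)
      then show ?thesis
        by (intro LIMSEQ_le[OF lims(1) tendsto_mult[OF tendsto_const tendsto_add[OF lims(2,3)]]]) blast
    qed
    note lims = tendsto_integral_mult[OF F(2) \<phi>(3) G(2) \<psi>(3) F(1) G(1)]
      tendsto_integral_mult[OF F(2) \<phi>(3) F(2) \<phi>(3) F(1) F(1)] tendsto_integral_mult[OF G(2) \<psi>(3) G(2) \<psi>(3) G(1) G(1)]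
    show ?thesis
      unfolding power2_eq_square
      using le by (intro LIMSEQ_le[OF lims(1) tendsto_mult[OF tendsto_const tendsto_add[OF lims(2,3)]]]) blast
  qed
  have "op_bound \<nu> C"
    unfolding op_bound_def case_prod_unfold
  proof (intro conjI ballI impI C)
    fix \<phi> \<psi> :: "real \<Rightarrow> real"
    assume [measurable]: "\<phi> \<in> borel_measurable borel" "\<psi> \<in> borel_measurable borel"
      and asm: "\<phi> 0 = 0 \<and> \<psi> 0 = 0 \<and> integrable \<nu> (\<lambda>p. (\<phi> (fst p))\<^sup>2) \<and> integrable \<nu> (\<lambda>p. (\<psi> (snd p))\<^sup>2)"
    then have sq: "square_integrable \<nu> (\<lambda>p. \<phi> (fst p))" "square_integrable \<nu> (\<lambda>p. \<psi> (snd p))"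
      by (auto simp: square_integrable_def)
    show "(LINT p|\<nu>. \<phi> (fst p) * \<psi> (snd p))
        \<le> C * sqrt ((LINT p|\<nu>. (\<phi> (fst p))\<^sup>2) * (LINT p|\<nu>. (\<psi> (snd p))\<^sup>2))"
    proof (rule le_sqrt_of_scaled)
      fix l :: real assume l: "0 < l"
      \<comment> \<open>The inequality \<open>jump\<close> is additive; rescaling the pair by
        \<open>sqrt l\<close> and \<open>1 / sqrt l\<close> for all \<open>l > 0\<close> recovers
        the geometric mean required by \<open>op_bound\<close>.\<close>
      have "(LINT p|\<nu>. (sqrt l * \<phi> (fst p)) * (1 / sqrt l * \<psi> (snd p)))
          \<le> C / 2 * ((LINT p|\<nu>. (sqrt l * \<phi> (fst p))\<^sup>2) + (LINT p|\<nu>. (1 / sqrt l * \<psi> (snd p))\<^sup>2))"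
        by (rule jump[of "\<lambda>x. sqrt l * \<phi> x" "\<lambda>x. 1 / sqrt l * \<psi> x"])
           (use asm sq in \<open>auto intro!: square_integrable_cmult simp del: times_divide_eq_left\<close>)
      then show "(LINT p|\<nu>. \<phi> (fst p) * \<psi> (snd p))
          \<le> C / 2 * (l * (LINT p|\<nu>. (\<phi> (fst p))\<^sup>2) + (LINT p|\<nu>. (\<psi> (snd p))\<^sup>2) / l)"
        using l by (simp add: power_mult_distrib power_divide)
    qed (use C in auto)
  qed
  then show "Op \<nu> \<le> C" by (rule Op_le)
qed

end

subsection \<open>Maximal correlation\<close>

lemma coordinate_measurable:
  assumes "0 \<le> t"
  shows "(\<lambda>w. w t) \<in> borel_measurable cadlag_space"
  unfolding cadlag_space_def
  using assms by (intro measurable_restrict_space1 measurable_component_singleton) simp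

context prob_space
begin

lemma square_integrable_integrable:
  assumes "square_integrable M U"
  shows "integrable M U"
  using square_integrable_mult[OF assms, of "\<lambda>_. 1"] by (simp add: square_integrable_def)

lemma covariance_eq:
  assumes U: "square_integrable M U" and V: "square_integrable M V"
  shows "expectation (\<lambda>\<omega>. (U \<omega> - expectation U) * (V \<omega> - expectation V))
    = expectation (\<lambda>\<omega>. U \<omega> * V \<omega>) - expectation U * expectation V"
proof -
  note int = square_integrable_integrable[OF U] square_integrable_integrable[OF V] square_integrable_mult[OF U V]
  have "expectation (\<lambda>\<omega>. (U \<omega> - expectation U) * (V \<omega> - expectation V))
    = expectation (\<lambda>\<omega>. U \<omega> * V \<omega> - expectation V * U \<omega> - expectation U * V \<omega> + expectation U * expectation V)"
    by (intro Bochner_Integration.integral_cong) (auto simp: algebra_simps)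
  also have "\<dots> = expectation (\<lambda>\<omega>. U \<omega> * V \<omega>) - expectation U * expectation V"
    using int by (simp add: prob_space)
  finally show ?thesis .
qed

lemma variance_eq_square:
  assumes "square_integrable M U"
  shows "variance U = expectation (\<lambda>\<omega>. U \<omega> * U \<omega>) - expectation U * expectation U"
  using covariance_eq[OF assms assms] by (simp add: power2_eq_square)

lemma AE_const_covariance:
  fixes U V :: "'a \<Rightarrow> real"
  assumes [measurable]: "U \<in> borel_measurable M" and U: "AE \<omega> in M. U \<omega> = c"
  shows "expectation (\<lambda>\<omega>. (U \<omega> - expectation U) * (V \<omega> - expectation V)) = 0"
    and "expectation (\<lambda>\<omega>. (V \<omega> - expectation V) * (U \<omega> - expectation U)) = 0"
proof -
  have ae: "AE \<omega> in M. U \<omega> - expectation U = 0"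
  proof -
    have "expectation U = expectation (\<lambda>_. c)" using U by (intro integral_cong_AE) auto
    then have "expectation U = c" by (simp add: prob_space)
    with U show ?thesis by simp
  qed
  show "expectation (\<lambda>\<omega>. (U \<omega> - expectation U) * (V \<omega> - expectation V)) = 0"
    using ae by (intro integral_eq_zero_AE) auto
  show "expectation (\<lambda>\<omega>. (V \<omega> - expectation V) * (U \<omega> - expectation U)) = 0"
    using ae by (intro integral_eq_zero_AE) auto
qed

lemma variance_zero_AE:
  assumes U: "square_integrable M U" and "variance U = 0"
  shows "AE \<omega> in M. U \<omega> = expectation U"
proof -
  have "square_integrable M (\<lambda>\<omega>. U \<omega> - expectation U)"
    by (intro square_integrable_diff U) (simp add: square_integrable_def)
  then have "AE \<omega> in M. (U \<omega> - expectation U)\<^sup>2 = 0"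
    using assms(2) by (subst integral_nonneg_eq_0_iff_AE[symmetric]) (auto simp: square_integrable_def)
  then show ?thesis by eventually_elim simp
qed

text \<open>The witness is composed with \<open>arctan\<close>: injectivity keeps it non-constant, boundedness makes it
  square-integrable.\<close>
lemma nondegenerate_bounded:
  assumes X: "X \<in> measurable M N" and nd: "\<not> degenerate M N X"
  shows "\<exists>\<phi>\<in>borel_measurable N. integrable M (\<lambda>\<omega>. (\<phi> (X \<omega>))\<^sup>2) \<and> 0 < variance (\<lambda>\<omega>. \<phi> (X \<omega>) :: real)"
proof -
  obtain \<phi> where \<phi>: "\<phi> \<in> borel_measurable N" and nc: "\<And>c::real. \<not> (AE \<omega> in M. \<phi> (X \<omega>) = c)"
    using nd by (auto simp: degenerate_def)
  let ?\<psi> = "\<lambda>x. arctan (\<phi> x)"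
  have m: "?\<psi> \<in> borel_measurable N" using \<phi> by measurable
  have sq: "square_integrable M (\<lambda>\<omega>. ?\<psi> (X \<omega>))"
  proof (rule square_integrable_bounded)
    show "(\<lambda>\<omega>. ?\<psi> (X \<omega>)) \<in> borel_measurable M" by (rule measurable_compose[OF X m])
    show "\<bar>?\<psi> (X \<omega>)\<bar> \<le> pi / 2" for \<omega>
      using arctan_lbound[of "\<phi> (X \<omega>)"] arctan_ubound[of "\<phi> (X \<omega>)"] by linarith
  qed
  have "variance (\<lambda>\<omega>. ?\<psi> (X \<omega>)) \<noteq> 0"
  proof
    assume "variance (\<lambda>\<omega>. ?\<psi> (X \<omega>)) = 0"
    from variance_zero_AE[OF sq this]
    have "AE \<omega> in M. \<phi> (X \<omega>) = tan (expectation (\<lambda>\<omega>. ?\<psi> (X \<omega>)))"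
      by eventually_elim (metis tan_arctan)
    then show False using nc by blast
  qed
  moreover have "0 \<le> variance (\<lambda>\<omega>. ?\<psi> (X \<omega>))" by (rule variance_positive)
  ultimately have "0 < variance (\<lambda>\<omega>. ?\<psi> (X \<omega>))" by linarith
  then show ?thesis using sq by (intro bexI[of _ ?\<psi>] conjI m) (simp add: square_integrable_def)
qed

end

section \<open>Comparison of the maximal correlation with the two constants\<close>

context levy_pair
begin

abbreviation R :: real where
  "R \<equiv> maximal_correlation M cadlag_space cadlag_space (sample_path X) (sample_path Y)"

abbreviation C0 :: real where
  "C0 \<equiv> max \<bar>gaussian_correlation \<Sigma>\<bar> (Op \<nu>)"

lemma path_X_measurable: "sample_path X \<in> measurable M cadlag_space"
  by (rule sample_path_measurable[OF X_measurable cadlag_X])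

lemma path_Y_measurable: "sample_path Y \<in> measurable M cadlag_space"
  by (rule sample_path_measurable[OF Y_measurable cadlag_Y])

lemma path_square_integrable:
  assumes "\<phi> \<in> borel_measurable cadlag_space"
  shows "integrable M (\<lambda>\<omega>. (\<phi> (sample_path X \<omega>))\<^sup>2) \<Longrightarrow> square_integrable M (\<lambda>\<omega>. \<phi> (sample_path X \<omega>))"
    and "integrable M (\<lambda>\<omega>. (\<phi> (sample_path Y \<omega>))\<^sup>2) \<Longrightarrow> square_integrable M (\<lambda>\<omega>. \<phi> (sample_path Y \<omega>))"
  using measurable_compose[OF path_X_measurable assms] measurable_compose[OF path_Y_measurable assms]
  by (simp_all add: square_integrable_def)

text \<open>\<open>covariance_le\<close> bounds the covariance by an arithmetic mean of variances
  only. It is applied to \<open>sqrt l * \<phi>\<close> and \<open>1 / sqrt l * \<psi>\<close> for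
  all \<open>l > 0\<close>, which keeps the covariance and optimises the mean to the product of
  standard deviations.\<close>

lemma pearson_le:
  assumes \<phi>: "\<phi> \<in> borel_measurable cadlag_space" "integrable M (\<lambda>\<omega>. (\<phi> (sample_path X \<omega>))\<^sup>2)"
    and \<psi>: "\<psi> \<in> borel_measurable cadlag_space" "integrable M (\<lambda>\<omega>. (\<psi> (sample_path Y \<omega>))\<^sup>2)"
    and pos: "0 < variance (\<lambda>\<omega>. \<phi> (sample_path X \<omega>))" "0 < variance (\<lambda>\<omega>. \<psi> (sample_path Y \<omega>))"
  shows "pearson_correlation M (\<lambda>\<omega>. \<phi> (sample_path X \<omega>)) (\<lambda>\<omega>. \<psi> (sample_path Y \<omega>)) \<le> C0"
proof -
  define U where "U = (\<lambda>\<omega>. \<phi> (sample_path X \<omega>))"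
  define V where "V = (\<lambda>\<omega>. \<psi> (sample_path Y \<omega>))"
  have U: "square_integrable M U" and V: "square_integrable M V"
    unfolding U_def V_def using path_square_integrable \<phi> \<psi> by blast+
  let ?cov = "expectation (\<lambda>\<omega>. (U \<omega> - expectation U) * (V \<omega> - expectation V))"
  have "?cov \<le> C0 * sqrt (variance U * variance V)"
  proof (rule le_sqrt_of_scaled)
    fix l :: real assume l: "0 < l"
    have 1: "(\<lambda>x. sqrt l * \<phi> x) \<in> borel_measurable cadlag_space" "(\<lambda>x. 1 / sqrt l * \<psi> x) \<in> borel_measurable cadlag_space"
      using \<phi>(1) \<psi>(1) by measurable
    have 2: "integrable M (\<lambda>\<omega>. (sqrt l * \<phi> (sample_path X \<omega>))\<^sup>2)"
      "integrable M (\<lambda>\<omega>. (1 / sqrt l * \<psi> (sample_path Y \<omega>))\<^sup>2)"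
      using \<phi>(2) \<psi>(2) unfolding power_mult_distrib by (intro integrable_mult_right; simp)+
    have eqs: "sqrt l * u * (1 / sqrt l * v) = u * v" "sqrt l * u * (sqrt l * v) = l * (u * v)"
      "1 / sqrt l * u * (1 / sqrt l * v) = (u * v) / l" for u v
      using l by (simp_all add: field_simps)
    have eqs': "sqrt l * u * (v / sqrt l) = u * v" "(u / sqrt l) * (v / sqrt l) = (u * v) / l" for u v
      using l by (simp_all add: field_simps)
    have "expectation (\<lambda>\<omega>. U \<omega> * V \<omega>) - expectation U * expectation V
      \<le> C0 / 2 * ((l * expectation (\<lambda>\<omega>. U \<omega> * U \<omega>) - l * (expectation U * expectation U))
        + (expectation (\<lambda>\<omega>. V \<omega> * V \<omega>) / l - expectation V * expectation V / l))"
      using covariance_le[OF 1(1) 2(1) 1(2) 2(2)] unfolding U_def V_def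
      by (simp only: eqs eqs' integral_mult_right_zero integral_divide_zero)
    also have "\<dots> = C0 / 2 * (l * variance U + variance V / l)"
      unfolding variance_eq_square[OF U] variance_eq_square[OF V]
      by (simp add: right_diff_distrib diff_divide_distrib)
    finally show "?cov \<le> C0 / 2 * (l * variance U + variance V / l)"
      unfolding covariance_eq[OF U V] .
  qed (use Op_nonneg in \<open>auto intro: variance_positive\<close>)
  moreover have "0 < sqrt (variance U * variance V)"
    using pos by (simp add: U_def V_def)
  ultimately show ?thesis
    unfolding pearson_correlation_def U_def[symmetric] V_def[symmetric]
    by (simp only: pos_divide_le_eq)
qed

definition correlations :: "real set" where
  "correlations = {pearson_correlation M (\<lambda>\<omega>. \<phi> (sample_path X \<omega>)) (\<lambda>\<omega>. \<psi> (sample_path Y \<omega>)) | \<phi> \<psi>.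
     \<phi> \<in> borel_measurable cadlag_space \<and> \<psi> \<in> borel_measurable cadlag_space \<and>
     integrable M (\<lambda>\<omega>. (\<phi> (sample_path X \<omega>))\<^sup>2) \<and> integrable M (\<lambda>\<omega>. (\<psi> (sample_path Y \<omega>))\<^sup>2) \<and>
     variance (\<lambda>\<omega>. \<phi> (sample_path X \<omega>)) > 0 \<and> variance (\<lambda>\<omega>. \<psi> (sample_path Y \<omega>)) > 0}"

abbreviation degenerate_pair :: bool where
  "degenerate_pair \<equiv> degenerate M cadlag_space (sample_path X) \<or> degenerate M cadlag_space (sample_path Y)"

lemma R_eq: "R = (if degenerate_pair then 0 else Sup correlations)"
  unfolding maximal_correlation_def correlations_def ..

lemma correlations_le:
  assumes "r \<in> correlations"
  shows "r \<le> C0"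
  using assms unfolding correlations_def
  by (elim CollectE exE conjE) (simp only: pearson_le)

lemma correlations_le_R:
  assumes "\<not> degenerate_pair" "r \<in> correlations"
  shows "r \<le> R"
proof -
  have "r \<le> Sup correlations"
    by (rule cSup_upper[OF assms(2) bdd_aboveI[of _ C0]]) (rule correlations_le)
  then show ?thesis using assms(1) by (simp add: R_eq)
qed

text \<open>Replacing \<phi> by its negative reverses the sign of the coefficient. Having both signs
  gives \<open>0 \<le> R\<close> as well as a nonempty set for the supremum.\<close>

lemma correlations_nonempty:
  assumes "\<not> degenerate_pair"
  shows "\<exists>r. r \<in> correlations \<and> - r \<in> correlations"
proof -
  obtain \<phi> :: "(real \<Rightarrow> real) \<Rightarrow> real" where \<phi>: "\<phi> \<in> borel_measurable cadlag_space" "integrable M (\<lambda>\<omega>. (\<phi> (sample_path X \<omega>))\<^sup>2)"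
    "0 < variance (\<lambda>\<omega>. \<phi> (sample_path X \<omega>))"
    using nondegenerate_bounded[OF path_X_measurable] assms by blast
  obtain \<psi> :: "(real \<Rightarrow> real) \<Rightarrow> real" where \<psi>: "\<psi> \<in> borel_measurable cadlag_space" "integrable M (\<lambda>\<omega>. (\<psi> (sample_path Y \<omega>))\<^sup>2)"
    "0 < variance (\<lambda>\<omega>. \<psi> (sample_path Y \<omega>))"
    using nondegenerate_bounded[OF path_Y_measurable] assms by blast
  let ?U = "\<lambda>\<omega>. \<phi> (sample_path X \<omega>)" and ?V = "\<lambda>\<omega>. \<psi> (sample_path Y \<omega>)"
  have e: "expectation (\<lambda>\<omega>. - ?U \<omega>) = - expectation ?U" by simp
  have v: "variance (\<lambda>\<omega>. - ?U \<omega>) = variance ?U"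
    unfolding e by (intro Bochner_Integration.integral_cong refl) (simp add: power2_commute)
  have "pearson_correlation M ?U ?V \<in> correlations"
    unfolding correlations_def using \<phi> \<psi> by blast
  moreover have "pearson_correlation M (\<lambda>\<omega>. - ?U \<omega>) ?V \<in> correlations"
  proof -
    have "(\<lambda>x. - \<phi> x) \<in> borel_measurable cadlag_space" using \<phi>(1) by measurable
    moreover have "integrable M (\<lambda>\<omega>. (- ?U \<omega>)\<^sup>2)" using \<phi>(2) by simp
    moreover have "0 < variance (\<lambda>\<omega>. - ?U \<omega>)" unfolding v by (rule \<phi>(3))
    ultimately show ?thesis unfolding correlations_def using \<psi>
      by (intro CollectI exI[of _ "\<lambda>x. - \<phi> x"] exI[of _ \<psi>] conjI refl) assumption+
  qed
  moreover have "pearson_correlation M (\<lambda>\<omega>. - ?U \<omega>) ?V = - pearson_correlation M ?U ?V"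
    unfolding pearson_correlation_def v
    by (simp only: e minus_diff_minus mult_minus_left Bochner_Integration.integral_minus minus_divide_left)
  ultimately show ?thesis by metis
qed

lemma R_nonneg: "0 \<le> R"
proof (cases degenerate_pair)
  case False
  then obtain r where "r \<in> correlations" "- r \<in> correlations" using correlations_nonempty by blast
  then have "r \<le> R" "- r \<le> R" using correlations_le_R[OF False] by blast+
  then show ?thesis by linarith
qed (simp add: R_eq)

lemma R_le: "R \<le> C0"
proof (cases degenerate_pair)
  case True
  then show ?thesis using Op_nonneg by (auto simp: R_eq)
next
  case False
  then have "correlations \<noteq> {}" using correlations_nonempty by blast
  then have "Sup correlations \<le> C0" by (rule cSup_least) (rule correlations_le)
  then show ?thesis using False by (simp add: R_eq)
qed

lemma covariance_le_R:
  assumes \<phi>: "\<phi> \<in> borel_measurable cadlag_space" "integrable M (\<lambda>\<omega>. (\<phi> (sample_path X \<omega>))\<^sup>2)"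
    and \<psi>: "\<psi> \<in> borel_measurable cadlag_space" "integrable M (\<lambda>\<omega>. (\<psi> (sample_path Y \<omega>))\<^sup>2)"
  defines "U \<equiv> \<lambda>\<omega>. \<phi> (sample_path X \<omega>)" and "V \<equiv> \<lambda>\<omega>. \<psi> (sample_path Y \<omega>)"
  shows "expectation (\<lambda>\<omega>. (U \<omega> - expectation U) * (V \<omega> - expectation V))
    \<le> R / 2 * (variance U + variance V)" (is "?cov \<le> _")
proof -
  have U: "square_integrable M U" and V: "square_integrable M V"
    unfolding U_def V_def using path_square_integrable \<phi> \<psi> by blast+
  have nonneg: "0 \<le> R / 2 * (variance U + variance V)"
    by (intro mult_nonneg_nonneg add_nonneg_nonneg variance_positive) (simp add: R_nonneg)
  show ?thesis
  proof (cases "(\<exists>c. AE \<omega> in M. U \<omega> = c) \<or> (\<exists>c. AE \<omega> in M. V \<omega> = c)")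
    case True
    then have "?cov = 0"
      using AE_const_covariance(1)[where U=U and V=V, OF square_integrable_measurable[OF U]]
        AE_const_covariance(2)[where U=V and V=U, OF square_integrable_measurable[OF V]] by blast
    with nonneg show ?thesis by simp
  next
    case False
    \<comment> \<open>\<open>U\<close> and \<open>V\<close> are themselves nonconstant measurable
      functions of the two paths, so neither path is degenerate and \<open>R\<close> is the
      supremum.\<close>
    then have nd: "\<not> degenerate_pair"
      unfolding degenerate_def U_def V_def using \<phi> \<psi> by blast
    have "variance U \<noteq> 0" "variance V \<noteq> 0"
      using False variance_zero_AE[OF U] variance_zero_AE[OF V] by blast+
    then have pos: "0 < variance U" "0 < variance V"
      using variance_positive[of U] variance_positive[of V] by linarith+
    then have "pearson_correlation M U V \<in> correlations"
      unfolding correlations_def U_def V_def using \<phi> \<psi> by blast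
    then have "pearson_correlation M U V \<le> R" by (rule correlations_le_R[OF nd])
    moreover have s: "0 < sqrt (variance U * variance V)" using pos by simp
    ultimately have "?cov \<le> R * sqrt (variance U * variance V)"
      unfolding pearson_correlation_def by (simp only: pos_divide_le_eq)
    also have "\<dots> \<le> R * ((variance U + variance V) / 2)"
      using pos by (intro mult_left_mono arith_geo_mean_sqrt R_nonneg) auto
    finally show ?thesis by simp
  qed
qed

text \<open>Functions of \<open>X t\<close> and \<open>Y t\<close> at one time are enough: the
  small-time limit of their covariance inequality already forces both constants below
  \<open>R\<close>.\<close>

lemma C0_le_R: "C0 \<le> R"
proof -
  have cov: "(LINT \<omega>|M. f (X t \<omega>) * g (Y t \<omega>)) - (LINT \<omega>|M. f (X t \<omega>)) * (LINT \<omega>|M. g (Y t \<omega>))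
      \<le> R / 2 * (((LINT \<omega>|M. f (X t \<omega>) * f (X t \<omega>)) - (LINT \<omega>|M. f (X t \<omega>)) * (LINT \<omega>|M. f (X t \<omega>)))
        + ((LINT \<omega>|M. g (Y t \<omega>) * g (Y t \<omega>)) - (LINT \<omega>|M. g (Y t \<omega>)) * (LINT \<omega>|M. g (Y t \<omega>))))"
    if t: "0 < t" and f: "f \<in> line_trig_poly" and g: "g \<in> line_trig_poly" for t f g
  proof -
    have t0: "0 \<le> t" using t by simp
    have m: "(\<lambda>w. h (w t)) \<in> borel_measurable cadlag_space" if "h \<in> line_trig_poly" for h
      by (rule measurable_compose[OF coordinate_measurable[OF t0] line_trig_poly_measurable[OF that]])
    have path: "sample_path Z \<omega> t = Z t \<omega>" for Z :: "real \<Rightarrow> 'a \<Rightarrow> real" and \<omega>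
      using t0 by (simp add: sample_path_def)
    have sq: "square_integrable M (\<lambda>\<omega>. h (Z t \<omega>))"
      if h: "h \<in> line_trig_poly" and Z: "Z t \<in> borel_measurable M" for h and Z :: "real \<Rightarrow> 'a \<Rightarrow> real"
    proof -
      obtain K where "\<And>x. \<bar>h x\<bar> \<le> K" using line_trig_poly_bounded[OF h] by blast
      then show ?thesis
        by (intro square_integrable_bounded[of _ K] measurable_compose[OF Z line_trig_poly_measurable[OF h]])
    qed
    have F: "square_integrable M (\<lambda>\<omega>. f (X t \<omega>))" by (rule sq[OF f, of X, OF X_measurable[OF t0]])
    have G: "square_integrable M (\<lambda>\<omega>. g (Y t \<omega>))" by (rule sq[OF g, of Y, OF Y_measurable[OF t0]])
    have "expectation (\<lambda>\<omega>. (f (X t \<omega>) - expectation (\<lambda>\<omega>. f (X t \<omega>))) * (g (Y t \<omega>) - expectation (\<lambda>\<omega>. g (Y t \<omega>))))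
      \<le> R / 2 * (variance (\<lambda>\<omega>. f (X t \<omega>)) + variance (\<lambda>\<omega>. g (Y t \<omega>)))"
      using covariance_le_R[OF m[OF f] _ m[OF g] _] F G unfolding path square_integrable_def by blast
    then show ?thesis
      unfolding covariance_eq[OF F G] variance_eq_square[OF F] variance_eq_square[OF G] .
  qed
  have "\<bar>gaussian_correlation \<Sigma>\<bar> \<le> R"
    by (rule trig_ineq_imp_bounds(1)[OF R_nonneg], rule small_time_ineq[OF cov])
  moreover have "Op \<nu> \<le> R"
    by (rule trig_ineq_imp_bounds(2)[OF R_nonneg], rule small_time_ineq[OF cov])
  ultimately show ?thesis by simp
qed

end

theorem theorem1p2:
  fixes M :: "'a measure"
    and X Y :: "real \<Rightarrow> 'a \<Rightarrow> real"
    and b :: "real ^ 2" and \<Sigma> :: "real ^ 2 ^ 2" and \<nu> :: "(real \<times> real) measure"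
  assumes "levy_process M (\<lambda>t \<omega>. (X t \<omega>, Y t \<omega>))"
    and "has_characteristic_triple M (\<lambda>t \<omega>. (X t \<omega>, Y t \<omega>)) b \<Sigma> \<nu>"
  shows "maximal_correlation M cadlag_space cadlag_space (sample_path X) (sample_path Y)
    = max \<bar>gaussian_correlation \<Sigma>\<bar> (Op \<nu>)"
proof -
  interpret levy_pair M X Y b \<Sigma> \<nu> by (rule levy_pair.intro) fact+
  show ?thesis using R_le C0_le_R by (rule antisym)
qed

end
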